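(* Let $P=\langle x\mid x=xx\rangle$, so that the diagram group $D(P,x)$ is isomorphic to R. Thompson's group $F$. Then $D(P,x)$ does not act on the cube complex $K(P,x)$ by semi-simple isometries: there is an element $g\in D(P,x)$ such that $\inf\{d(y,gy): y\in K(P,x)\}$ is not attained at any point $y\in K(P,x)$, i.e. $g$ acts on $K(P,x)$ as a parabolic isometry.
   Context: Diagrams (over a finite presentation). Let $A$ be a finite alphabet and $R$ a finite set of pairs $(u,v)$ of nonempty words over $A$ with $u\neq v$ and with $(u,v)\in R\Rightarrow (v,u)\in R$; $P=\langle A\mid u=v,\ (u,v)\in R\rangle$. For $P=\langle x\mid x=xx\rangle$ we have $A=\{x\}$, $R=\{(x,xx),(xx,x)\}$. A degenerate diagram is a left-to-right path whose edges are labelled by letters, reading a word $w$; its top and bottom labels are both $w$. A cell $C(u,v)$, $(u,v)\in R$, is a planar disk bounded by a top path labelled $u$ and a bottom path labelled $v$, with common left and right endpoints, both oriented left to right. A diagram is obtained from a degenerate diagram by successively attaching finitely many cells from below: a cell $C(u,v)$ is attached by identifying its top path with a subpath labelled $u$ of the current bottom path, and that subpath is replaced in the bottom path by the bottom path of the cell. Diagrams are considered up to label-preserving planar isotopy. $top(U)$, $bot(U)$ denote the words labelling the top and bottom paths of $U$. $U^{-1}$ is the reflection of $U$ in a horizontal line. If a diagram contains cells $C_1=C(u,v)$ and $C_2=C(v,u)$ such that the bottom path of $C_1$ is the top path of $C_2$, they may be cancelled (remove the middle path and identify the top path of $C_1$ with the bottom path of $C_2$). A diagram is reduced if no cancellation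 is possible; every diagram has a unique reduced form. If $bot(U)=top(V)$, $U\circ V$ is the concatenation ($V$ placed under $U$) and $UV$ is its reduced form. For reduced diagrams, $H<W$ ($H$ is a prefix of $W$; $H=W$ allowed) means $W=H\circ F$ for some diagram $F$. A diagram is thin if the top path of each of its cells is contained in the top path of the diagram. Cube complex. Fix a word $w$. $\mathcal V(P,w)$ is the set of reduced diagrams $U$ with $top(U)=w$. The cube complex $K(P,w)$ has vertex set $\mathcal V(P,w)$; for each $U\in\mathcal V(P,w)$ and each thin diagram $\Phi$ with $top(\Phi)=bot(U)$ having $k$ cells there is a $k$-dimensional cube with vertex set $C(U,\Phi)=\{UV: V<\Phi\}$ (the prefixes of $\Phi$ correspond to subsets of its set of cells, giving the cube structure). Each $k$-cube carries the metric of the Euclidean unit cube $[0,1]^k$, and $K(P,w)$ carries the induced length metric $d$. Diagram group. $D(P,w)$ is the group of reduced diagrams $g$ with $top(g)=bot(g)=w$ under the product $UV$. It acts on $K(P,w)$ by isometries: $g$ sends a vertex $U$ to $gU$, extended affinely on each cube. *)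

theory Defs
  imports Complex_Main "HOL-Algebra.Group"
begin

section \<open>Diagrams over a semigroup presentation\<close>

text \<open>
  A presentation over the alphabet \<open>'a\<close> is given by its set of relations
  \<open>R :: ('a list \<times> 'a list) set\<close>, which is meant to be symmetric and to relate distinct
  nonempty words.

  Diagrams up to planar isotopy are represented by canonical names. An edge is either the
  \<open>i\<close>-th edge of the top path of the diagram (with its label), or the \<open>j\<close>-th edge of the bottom
  path of a cell. As every cell is attached from below to a nonempty path of existing edges, and
  an edge lies on the top path of at most one cell, a cell is identified within a diagram by its
  top path; its name consists of this path and of its bottom label. Names are invariant under
  isotopy, and the diagram can be rebuilt from the names of its cells, so that isotopy of diagrams
  is equality of the terms below.
\<close>

datatype 'a edge = Top nat 'a | Bot "'a cell" nat
  and 'a cell = Cell (cell_top: "'a edge list") (cell_botword: "'a list")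

fun label :: "'a edge \<Rightarrow> 'a" where
  "label (Top i a) = a"
| "label (Bot c j) = cell_botword c ! j"

definition cell_topword :: "'a cell \<Rightarrow> 'a list" where
  "cell_topword c = map label (cell_top c)"

definition cell_bot :: "'a cell \<Rightarrow> 'a edge list" where
  "cell_bot c = map (Bot c) [0..<length (cell_botword c)]"

definition path_of_word :: "'a list \<Rightarrow> 'a edge list" where
  "path_of_word w = map (\<lambda>i. Top i (w ! i)) [0..<length w]"

text \<open>The bottom path is determined by the top word and the cells; it is stored for
convenience.\<close>

datatype 'a diagram =
  Diagram (topw: "'a list") (cells: "'a cell set") (bot_path: "'a edge list")

definition top_path :: "'a diagram \<Rightarrow> 'a edge list" where
  "top_path U = path_of_word (topw U)"

definition botw :: "'a diagram \<Rightarrow> 'a list" where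
  "botw U = map label (bot_path U)"

definition degenerate :: "'a list \<Rightarrow> 'a diagram" where
  "degenerate w = Diagram w {} (path_of_word w)"

inductive is_diagram :: "('a list \<times> 'a list) set \<Rightarrow> 'a diagram \<Rightarrow> bool"
  for R :: "('a list \<times> 'a list) set" where
  is_diagram_degenerate: "is_diagram R (degenerate w)"
| is_diagram_attach:
    "is_diagram R (Diagram w C (p @ es @ q)) \<Longrightarrow> (map label es, v) \<in> R \<Longrightarrow>
     is_diagram R (Diagram w (insert (Cell es v) C) (p @ cell_bot (Cell es v) @ q))"

text \<open>
  Hereditary renaming: an edge \<open>e\<close> with \<open>h e = Some e'\<close> is identified with \<open>e'\<close>, and the names of
  all cells and edges hanging below it change accordingly.
\<close>

primrec rename_edge :: "('a edge \<Rightarrow> 'a edge option) \<Rightarrow> 'a edge \<Rightarrow> 'a edge"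
  and rename_cell :: "('a edge \<Rightarrow> 'a edge option) \<Rightarrow> 'a cell \<Rightarrow> 'a cell" where
  "rename_edge h (Top i a) = (case h (Top i a) of Some e \<Rightarrow> e | None \<Rightarrow> Top i a)"
| "rename_edge h (Bot c j) = (case h (Bot c j) of Some e \<Rightarrow> e | None \<Rightarrow> Bot (rename_cell h c) j)"
| "rename_cell h (Cell es v) = Cell (map (rename_edge h) es) v"

text \<open>The concatenation is meaningful only if \<open>botw U = topw V\<close>.\<close>

definition glue :: "'a edge list \<Rightarrow> 'a edge \<Rightarrow> 'a edge option" where
  "glue es e = (case e of Top i a \<Rightarrow> Some (es ! i) | Bot c j \<Rightarrow> None)"

definition concat_diagram :: "'a diagram \<Rightarrow> 'a diagram \<Rightarrow> 'a diagram" where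
  "concat_diagram U V =
     Diagram (topw U)
       (cells U \<union> rename_cell (glue (bot_path U)) ` cells V)
       (map (rename_edge (glue (bot_path U))) (bot_path V))"

definition dipole :: "'a diagram \<Rightarrow> 'a cell \<Rightarrow> 'a cell \<Rightarrow> bool" where
  "dipole U c1 c2 \<longleftrightarrow>
     c1 \<in> cells U \<and> c2 \<in> cells U \<and> cell_bot c1 = cell_top c2 \<and> cell_botword c2 = cell_topword c1"

text \<open>
  Cancelling a dipole identifies the bottom path of \<open>c2\<close> with the top path of \<open>c1\<close>. The middle
  path lies on no other cell and not on the bottom path, so it disappears with the two cells.
\<close>

definition fold_dipole :: "'a cell \<Rightarrow> 'a cell \<Rightarrow> 'a edge \<Rightarrow> 'a edge option" where
  "fold_dipole c1 c2 e =
     (case e of Top i a \<Rightarrow> None | Bot c j \<Rightarrow> if c = c2 then Some (cell_top c1 ! j) else None)"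

definition cancel_dipole :: "'a diagram \<Rightarrow> 'a cell \<Rightarrow> 'a cell \<Rightarrow> 'a diagram" where
  "cancel_dipole U c1 c2 =
     Diagram (topw U)
       (rename_cell (fold_dipole c1 c2) ` (cells U - {c1, c2}))
       (map (rename_edge (fold_dipole c1 c2)) (bot_path U))"

definition cancels :: "'a diagram \<Rightarrow> 'a diagram \<Rightarrow> bool" where
  "cancels U V \<longleftrightarrow> (\<exists>c1 c2. dipole U c1 c2 \<and> V = cancel_dipole U c1 c2)"

definition reduced :: "'a diagram \<Rightarrow> bool" where
  "reduced U \<longleftrightarrow> (\<nexists>c1 c2. dipole U c1 c2)"

definition reduced_form :: "'a diagram \<Rightarrow> 'a diagram" where
  "reduced_form U = (THE V. cancels\<^sup>*\<^sup>* U V \<and> reduced V)"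

definition diagram_prod :: "'a diagram \<Rightarrow> 'a diagram \<Rightarrow> 'a diagram" where
  "diagram_prod U V = reduced_form (concat_diagram U V)"

definition is_prefix :: "('a list \<times> 'a list) set \<Rightarrow> 'a diagram \<Rightarrow> 'a diagram \<Rightarrow> bool" where
  "is_prefix R H W \<longleftrightarrow>
     is_diagram R H \<and> (\<exists>F. is_diagram R F \<and> botw H = topw F \<and> W = concat_diagram H F)"

definition thin :: "'a diagram \<Rightarrow> bool" where
  "thin U \<longleftrightarrow> (\<forall>c\<in>cells U. set (cell_top c) \<subseteq> set (top_path U))"

definition diagram_group ::
    "('a list \<times> 'a list) set \<Rightarrow> 'a list \<Rightarrow> 'a diagram monoid" where
  "diagram_group R w =
     \<lparr>carrier = {g. is_diagram R g \<and> reduced g \<and> topw g = w \<and> botw g = w},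
      mult = diagram_prod,
      one = degenerate w\<rparr>"


section \<open>The cube complex\<close>

definition vertices :: "('a list \<times> 'a list) set \<Rightarrow> 'a list \<Rightarrow> 'a diagram set" where
  "vertices R w = {U. is_diagram R U \<and> reduced U \<and> topw U = w}"

definition cubes :: "('a list \<times> 'a list) set \<Rightarrow> 'a list \<Rightarrow> ('a diagram \<times> 'a diagram) set" where
  "cubes R w = {(U, \<Phi>). U \<in> vertices R w \<and> is_diagram R \<Phi> \<and> thin \<Phi> \<and> topw \<Phi> = botw U}"

text \<open>
  The cube \<open>C(U, \<Phi>)\<close> is parametrised by \<open>[0,1]\<close>-valued functions on the cells of \<open>\<Phi>\<close>; the
  0-1-valued function supported on the cells of a prefix \<open>V\<close> of \<open>\<Phi>\<close> is the vertex \<open>U V\<close>.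
  (The names of the cells of a prefix \<open>V\<close> of \<open>\<Phi>\<close> are the same in \<open>V\<close> and in \<open>\<Phi>\<close>.)
\<close>

definition cube_coords :: "'a diagram \<Rightarrow> ('a cell \<Rightarrow> real) set" where
  "cube_coords \<Phi> = cells \<Phi> \<rightarrow> {0..1}"

text \<open>
  A point of the complex is represented by its weights on the vertices, the cubical analogue of
  barycentric coordinates in a simplicial complex: the point with coordinates \<open>t\<close> in a cube puts on
  the vertex given by a set \<open>S\<close> of cells the weight \<open>\<Prod>c\<in>S. t c\<close> times \<open>\<Prod>c\<notin>S. 1 - t c\<close>.
  The weights determine \<open>t\<close>, and they are supported on the vertices of the smallest face containing
  the point, so that two points of different cubes have the same weights iff they are identified
  along a common face.
\<close>

definition cube_point ::
    "('a list \<times> 'a list) set \<Rightarrow> 'a diagram \<Rightarrow> 'a diagram \<Rightarrow> ('a cell \<Rightarrow> real) \<Rightarrow> 'a diagram \<Rightarrow> real"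
  where
  "cube_point R U \<Phi> t W =
     (\<Sum>V | is_prefix R V \<Phi> \<and> diagram_prod U V = W.
        \<Prod>c\<in>cells \<Phi>. if c \<in> cells V then t c else 1 - t c)"

definition cube_complex :: "('a list \<times> 'a list) set \<Rightarrow> 'a list \<Rightarrow> ('a diagram \<Rightarrow> real) set" where
  "cube_complex R w = {cube_point R U \<Phi> t |U \<Phi> t. (U, \<Phi>) \<in> cubes R w \<and> t \<in> cube_coords \<Phi>}"

text \<open>
  \<open>cube_string R w y z l\<close>: there is a sequence of points from \<open>y\<close> to \<open>z\<close>, any two consecutive ones
  lying in a common cube, whose Euclidean distances in these cubes add up to \<open>l\<close>. The length metric
  is the infimum of the lengths of such piecewise linear paths.
\<close>

inductive cube_string ::
    "('a list \<times> 'a list) set \<Rightarrow> 'a list \<Rightarrow> ('a diagram \<Rightarrow> real) \<Rightarrow> ('a diagram \<Rightarrow> real) \<Rightarrow> real \<Rightarrow> bool"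
  for R :: "('a list \<times> 'a list) set" and w :: "'a list" where
  cube_string_refl: "y \<in> cube_complex R w \<Longrightarrow> cube_string R w y y 0"
| cube_string_step:
    "cube_string R w y (cube_point R U \<Phi> s) l \<Longrightarrow> (U, \<Phi>) \<in> cubes R w \<Longrightarrow>
     s \<in> cube_coords \<Phi> \<Longrightarrow> t \<in> cube_coords \<Phi> \<Longrightarrow>
     cube_string R w y (cube_point R U \<Phi> t) (l + sqrt (\<Sum>c\<in>cells \<Phi>. (s c - t c)\<^sup>2))"

definition complex_dist ::
    "('a list \<times> 'a list) set \<Rightarrow> 'a list \<Rightarrow> ('a diagram \<Rightarrow> real) \<Rightarrow> ('a diagram \<Rightarrow> real) \<Rightarrow> real" where
  "complex_dist R w y z = Inf {l. cube_string R w y z l}"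

text \<open>
  The action of \<open>g\<close> moves the weight of a vertex \<open>U\<close> to the vertex \<open>g U\<close>; on each cube this is the
  affine map that sends the point of \<open>C(U, \<Phi>)\<close> with coordinates \<open>t\<close> to the one of \<open>C(g U, \<Phi>)\<close> with
  the same coordinates.
\<close>

definition diagram_act :: "'a diagram \<Rightarrow> ('a diagram \<Rightarrow> real) \<Rightarrow> 'a diagram \<Rightarrow> real" where
  "diagram_act g y W = (\<Sum>U | y U \<noteq> 0 \<and> diagram_prod g U = W. y U)"


section \<open>Semi-simple and parabolic isometries\<close>

definition isometry_of :: "'b set \<Rightarrow> ('b \<Rightarrow> 'b \<Rightarrow> real) \<Rightarrow> ('b \<Rightarrow> 'b) \<Rightarrow> bool" where
  "isometry_of K d f \<longleftrightarrow> bij_betw f K K \<and> (\<forall>y\<in>K. \<forall>z\<in>K. d (f y) (f z) = d y z)"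

definition attains_translation_length :: "'b set \<Rightarrow> ('b \<Rightarrow> 'b \<Rightarrow> real) \<Rightarrow> ('b \<Rightarrow> 'b) \<Rightarrow> bool" where
  "attains_translation_length K d f \<longleftrightarrow> (\<exists>y\<in>K. d y (f y) = Inf {d z (f z) |z. z \<in> K})"

definition semi_simple :: "'b set \<Rightarrow> ('b \<Rightarrow> 'b \<Rightarrow> real) \<Rightarrow> ('b \<Rightarrow> 'b) \<Rightarrow> bool" where
  "semi_simple K d f \<longleftrightarrow> isometry_of K d f \<and> attains_translation_length K d f"

definition parabolic :: "'b set \<Rightarrow> ('b \<Rightarrow> 'b \<Rightarrow> real) \<Rightarrow> ('b \<Rightarrow> 'b) \<Rightarrow> bool" where
  "parabolic K d f \<longleftrightarrow> isometry_of K d f \<and> \<not> attains_translation_length K d f"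


section \<open>The presentation \<open>\<langle>x | x = xx\<rangle>\<close>\<close>

datatype letter = letter_x

definition thompson_rels :: "(letter list \<times> letter list) set" where
  "thompson_rels =
     {([letter_x], [letter_x, letter_x]), ([letter_x, letter_x], [letter_x])}"

end

theory Submission
  imports Defs "HOL-Analysis.L2_Norm"
begin

text \<open>
  A diagram is determined by the names on its bottom path, and cancelling dipoles amounts to
  rewriting these names to a normal form: if the top path of a cell with bottom label \<open>v\<close> is the
  whole bottom path of a cell with top label \<open>v\<close>, the edges below the former are identified with
  those above the latter. Hence reduced forms are unique, the product is given by substituting
  names, and a point of the complex is a path some of whose segments are replaced with given
  probabilities.

  The element \<open>g\<close> (called \<open>par\<close> below) splits the rightmost edge once per period and merges edges
  into the leftmost edge twice per period; the edge emitted at the right end is split in two by a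
  further cell on its way to the left. The translates of this cell do not depend on each other, so
  \<open>N\<close> of them can be advanced simultaneously by \<open>1 / N\<close>, which gives displacement
  \<open>sqrt (1 + 4 + 1 / N)\<close>. On the other
  hand, with \<open>r\<close> and \<open>l\<close> counting splits minus merges at the right and left ends and with the
  indicator \<open>D\<close> of the hyperplane of such a translate, the gradient of \<open>r - 2 l + \<epsilon> D\<close> has norm at
  most \<open>sqrt (5 + 2 \<epsilon>\<^sup>2)\<close>, because this cell never meets the ends, while \<open>g\<close> changes the function by
  \<open>5 + \<epsilon> \<delta>\<close> with \<open>\<delta>\<close> the change of \<open>D\<close>. A translate with \<open>\<delta> \<noteq> 0\<close> exists at every point, and
  \<open>\<epsilon> = \<delta>\<close> shows that the displacement exceeds \<open>sqrt 5\<close>.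
\<close>

section \<open>Normal forms of names\<close>

text \<open>The pair (r, l) alone gives the weak bound: the element adds (1, -2) to it, at most one
  cell of a cube touches each end of the path, and r - 2 l is the combination whose gradient is
  parallel to this vector, so the displacement is at least 5 / sqrt 5. The difficulty is strictness
  at every single point, although there is no gap above sqrt 5. Perturbing by \<epsilon> D works
  because the cells that change D are different from those at the ends: the norm of the gradient
  grows only to second order in \<epsilon>, the increment to first order. The number \<delta> is the
  change of a mean over vertices of a cube, and it must be small at points whose displacement is
  near sqrt 5. For the upper bound, the two merges of a period both involve the leftmost edge and
  cannot share a cube; they cost 2 rather than sqrt 2, and the path consists of two segments. The
  split of the emitted edge is an interior event: one has to be completed per period, but each can
  be spread over N periods.\<close>

definition inverse_cells :: "'a cell \<Rightarrow> 'a cell \<Rightarrow> bool" where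
  "inverse_cells c1 c2 \<longleftrightarrow> cell_top c2 = cell_bot c1 \<and> cell_botword c2 = cell_topword c1"

text \<open>The only candidate for a cell whose bottom path is the top path of \<open>c\<close>,
  read off from the first edge. In the \<open>Top\<close> case \<open>c\<close> is a dummy value: a
  path that begins with a \<open>Top\<close> edge is not the bottom path of a cell, so the test in
  \<open>fold_edge\<close> fails.\<close>

definition mate :: "'a cell \<Rightarrow> 'a cell" where
  "mate c = (case hd (cell_top c) of Bot c1 j \<Rightarrow> c1 | Top i a \<Rightarrow> c)"

definition fold_edge :: "'a cell \<Rightarrow> nat \<Rightarrow> 'a edge" where
  "fold_edge c j = (if inverse_cells (mate c) c then cell_top (mate c) ! j else Bot c j)"

text \<open>The elementary move on normal paths: what replaces \<open>es\<close> after a cell with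
  bottom label \<open>v\<close> is attached there and a dipole that it may form is cancelled at
  once.\<close>

definition att :: "'a edge list \<Rightarrow> 'a list \<Rightarrow> 'a edge list" where
  "att es v = map (fold_edge (Cell es v)) [0..<length v]"

primrec nf_edge :: "'a edge \<Rightarrow> 'a edge" and nf_cell :: "'a cell \<Rightarrow> 'a cell" where
  "nf_edge (Top i a) = Top i a"
| "nf_edge (Bot c j) = fold_edge (nf_cell c) j"
| "nf_cell (Cell es v) = Cell (map nf_edge es) v"

text \<open>Well-formed names over the top word \<open>w\<close>. That the edges of a path coexist
  in one diagram is not expressed here. The quantifier over a mapped list has the shape that nested
  \<open>primrec\<close> accepts.\<close>

primrec good_edge :: "('a list \<times> 'a list) set \<Rightarrow> 'a list \<Rightarrow> 'a edge \<Rightarrow> bool"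
  and good_cell :: "('a list \<times> 'a list) set \<Rightarrow> 'a list \<Rightarrow> 'a cell \<Rightarrow> bool" where
  "good_edge R w (Top i a) = (i < length w \<and> a = w ! i)"
| "good_edge R w (Bot c j) = (j < length (cell_botword c) \<and> good_cell R w c)"
| "good_cell R w (Cell es v) = ((map label es, v) \<in> R \<and> (\<forall>b\<in>set (map (good_edge R w) es). b))"

text \<open>The name of the lower cell of a dipole contains the name of its partner, so being
  reduced can be tested on each name separately.\<close>

primrec normal_edge :: "'a edge \<Rightarrow> bool" and normal_cell :: "'a cell \<Rightarrow> bool" where
  "normal_edge (Top i a) = True"
| "normal_edge (Bot c j) = normal_cell c"
| "normal_cell (Cell es v) =
     ((\<nexists>c1. inverse_cells c1 (Cell es v)) \<and> (\<forall>b\<in>set (map normal_edge es). b))"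

primrec edge_cells :: "'a edge \<Rightarrow> 'a cell set" and cell_cells :: "'a cell \<Rightarrow> 'a cell set" where
  "edge_cells (Top i a) = {}"
| "edge_cells (Bot c j) = cell_cells c"
| "cell_cells (Cell es v) = insert (Cell es v) (\<Union>(set (map edge_cells es)))"

lemma length_cell_bot [simp]: "length (cell_bot c) = length (cell_botword c)"
  by (simp add: cell_bot_def)

lemma length_att [simp]: "length (att es v) = length v"
  by (simp add: att_def)

lemma cell_bot_eq_iff: "cell_botword c \<noteq> [] \<Longrightarrow> cell_bot c = cell_bot c' \<longleftrightarrow> c = c'"
proof
  assume a: "cell_botword c \<noteq> []" "cell_bot c = cell_bot c'"
  have "length (cell_botword c') \<noteq> 0" using a by (metis length_cell_bot length_0_conv)
  moreover have "hd (cell_bot c) = hd (cell_bot c')" using a by simp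
  ultimately show "c = c'" using a(1) by (simp add: cell_bot_def hd_map)
qed simp

lemma mate_eq: "inverse_cells c1 c \<Longrightarrow> cell_botword c1 \<noteq> [] \<Longrightarrow> mate c = c1"
  by (simp add: inverse_cells_def mate_def cell_bot_def hd_map)

lemma inverse_cells_nonempty:
  "inverse_cells c1 c \<Longrightarrow> cell_top c \<noteq> [] \<Longrightarrow> cell_botword c1 \<noteq> []"
  by (auto simp: inverse_cells_def cell_bot_def)

text \<open>The dichotomy behind the later inductions: an attached cell either undoes a cell
  \<open>c1\<close> and gives back its top path, or is new. The candidate is unique because a
  nonempty bottom path determines its cell.\<close>

lemma att_cases:
  assumes "es \<noteq> []"
  shows "(\<exists>c1. inverse_cells c1 (Cell es v) \<and> cell_botword c1 \<noteq> [] \<and> att es v = cell_top c1) \<or>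
         ((\<nexists>c1. inverse_cells c1 (Cell es v)) \<and> att es v = cell_bot (Cell es v))"
proof (cases "\<exists>c1. inverse_cells c1 (Cell es v)")
  case True
  then obtain c1 where c1: "inverse_cells c1 (Cell es v)" by blast
  have ne: "cell_botword c1 \<noteq> []" using inverse_cells_nonempty[OF c1] assms by simp
  have m: "mate (Cell es v) = c1" using mate_eq[OF c1 ne] .
  have "length v = length (cell_top c1)" using c1 by (simp add: inverse_cells_def cell_topword_def)
  then have "att es v = cell_top c1"
    using c1 m by (auto simp: att_def fold_edge_def intro: nth_equalityI)
  then show ?thesis using c1 ne by blast
next
  case False
  then show ?thesis by (simp add: att_def fold_edge_def cell_bot_def)
qed

lemma fold_edge_nth: "j < length v \<Longrightarrow> fold_edge (Cell es v) j = att es v ! j"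
  by (simp add: att_def)

lemma map_nf_cell_bot: "map nf_edge (cell_bot (Cell es v)) = att (map nf_edge es) v"
  by (simp add: cell_bot_def att_def)

lemma map_label_cell_bot [simp]: "map label (cell_bot c) = cell_botword c"
  by (auto simp: cell_bot_def intro: nth_equalityI)

lemma good_cell_iff:
  "good_cell R w c \<longleftrightarrow> (cell_topword c, cell_botword c) \<in> R \<and> (\<forall>e\<in>set (cell_top c). good_edge R w e)"
  by (cases c) (simp add: cell_topword_def)

lemma normal_cell_iff:
  "normal_cell c \<longleftrightarrow> (\<nexists>c1. inverse_cells c1 c) \<and> (\<forall>e\<in>set (cell_top c). normal_edge e)"
  by (cases c) simp

lemma cell_cells_iff:
  "cell_cells c = insert c (\<Union>(edge_cells ` set (cell_top c)))"
  by (cases c) simp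

lemma set_cell_bot: "set (cell_bot c) = Bot c ` {0..<length (cell_botword c)}"
  by (simp add: cell_bot_def)

lemma
  fixes e :: "'a edge" and c :: "'a cell"
  shows finite_edge_cells: "finite (edge_cells e)"
  and "finite (cell_cells c)"
  by (induction e and c) auto

lemma cell_cells_trans:
  "c \<in> edge_cells e \<Longrightarrow> cell_cells c \<subseteq> edge_cells e"
  "c \<in> cell_cells c' \<Longrightarrow> cell_cells c \<subseteq> cell_cells c'"
proof (induction e and c')
  case (Cell es v)
  show ?case
  proof (cases "c = Cell es v")
    case False
    then obtain e where e: "e \<in> set es" "c \<in> edge_cells e" using Cell.prems by auto
    then show ?thesis using Cell.IH[OF e] by auto
  qed simp
qed auto

lemma
  fixes e :: "'a edge" and c' :: "'a cell"
  shows normal_edge_iff_cells: "normal_edge e \<longleftrightarrow> (\<forall>c\<in>edge_cells e. \<nexists>c1. inverse_cells c1 c)"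
  and "normal_cell c' \<longleftrightarrow> (\<forall>c\<in>cell_cells c'. \<nexists>c1. inverse_cells c1 c)"
  by (induction e and c') auto

lemma glue_simps [simp]: "glue B (Top i a) = Some (B ! i)" "glue B (Bot c j) = None"
  by (simp_all add: glue_def)

locale presentation =
  fixes R :: "('a list \<times> 'a list) set"
  assumes rel_nonempty: "(u, v) \<in> R \<Longrightarrow> u \<noteq> [] \<and> v \<noteq> []"
begin

abbreviation good_path :: "'a list \<Rightarrow> 'a edge list \<Rightarrow> bool" where
  "good_path w B \<equiv> (\<forall>e\<in>set B. good_edge R w e)"

abbreviation normal_path :: "'a edge list \<Rightarrow> bool" where
  "normal_path B \<equiv> (\<forall>e\<in>set B. normal_edge e)"

lemma good_cell_nonempty: "good_cell R w c \<Longrightarrow> cell_top c \<noteq> [] \<and> cell_botword c \<noteq> []"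
  using rel_nonempty by (fastforce simp: good_cell_iff cell_topword_def)

lemma good_path_cell_bot: "good_cell R w c \<Longrightarrow> good_path w (cell_bot c)"
  by (auto simp: cell_bot_def)

lemma cell_top_good:
  assumes "inverse_cells c1 (Cell es v)" "good_path w es" "es \<noteq> []"
  shows "good_cell R w c1"
proof -
  have "cell_botword c1 \<noteq> []" using inverse_cells_nonempty[OF assms(1)] assms(3) by simp
  then have "Bot c1 0 \<in> set es" using assms(1) by (auto simp: inverse_cells_def cell_bot_def)
  then show ?thesis using assms(2) by fastforce
qed

lemma cell_top_normal:
  assumes "inverse_cells c1 (Cell es v)" "normal_path es" "es \<noteq> []"
  shows "normal_cell c1"
proof -
  have "cell_botword c1 \<noteq> []" using inverse_cells_nonempty[OF assms(1)] assms(3) by simp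
  then have "Bot c1 0 \<in> set es" using assms(1) by (auto simp: inverse_cells_def cell_bot_def)
  then show ?thesis using assms(2) by fastforce
qed

lemma att_props:
  assumes "good_path w es" "(map label es, v) \<in> R"
  shows good_att: "good_path w (att es v)"
    and label_att: "map label (att es v) = v"
    and normal_att: "normal_path es \<Longrightarrow> normal_path (att es v)"
proof -
  have ne: "es \<noteq> []" using rel_nonempty assms(2) by fastforce
  have "good_path w (att es v) \<and> map label (att es v) = v \<and>
    (normal_path es \<longrightarrow> normal_path (att es v))"
    using att_cases[OF ne, of v]
  proof (elim disjE exE conjE)
    fix c1 assume c1: "inverse_cells c1 (Cell es v)" "att es v = cell_top c1"
    have "good_cell R w c1" using cell_top_good[OF c1(1) assms(1) ne] .
    moreover have "normal_path es \<Longrightarrow> normal_cell c1" using cell_top_normal[OF c1(1) _ ne] .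
    ultimately show ?thesis
      using c1 by (auto simp: good_cell_iff normal_cell_iff inverse_cells_def cell_topword_def)
  next
    assume a: "\<nexists>c1. inverse_cells c1 (Cell es v)" "att es v = cell_bot (Cell es v)"
    have "good_cell R w (Cell es v)" using assms by (simp add: good_cell_iff cell_topword_def)
    then show ?thesis using a good_path_cell_bot by (auto simp: set_cell_bot)
  qed
  then show "good_path w (att es v)" "map label (att es v) = v"
    "normal_path es \<Longrightarrow> normal_path (att es v)" by auto
qed

text \<open>Moves are invertible. If the first move undid \<open>c1\<close>, the second one
  recreates \<open>c1\<close>, which is normal and therefore not cancelled; otherwise the second
  cell is inverse to the first.\<close>

lemma att_att:
  assumes "good_path w es" "normal_path es" "(map label es, v) \<in> R"
  shows "att (att es v) (map label es) = es"
proof -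
  have ne: "es \<noteq> []" "v \<noteq> []" using rel_nonempty assms(3) by fastforce+
  show ?thesis using att_cases[OF ne(1), of v]
  proof (elim disjE exE conjE)
    fix c1 assume c1: "inverse_cells c1 (Cell es v)" "att es v = cell_top c1"
    have n: "normal_cell c1" using cell_top_normal[OF c1(1) assms(2) ne(1)] .
    have g: "good_cell R w c1" using cell_top_good[OF c1(1) assms(1) ne(1)] .
    have es: "es = cell_bot c1" using c1 by (simp add: inverse_cells_def)
    then have "Cell (cell_top c1) (map label es) = c1" by (cases c1) simp
    then show ?thesis using att_cases[of "cell_top c1" "map label es"] n es c1
      good_cell_nonempty[OF g] by (auto simp: normal_cell_iff)
  next
    assume a: "\<nexists>c1. inverse_cells c1 (Cell es v)" "att es v = cell_bot (Cell es v)"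
    have i: "inverse_cells (Cell es v) (Cell (cell_bot (Cell es v)) (map label es))"
      by (simp add: inverse_cells_def cell_topword_def)
    have b: "cell_bot (Cell es v) \<noteq> []" using ne(2) by (simp add: cell_bot_def)
    from att_cases[OF b, of "map label es"] i a(2) show ?thesis
      using mate_eq[OF i] mate_eq[of _ "Cell (cell_bot (Cell es v)) (map label es)"] ne by fastforce
  qed
qed

lemma nf_props:
  "good_edge R w e \<Longrightarrow> good_edge R w (nf_edge e) \<and> label (nf_edge e) = label e \<and> normal_edge (nf_edge e)"
  "good_cell R w c \<Longrightarrow> good_path w (map nf_edge (cell_top c)) \<and>
     map label (map nf_edge (cell_top c)) = cell_topword c \<and> normal_path (map nf_edge (cell_top c))"
proof (induction e and c)
  case (Bot c j)
  obtain es v where c: "c = Cell es v" by (cases c)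
  have g: "good_cell R w c" and j: "j < length v" using Bot.prems c by auto
  have p: "good_path w (map nf_edge es)" "map label (map nf_edge es) = map label es"
    "normal_path (map nf_edge es)"
    using Bot.IH[OF g] c by (auto simp: cell_topword_def)
  have r: "(map label (map nf_edge es), v) \<in> R" unfolding p(2) using g c by simp
  have "nf_edge (Bot c j) = att (map nf_edge es) v ! j" using c j by (simp add: fold_edge_nth)
  moreover have "att (map nf_edge es) v ! j \<in> set (att (map nf_edge es) v)" using j by simp
  moreover have "label (att (map nf_edge es) v ! j) = v ! j"
    using label_att[OF p(1) r] j by (metis length_att nth_map)
  ultimately show ?case
    using good_att[OF p(1) r] normal_att[OF p(1) r p(3)] c by simp
qed (auto simp: cell_topword_def)

lemma good_nf: "good_edge R w e \<Longrightarrow> good_edge R w (nf_edge e)"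
  and label_nf: "good_edge R w e \<Longrightarrow> label (nf_edge e) = label e"
  and normal_nf: "good_edge R w e \<Longrightarrow> normal_edge (nf_edge e)"
  using nf_props(1) by auto

lemma map_label_nf: "good_path w B \<Longrightarrow> map label (map nf_edge B) = map label B"
  using nf_props(1) by auto

lemma nf_normal:
  "good_edge R w e \<Longrightarrow> normal_edge e \<Longrightarrow> nf_edge e = e"
  "good_cell R w c \<Longrightarrow> normal_cell c \<Longrightarrow> nf_cell c = c"
proof (induction e and c)
  case (Bot c j)
  then show ?case using normal_cell_iff[of c] by (auto simp: fold_edge_def)
next
  case (Cell es v)
  then show ?case by (auto intro: map_idI)
qed simp

lemma map_nf_normal: "good_path w B \<Longrightarrow> normal_path B \<Longrightarrow> map nf_edge B = B"
  by (auto intro!: map_idI nf_normal)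

section \<open>Normal forms under gluing and cancellation\<close>

lemma rename_props:
  assumes "good_path w B"
  shows "good_edge R (map label B) e \<Longrightarrow> good_edge R w (rename_edge (glue B) e) \<and>
           label (rename_edge (glue B) e) = label e"
    and "good_cell R (map label B) c \<Longrightarrow> good_cell R w (rename_cell (glue B) c)"
proof (induction e and c)
  case (Bot c j)
  then show ?case by (cases c) auto
next
  case (Cell es v)
  have "map label (map (rename_edge (glue B)) es) = map label es" using Cell by auto
  then have "(map label (map (rename_edge (glue B)) es), v) \<in> R"
    using Cell.prems by (simp del: map_map)
  then show ?case using Cell by auto
qed (use assms in auto)

lemma good_rename: "good_path w B \<Longrightarrow> good_edge R (map label B) e \<Longrightarrow> good_edge R w (rename_edge (glue B) e)"
  and label_rename: "good_path w B \<Longrightarrow> good_edge R (map label B) e \<Longrightarrow> label (rename_edge (glue B) e) = label e"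
  using rename_props(1) by auto

text \<open>The partner of a dipole need only become visible after normalisation of the top path,
  whatever \<open>es\<close> was before. The reason is \<open>att_att\<close>, applied to the
  normalised \<open>fs\<close>.\<close>

lemma nf_cell_bot_inverse:
  assumes "good_cell R w (Cell fs u)" "j < length fs"
    and "map nf_edge es = map nf_edge (cell_bot (Cell fs u))"
  shows "fold_edge (Cell (map nf_edge es) (map label fs)) j = nf_edge (fs ! j)"
proof -
  have f: "good_path w fs" "(map label fs, u) \<in> R" using assms(1) by auto
  have n: "good_path w (map nf_edge fs)" "map label (map nf_edge fs) = map label fs"
    "normal_path (map nf_edge fs)"
    using f by (auto simp: label_nf good_nf normal_nf)
  have "att (map nf_edge es) (map label fs) = map nf_edge fs"
    using att_att[OF n(1,3), of u] f(2) unfolding n(2) assms(3) map_nf_cell_bot by simp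
  then show ?thesis using fold_edge_nth[of j "map label fs"] assms(2) by simp
qed

text \<open>A dipole of the lower diagram stays a dipole after gluing, so it is removed by the final
  normalisation whether or not it was cancelled before. Together with the next two lemmas this
  yields associativity of the product.\<close>

lemma nf_rename_nf:
  assumes B: "good_path w B"
  shows "good_edge R (map label B) e \<Longrightarrow>
           nf_edge (rename_edge (glue B) (nf_edge e)) = nf_edge (rename_edge (glue B) e)"
    and "good_cell R (map label B) c \<Longrightarrow>
           map (\<lambda>e. nf_edge (rename_edge (glue B) (nf_edge e))) (cell_top c) =
           map (\<lambda>e. nf_edge (rename_edge (glue B) e)) (cell_top c)"
proof (induction e and c)
  case (Bot c j)
  let ?r = "rename_edge (glue B)"
  obtain es v where c: "c = Cell es v" by (cases c)
  have g: "good_path (map label B) es" "(map label es, v) \<in> R" and j: "j < length v"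
    using Bot.prems c by auto
  have ih: "map nf_edge (map ?r (map nf_edge es)) = map nf_edge (map ?r es)"
    using Bot c by (simp add: comp_def)
  have ne: "map nf_edge es \<noteq> []" using rel_nonempty g(2) by fastforce
  have gn: "good_path (map label B) (map nf_edge es)" using g good_nf by auto
  have e: "nf_edge (Bot c j) = att (map nf_edge es) v ! j" using c j by (simp add: fold_edge_nth)
  show ?case using att_cases[OF ne, of v]
  proof (elim disjE exE conjE)
    fix c1 assume c1: "inverse_cells c1 (Cell (map nf_edge es) v)" "att (map nf_edge es) v = cell_top c1"
    obtain fs u where c1': "c1 = Cell fs u" by (cases c1)
    have gc: "good_cell R (map label B) c1" using cell_top_good[OF c1(1) gn ne] .
    have gr: "good_cell R w (Cell (map ?r fs) u)" using rename_props(2)[OF B gc] c1' by simp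
    have v: "v = map label (map ?r fs)"
      using c1(1) gc c1' label_rename[OF B] by (auto simp: inverse_cells_def cell_topword_def)
    have jf: "j < length (map ?r fs)" using v j by simp
    have m: "map ?r (map nf_edge es) = cell_bot (Cell (map ?r fs) u)"
      using c1(1) c1' by (simp add: inverse_cells_def cell_bot_def)
    have "nf_edge (?r (Bot c j)) = fold_edge (Cell (map nf_edge (map ?r es)) v) j" using c by simp
    also have "\<dots> = nf_edge (map ?r fs ! j)"
      using nf_cell_bot_inverse[OF gr jf, of "map ?r (map nf_edge es)"]
      unfolding m[symmetric] ih v[symmetric] by simp
    also have "\<dots> = nf_edge (?r (nf_edge (Bot c j)))" using e c1(2) c1' jf by simp
    finally show ?thesis by simp
  next
    assume "att (map nf_edge es) v = cell_bot (Cell (map nf_edge es) v)"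
    then have "nf_edge (Bot c j) = Bot (Cell (map nf_edge es) v) j"
      using e j by (simp add: cell_bot_def)
    then show ?thesis using c by (simp add: ih del: map_map)
  qed
qed auto

text \<open>The counterpart for the upper diagram: at a \<open>Top\<close> edge it reduces to
  idempotence of the normal form.\<close>

lemma nf_rename_glue_nf:
  assumes "good_path w B"
  shows "good_edge R (map label B) e \<Longrightarrow>
           nf_edge (rename_edge (glue (map nf_edge B)) e) = nf_edge (rename_edge (glue B) e)"
    and "good_cell R (map label B) c \<Longrightarrow>
           nf_cell (rename_cell (glue (map nf_edge B)) c) = nf_cell (rename_cell (glue B) c)"
proof (induction e and c)
  case (Top i a)
  then have "B ! i \<in> set B" by simp
  then have "nf_edge (nf_edge (B ! i)) = nf_edge (B ! i)"
    using assms nf_normal(1) good_nf normal_nf by blast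
  then show ?case using Top by simp
qed auto

lemma rename_glue_rename:
  "good_edge R (map label B') e \<Longrightarrow>
     rename_edge (glue (map (rename_edge (glue B)) B')) e = rename_edge (glue B) (rename_edge (glue B') e)"
  "good_cell R (map label B') c \<Longrightarrow>
     rename_cell (glue (map (rename_edge (glue B)) B')) c = rename_cell (glue B) (rename_cell (glue B') c)"
  by (induction e and c) auto

text \<open>Below \<open>c2\<close> normalisation finds the partner \<open>c1\<close> and returns
  the same edge of its top path as the cancellation does; elsewhere nothing happens. This invariance
  takes the place of a confluence argument.\<close>

lemma nf_fold_dipole:
  assumes "inverse_cells c1 c2" "good_cell R w c1" "good_cell R w c2"
  shows "good_edge R w e \<Longrightarrow> nf_edge (rename_edge (fold_dipole c1 c2) e) = nf_edge e"
    and "good_cell R w c \<Longrightarrow> nf_cell (rename_cell (fold_dipole c1 c2) c) = nf_cell c"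
proof (induction e and c)
  case (Top i a)
  then show ?case by (simp add: fold_dipole_def)
next
  case (Bot c j)
  show ?case
  proof (cases "c = c2")
    case True
    obtain fs u where c1: "c1 = Cell fs u" by (cases c1)
    have c2: "c2 = Cell (cell_bot c1) (map label fs)"
      using assms(1) c1 by (cases c2) (simp add: inverse_cells_def cell_topword_def)
    have "j < length fs" using Bot.prems True c2 by simp
    then show ?thesis
      using True nf_cell_bot_inverse[of w fs u j "cell_bot c1"] assms(2) c1 c2
      by (simp add: fold_dipole_def)
  next
    case False
    then show ?thesis using Bot by (simp add: fold_dipole_def)
  qed
qed auto

end

section \<open>Diagrams as paths of names\<close>

lemma append_eq_append_distinct:
  assumes "p @ X @ q = p' @ X @ q'" "distinct (p @ X @ q)" "X \<noteq> []"
  shows "p = p' \<and> q = q'"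
proof -
  let ?B = "p @ X @ q"
  have "?B ! length p = hd X" using assms(3) by (simp add: nth_append hd_conv_nth)
  moreover have "?B ! length p' = hd X" unfolding assms(1) using assms(3) by (simp add: nth_append hd_conv_nth)
  moreover have "length p < length ?B" "length p' < length ?B"
    using assms(3) by simp (simp add: assms(1) assms(3))
  ultimately have "length p = length p'" using assms(2) nth_eq_iff_index_eq by metis
  then show ?thesis using assms(1) by simp
qed

text \<open>A name is larger than the names occurring in it, so no cell is its own ancestor.\<close>

lemma Bot_in_cell_top:
  assumes "Bot c1 j \<in> set (cell_top c2)"
  shows "c1 \<in> cell_cells c2" "c1 \<noteq> c2"
proof -
  have c1: "c1 \<in> edge_cells (Bot c1 j)" by (simp add: cell_cells_iff[of c1])
  then show "c1 \<in> cell_cells c2" using assms by (auto simp: cell_cells_iff[of c2] simp del: edge_cells.simps)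
  obtain es v where c2: "c2 = Cell es v" by (cases c2)
  have "size (Bot c1 j) \<le> size_list size es" using assms c2 by (simp add: size_list_estimation')
  then show "c1 \<noteq> c2" using c2 by auto
qed

text \<open>For commuting two attachments: disjoint segments of one path cannot overlap, so one of
  them precedes the other.\<close>

lemma append_eq_append_disjoint:
  assumes "p @ X @ q = p' @ Y @ q'" "set X \<inter> set Y = {}" "X \<noteq> []" "Y \<noteq> []"
  shows "(\<exists>r. p = p' @ Y @ r \<and> q' = r @ X @ q) \<or> (\<exists>r. q = r @ Y @ q' \<and> p' = p @ X @ r)"
  using assms
proof (induction p arbitrary: p')
  case Nil
  have "\<exists>r. q = r @ Y @ q' \<and> p' = X @ r"
    using Nil
  proof (induction X arbitrary: p')
    case (Cons a X)
    then show ?case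
    proof (cases p')
      case Nil
      then show ?thesis using Cons.prems by (cases Y) auto
    next
      case c: (Cons b p'')
      show ?thesis
      proof (cases "X = []")
        case True
        then show ?thesis using Cons.prems c by auto
      next
        case False
        then show ?thesis using Cons.IH[of p''] Cons.prems c by auto
      qed
    qed
  qed simp
  then show ?case by simp
next
  case (Cons a p)
  then show ?case
  proof (cases p')
    case Nil
    obtain b Y' where Y: "Y = b # Y'" using Cons.prems(4) by (cases Y) auto
    have e: "p @ X @ q = Y' @ q'" "a = b" using Cons.prems(1) Nil Y by auto
    have "\<exists>r. p = Y' @ r \<and> q' = r @ X @ q"
      using e(1) Cons.prems(2) Y
    proof (induction Y' arbitrary: p Y b)
      case (Cons y Y')
      then show ?case using Cons.prems(1) \<open>X \<noteq> []\<close>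
      proof (cases p)
        case Nil
        then show ?thesis using Cons.prems \<open>X \<noteq> []\<close> by (cases X) auto
      next
        case c: (Cons x p')
        show ?thesis using Cons.IH[of p' "y # Y'" y] Cons.prems c by auto
      qed
    qed simp
    then show ?thesis using Y e(2) Nil by auto
  next
    case c: (Cons b p'')
    then show ?thesis using Cons.IH[of p''] Cons.prems by auto
  qed
qed

text \<open>Following edges downwards from a cell ends at the bottom path, because every cell has a
  nonempty bottom path. So the cells are exactly the ancestors of the bottom edges
  (\<open>is_diagram_mk\<close>).\<close>

definition mk_diagram :: "'a list \<Rightarrow> 'a edge list \<Rightarrow> 'a diagram" where
  "mk_diagram w B = Diagram w (\<Union>(edge_cells ` set B)) B"

lemma mk_diagram_sel [simp]:
  "topw (mk_diagram w B) = w" "bot_path (mk_diagram w B) = B"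
  "cells (mk_diagram w B) = \<Union>(edge_cells ` set B)"
  by (simp_all add: mk_diagram_def)

lemma path_of_word_no_Bot: "Bot c j \<notin> set (path_of_word w)"
  by (auto simp: path_of_word_def)

lemma label_path_of_word [simp]: "map label (path_of_word w) = w"
  by (auto simp: path_of_word_def intro: nth_equalityI)

lemma length_path_of_word [simp]: "length (path_of_word w) = length w"
  by (simp add: path_of_word_def)

lemma nth_path_of_word [simp]: "i < length w \<Longrightarrow> path_of_word w ! i = Top i (w ! i)"
  by (simp add: path_of_word_def)

lemma degenerate_eq: "degenerate w = mk_diagram w (path_of_word w)"
  by (auto simp: degenerate_def mk_diagram_def path_of_word_def)

context presentation
begin

lemma is_diagram_mk:
  "is_diagram R U \<Longrightarrow> U = mk_diagram (topw U) (bot_path U)"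
proof (induction rule: is_diagram.induct)
  case (is_diagram_degenerate w)
  then show ?case by (simp add: degenerate_eq)
next
  case (is_diagram_attach w C p es q v)
  have "v \<noteq> []" using rel_nonempty is_diagram_attach by blast
  then have "\<Union>(edge_cells ` set (cell_bot (Cell es v))) = cell_cells (Cell es v)"
    by (auto simp: set_cell_bot)
  then show ?case using is_diagram_attach by (auto simp: mk_diagram_def)
qed

lemma is_diagram_good: "is_diagram R U \<Longrightarrow> good_path (topw U) (bot_path U)"
proof (induction rule: is_diagram.induct)
  case (is_diagram_degenerate w)
  then show ?case by (auto simp: degenerate_def path_of_word_def)
next
  case (is_diagram_attach w C p es q v)
  then have "good_cell R w (Cell es v)" by simp
  from good_path_cell_bot[OF this] show ?case using is_diagram_attach by auto
qed

text \<open>The last two claims need a joint induction: a new cell is fresh because its top path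
  still lies on the bottom path, which no top path of an earlier cell meets, and its bottom edges
  are fresh because the cell is.\<close>

lemma is_diagram_struct:
  assumes "is_diagram R U"
  shows "finite (cells U)"
    and "\<And>c. c \<in> cells U \<Longrightarrow> cell_cells c \<subseteq> cells U"
    and "distinct (bot_path U)"
    and "\<And>c e. c \<in> cells U \<Longrightarrow> e \<in> set (cell_top c) \<Longrightarrow> e \<notin> set (bot_path U)"
proof -
  let ?P = "\<lambda>U. distinct (bot_path U) \<and> (\<forall>c\<in>cells U. set (cell_top c) \<inter> set (bot_path U) = {})"
  have cl: "cell_cells c \<subseteq> cells U" if "is_diagram R U" "c \<in> cells U" for U c
  proof -
    have "cells U = \<Union>(edge_cells ` set (bot_path U))"
      using is_diagram_mk[OF that(1)] by (metis mk_diagram_sel(3))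
    then show ?thesis using that(2) cell_cells_trans(1) by fastforce
  qed
  have fin: "finite (cells U)" if "is_diagram R U" for U
    using is_diagram_mk[OF that] by (metis finite_UN finite_edge_cells finite_set mk_diagram_sel(3))
  have "?P U" using assms
  proof (induction rule: is_diagram.induct)
    case (is_diagram_degenerate w)
    then show ?case by (auto simp: degenerate_def path_of_word_def distinct_map inj_on_def)
  next
    case (is_diagram_attach w C p es q v)
    let ?c = "Cell es v"
    have ne: "es \<noteq> []" using rel_nonempty is_diagram_attach by fastforce
    have fresh: "?c \<notin> C" using is_diagram_attach.IH ne by (cases es) auto
    have cl': "cell_cells c \<subseteq> C" if "c \<in> C" for c
      using cl[OF is_diagram_attach.hyps(1)] that by simp
    have b: "Bot ?c j \<notin> set (p @ es @ q)" for j
    proof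
      assume "Bot ?c j \<in> set (p @ es @ q)"
      then have "?c \<in> cells (mk_diagram w (p @ es @ q))"
        by (auto simp: cell_cells_iff intro!: bexI[of _ "Bot ?c j"])
      then show False using fresh is_diagram_mk[OF is_diagram_attach.hyps(1)] by (simp add: mk_diagram_def)
    qed
    have t: "Bot ?c j \<notin> set (cell_top c)" if "c \<in> C" for c j
    proof
      assume "Bot ?c j \<in> set (cell_top c)"
      then have "?c \<in> cell_cells c" using Bot_in_cell_top(1) by blast
      then show False using cl'[OF that] fresh by blast
    qed
    have "distinct (cell_bot ?c)" by (simp add: cell_bot_def distinct_map inj_on_def)
    then show ?case using is_diagram_attach.IH b t
      by (fastforce simp: set_cell_bot)
  qed
  then show "finite (cells U)" "\<And>c. c \<in> cells U \<Longrightarrow> cell_cells c \<subseteq> cells U" "distinct (bot_path U)"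
    "\<And>c e. c \<in> cells U \<Longrightarrow> e \<in> set (cell_top c) \<Longrightarrow> e \<notin> set (bot_path U)"
    using fin cl assms by auto
qed

lemma attach_fresh:
  assumes "is_diagram R (Diagram w C (p @ es @ q))" "es \<noteq> []"
  shows "Cell es v \<notin> C"
  using is_diagram_struct(4)[OF assms(1), of "Cell es v" "hd es"] assms(2) by auto

text \<open>The attachments can be reordered so that \<open>c\<close> comes last: in the induction
  \<open>c\<close> either is the last cell, or its bottom path is disjoint from that of the last
  cell and the two attachments commute.\<close>

lemma unattach:
  assumes "is_diagram R (Diagram w C (p @ cell_bot c @ q))" "cell_botword c \<noteq> []"
  shows "is_diagram R (Diagram w (C - {c}) (p @ cell_top c @ q))"
proof -
  have "is_diagram R U \<Longrightarrow> bot_path U = p @ cell_bot c @ q \<Longrightarrow>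
    is_diagram R (Diagram (topw U) (cells U - {c}) (p @ cell_top c @ q))" for U
  proof (induction arbitrary: p q rule: is_diagram.induct)
    case (is_diagram_degenerate w)
    have "Bot c 0 \<in> set (path_of_word w)"
      using is_diagram_degenerate assms(2) by (simp add: degenerate_def set_cell_bot)
    then show ?case using path_of_word_no_Bot by metis
  next
    case (is_diagram_attach w C p0 es q0 v)
    let ?c = "Cell es v"
    have ne: "es \<noteq> []" "v \<noteq> []" using rel_nonempty is_diagram_attach.hyps by fastforce+
    have eq: "p0 @ cell_bot ?c @ q0 = p @ cell_bot c @ q" using is_diagram_attach.prems by simp
    have dg: "is_diagram R (Diagram w (insert ?c C) (p0 @ cell_bot ?c @ q0))"
      using is_diagram.is_diagram_attach is_diagram_attach.hyps by blast
    have ne': "cell_bot ?c \<noteq> []" "cell_bot c \<noteq> []" using ne assms(2) by (auto simp: cell_bot_def)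
    show ?case
    proof (cases "c = ?c")
      case True
      then have "p0 = p \<and> q0 = q"
        using append_eq_append_distinct[OF eq[unfolded True]] is_diagram_struct(3)[OF dg] ne' by simp
      then show ?thesis
        using True is_diagram_attach.hyps(1) attach_fresh[OF is_diagram_attach.hyps(1) ne(1)] by simp
    next
      case False
      have dj: "set (cell_bot ?c) \<inter> set (cell_bot c) = {}" using False by (auto simp: set_cell_bot)
      from append_eq_append_disjoint[OF eq dj ne'] show ?thesis
      proof (elim disjE exE conjE)
        fix r assume r: "p0 = p @ cell_bot c @ r" "q = r @ cell_bot ?c @ q0"
        have "is_diagram R (Diagram w (C - {c}) ((p @ cell_top c @ r) @ es @ q0))"
          using is_diagram_attach.IH[of p "r @ es @ q0"] r by simp
        from is_diagram.is_diagram_attach[OF this is_diagram_attach.hyps(2)] show ?thesis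
          using r False by (simp add: insert_Diff_if)
      next
        fix r assume r: "q0 = r @ cell_bot c @ q" "p = p0 @ cell_bot ?c @ r"
        have "is_diagram R (Diagram w (C - {c}) (p0 @ es @ (r @ cell_top c @ q)))"
          using is_diagram_attach.IH[of "p0 @ es @ r" q] r by simp
        from is_diagram.is_diagram_attach[OF this is_diagram_attach.hyps(2)] show ?thesis
          using r False by (simp add: insert_Diff_if)
      qed
    qed
  qed
  from this[OF assms(1)] show ?thesis by simp
qed

lemma good_cells_of:
  "good_edge R w e \<Longrightarrow> \<forall>c\<in>edge_cells e. good_cell R w c"
  "good_cell R w d \<Longrightarrow> \<forall>c\<in>cell_cells d. good_cell R w c"
  by (induction e and d) auto

lemma cells_eq: "is_diagram R U \<Longrightarrow> cells U = \<Union>(edge_cells ` set (bot_path U))"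
  using is_diagram_mk by (metis mk_diagram_sel(3))

lemma is_diagram_good_cell: "is_diagram R U \<Longrightarrow> c \<in> cells U \<Longrightarrow> good_cell R (topw U) c"
  using good_cells_of(1) is_diagram_good cells_eq by blast

text \<open>Normality quantifies over arbitrary partners, \<open>reduced\<close> only over cells of
  the diagram; the two agree because a partner is an ancestor and hence belongs to the
  diagram.\<close>

lemma reduced_iff:
  assumes "is_diagram R U"
  shows "reduced U \<longleftrightarrow> normal_path (bot_path U)"
proof
  note c = cells_eq[OF assms] and gc = is_diagram_good_cell[OF assms]
  show "reduced U \<Longrightarrow> normal_path (bot_path U)"
  proof (rule ccontr)
    assume r: "reduced U" and "\<not> normal_path (bot_path U)"
    then obtain c1 c2 where c2: "c2 \<in> cells U" "inverse_cells c1 c2"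
      unfolding c normal_edge_iff_cells by blast
    have n: "cell_top c2 \<noteq> []" using good_cell_nonempty[OF gc[OF c2(1)]] by simp
    then have "cell_botword c1 \<noteq> []" using inverse_cells_nonempty[OF c2(2)] by simp
    then have "Bot c1 0 \<in> set (cell_top c2)" using c2(2) by (simp add: inverse_cells_def set_cell_bot)
    then have "c1 \<in> cell_cells c2" using Bot_in_cell_top(1) by blast
    then have "c1 \<in> cells U" using is_diagram_struct(2)[OF assms c2(1)] by auto
    then show False using r c2 by (auto simp: reduced_def dipole_def inverse_cells_def)
  qed
  assume n: "normal_path (bot_path U)"
  show "reduced U" unfolding reduced_def
  proof
    assume "\<exists>c1 c2. dipole U c1 c2"
    then obtain c1 c2 where d: "c2 \<in> cells U" "inverse_cells c1 c2"
      unfolding dipole_def inverse_cells_def by metis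
    show False using n d unfolding c normal_edge_iff_cells by blast
  qed
qed

lemma rename_fold_dipole_id:
  "c2 \<notin> edge_cells e \<Longrightarrow> rename_edge (fold_dipole c1 c2) e = e"
  "c2 \<notin> cell_cells c \<Longrightarrow> rename_cell (fold_dipole c1 c2) c = c"
proof (induction e and c)
  case (Bot c j)
  then have "c \<noteq> c2" by (auto simp: cell_cells_iff)
  then show ?case using Bot by (simp add: fold_dipole_def)
qed (auto simp: fold_dipole_def intro: map_idI)

lemma edge_cells_diagram:
  assumes "is_diagram R U" "e \<in> set (bot_path U)"
  shows "edge_cells e \<subseteq> cells U"
  using is_diagram_mk[OF assms(1)] assms(2) by (metis UN_upper mk_diagram_sel(3))

lemma label_fold_dipole:
  assumes "inverse_cells c1 c2" "good_edge R w e"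
  shows "label (rename_edge (fold_dipole c1 c2) e) = label e"
proof (cases e)
  case (Bot c j)
  show ?thesis
  proof (cases "c = c2")
    case True
    have "j < length (cell_top c1)"
      using assms Bot True by (simp add: inverse_cells_def cell_topword_def)
    then show ?thesis
      using Bot True assms(1) by (simp add: fold_dipole_def inverse_cells_def cell_topword_def)
  next
    case False
    then show ?thesis using Bot by (cases c) (simp add: fold_dipole_def)
  qed
qed (simp add: fold_dipole_def)

text \<open>Cancellation is defined on names and might leave the inductive class of diagrams. If
  \<open>c2\<close> was attached last, the result is the diagram before it with \<open>c1\<close>
  removed by \<open>unattach\<close>; otherwise the dipole is cancelled earlier and the last cell is
  attached along its renamed top path.\<close>

lemma cancel_is_diagram:
  assumes "is_diagram R U" "dipole U c1 c2"
  shows "is_diagram R (cancel_dipole U c1 c2)"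
  using assms
proof (induction rule: is_diagram.induct)
  case (is_diagram_degenerate w)
  then show ?case by (simp add: degenerate_def dipole_def)
next
  case (is_diagram_attach w C p es q v)
  let ?c = "Cell es v" and ?r = "rename_edge (fold_dipole c1 c2)"
  note dg = is_diagram_attach.hyps(1)
  have ne: "es \<noteq> []" "v \<noteq> []" using rel_nonempty is_diagram_attach.hyps by fastforce+
  have fresh: "?c \<notin> C" using attach_fresh[OF dg ne(1)] .
  have c12: "c1 \<in> insert ?c C" "c2 \<in> insert ?c C" and i: "inverse_cells c1 c2"
    using is_diagram_attach.prems by (auto simp: dipole_def inverse_cells_def)
  have dg': "is_diagram R (Diagram w (insert ?c C) (p @ cell_bot ?c @ q))"
    using is_diagram.is_diagram_attach is_diagram_attach.hyps by blast
  have top2: "cell_top c2 \<noteq> []"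
  proof (cases "c2 = ?c")
    case False
    then have "c2 \<in> C" using c12 by simp
    then have "good_cell R w c2" using is_diagram_good_cell[OF dg] by simp
    then show ?thesis using good_cell_nonempty by blast
  qed (use ne in simp)
  have n1: "cell_botword c1 \<noteq> []" using inverse_cells_nonempty[OF i top2] .
  have "Bot c1 0 \<in> set (cell_top c2)" using i n1 by (simp add: inverse_cells_def set_cell_bot)
  then have c1c2: "c1 \<in> cell_cells c2" "c1 \<noteq> c2" using Bot_in_cell_top by blast+
  show ?case
  proof (cases "c2 = ?c")
    case True
    then have c1: "c1 \<in> C" using c12 c1c2 by auto
    have es: "es = cell_bot c1" using i True by (simp add: inverse_cells_def)
    have v: "v = cell_topword c1" using i True by (simp add: inverse_cells_def)
    have d: "is_diagram R (Diagram w (C - {c1}) (p @ cell_top c1 @ q))"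
      using unattach[of w C p c1 q] dg es n1 by simp
    have fix_e: "?r e = e" if "e \<in> set (p @ es @ q)" for e
      using rename_fold_dipole_id(1) edge_cells_diagram[OF dg, of e] that fresh True by auto
    have fix_c: "rename_cell (fold_dipole c1 c2) c = c" if "c \<in> C" for c
      using rename_fold_dipole_id(2) is_diagram_struct(2)[OF dg, of c] that fresh True by auto
    have "map ?r (cell_bot c2) = cell_top c1"
      using True v by (auto simp: cell_bot_def fold_dipole_def cell_topword_def intro!: nth_equalityI)
    moreover have "map ?r p = p" "map ?r q = q" using fix_e by (auto intro: map_idI)
    moreover have "rename_cell (fold_dipole c1 c2) ` (insert ?c C - {c1, c2}) = C - {c1}"
      using fix_c True fresh by force
    ultimately show ?thesis using d True by (simp add: cancel_dipole_def)
  next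
    case False
    then have c2: "c2 \<in> C" using c12 by simp
    then have "c1 \<in> C" using is_diagram_struct(2)[OF dg, of c2] c1c2 by auto
    then have dp: "dipole (Diagram w C (p @ es @ q)) c1 c2"
      using i c2 by (simp add: dipole_def inverse_cells_def)
    have d: "is_diagram R (Diagram w (rename_cell (fold_dipole c1 c2) ` (C - {c1, c2}))
        (map ?r p @ map ?r es @ map ?r q))"
      using is_diagram_attach.IH[OF dp] by (simp add: cancel_dipole_def)
    have "label (?r e) = label e" if "e \<in> set es" for e
      using label_fold_dipole[OF i, of w e] is_diagram_good[OF dg] that by simp
    then have "map label (map ?r es) = map label es" by simp
    then have "(map label (map ?r es), v) \<in> R" using is_diagram_attach.hyps(2) by (simp del: map_map)
    from is_diagram.is_diagram_attach[OF d this] have "is_diagram R (Diagram w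
        (insert (Cell (map ?r es) v) (rename_cell (fold_dipole c1 c2) ` (C - {c1, c2})))
        (map ?r p @ cell_bot (Cell (map ?r es) v) @ map ?r q))" .
    moreover have "insert ?c C - {c1, c2} = insert ?c (C - {c1, c2})"
      using \<open>c1 \<in> C\<close> c2 fresh by auto
    moreover have "map ?r (cell_bot ?c) = cell_bot (Cell (map ?r es) v)"
      using False by (auto simp: cell_bot_def fold_dipole_def)
    ultimately show ?thesis by (simp add: cancel_dipole_def)
  qed
qed

end

lemma rename_glue_path_of_word:
  "length w = length B \<Longrightarrow> map (rename_edge (glue B)) (path_of_word w) = B"
  by (auto intro: nth_equalityI)

lemma rename_glue_degenerate:
  "good_edge R w e \<Longrightarrow> rename_edge (glue (path_of_word w)) e = e"
  "good_cell R w c \<Longrightarrow> rename_cell (glue (path_of_word w)) c = c"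
  by (induction e and c) (auto intro: map_idI)

context presentation
begin

section \<open>Reduced forms and prefixes\<close>

lemma cancels_props:
  assumes "is_diagram R U" "cancels U V"
  shows "is_diagram R V \<and> topw V = topw U \<and> map nf_edge (bot_path V) = map nf_edge (bot_path U) \<and>
    card (cells V) < card (cells U)"
proof -
  obtain c1 c2 where d: "dipole U c1 c2" and V: "V = cancel_dipole U c1 c2"
    using assms(2) by (auto simp: cancels_def)
  have c: "c1 \<in> cells U" "c2 \<in> cells U" "inverse_cells c1 c2"
    using d unfolding dipole_def inverse_cells_def by auto
  note fin = is_diagram_struct(1)[OF assms(1)]
  have "card (cells V) \<le> card (cells U - {c1, c2})"
    unfolding V cancel_dipole_def using fin by (simp add: card_image_le)
  also have "\<dots> < card (cells U)" using fin c by (intro psubset_card_mono) auto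
  finally have "card (cells V) < card (cells U)" .
  moreover have "map nf_edge (bot_path V) = map nf_edge (bot_path U)"
    using nf_fold_dipole(1)[OF c(3) is_diagram_good_cell[OF assms(1) c(1)]
        is_diagram_good_cell[OF assms(1) c(2)]] is_diagram_good[OF assms(1)]
    by (simp add: V cancel_dipole_def)
  ultimately show ?thesis using cancel_is_diagram[OF assms(1) d] V by (simp add: cancel_dipole_def)
qed

lemma cancels_star_props:
  assumes "cancels\<^sup>*\<^sup>* U V" "is_diagram R U"
  shows "is_diagram R V \<and> topw V = topw U \<and> map nf_edge (bot_path V) = map nf_edge (bot_path U)"
  using assms
proof (induction rule: rtranclp_induct)
  case (step V V')
  then show ?case using cancels_props[of V V'] by simp
qed simp

lemma ex_reduced: "is_diagram R U \<Longrightarrow> \<exists>V. cancels\<^sup>*\<^sup>* U V \<and> reduced V"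
proof (induction "card (cells U)" arbitrary: U rule: less_induct)
  case less
  show ?case
  proof (cases "reduced U")
    case False
    then obtain V where V: "cancels U V" by (auto simp: reduced_def cancels_def)
    from cancels_props[OF less.prems V] less.hyps obtain W where "cancels\<^sup>*\<^sup>* V W" "reduced W" by blast
    then show ?thesis using V by (meson converse_rtranclp_into_rtranclp)
  qed blast
qed

text \<open>Existence comes from the decreasing number of cells. For uniqueness, cancellation
  preserves the normalised bottom path, and the bottom path of a reduced diagram is its own
  normalisation.\<close>

lemma reduced_form_props:
  assumes "is_diagram R U"
  shows reduced_form_eq: "reduced_form U = mk_diagram (topw U) (map nf_edge (bot_path U))"
    and is_diagram_reduced_form: "is_diagram R (mk_diagram (topw U) (map nf_edge (bot_path U)))"
proof -
  have u: "V = mk_diagram (topw U) (map nf_edge (bot_path U)) \<and> is_diagram R V"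
    if "cancels\<^sup>*\<^sup>* U V" "reduced V" for V
  proof -
    note p = cancels_star_props[OF that(1) assms]
    have "map nf_edge (bot_path V) = bot_path V"
      using map_nf_normal is_diagram_good reduced_iff p that(2) by metis
    then show ?thesis using p is_diagram_mk[of V] by simp
  qed
  obtain V where V: "cancels\<^sup>*\<^sup>* U V" "reduced V" using ex_reduced[OF assms] by blast
  show "reduced_form U = mk_diagram (topw U) (map nf_edge (bot_path U))"
    unfolding reduced_form_def by (rule the_equality) (use V u in blast)+
  show "is_diagram R (mk_diagram (topw U) (map nf_edge (bot_path U)))" using u[OF V] by auto
qed

inductive attach :: "'a diagram \<Rightarrow> 'a diagram \<Rightarrow> bool" where
  "(map label es, v) \<in> R \<Longrightarrow> attach (Diagram w C (p @ es @ q))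
     (Diagram w (insert (Cell es v) C) (p @ cell_bot (Cell es v) @ q))"

lemma attach_is_diagram: "attach\<^sup>*\<^sup>* U V \<Longrightarrow> is_diagram R U \<Longrightarrow> is_diagram R V"
  by (induction rule: rtranclp_induct) (auto elim!: attach.cases intro: is_diagram.is_diagram_attach)

lemma attach_concat:
  assumes V: "is_diagram R V" and U: "is_diagram R U" and w: "botw U = topw V"
  shows "attach\<^sup>*\<^sup>* U (concat_diagram U V)"
  using V w
proof (induction rule: is_diagram.induct)
  case (is_diagram_degenerate w)
  have "concat_diagram U (degenerate w) = U"
    using is_diagram_degenerate
    by (auto simp: concat_diagram_def degenerate_def rename_glue_path_of_word botw_def)
  then show ?case by simp
next
  case (is_diagram_attach w C p es q v)
  let ?r = "rename_edge (glue (bot_path U))" and ?rc = "rename_cell (glue (bot_path U))"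
  have w: "w = map label (bot_path U)" using is_diagram_attach.prems by (simp add: botw_def)
  have "good_path w es" using is_diagram_good[OF is_diagram_attach.hyps(1)] by simp
  then have "map label (map ?r es) = map label es"
    using label_rename[OF is_diagram_good[OF U]] w by simp
  then have r: "(map label (map ?r es), v) \<in> R" using is_diagram_attach.hyps(2) by (simp del: map_map)
  have b: "map ?r (cell_bot (Cell es v)) = cell_bot (Cell (map ?r es) v)" by (simp add: cell_bot_def)
  have "attach (concat_diagram U (Diagram w C (p @ es @ q)))
     (concat_diagram U (Diagram w (insert (Cell es v) C) (p @ cell_bot (Cell es v) @ q)))"
    using attach.intros[OF r, of "topw U" "cells U \<union> ?rc ` C" "map ?r p" "map ?r q"]
    by (simp add: concat_diagram_def b)
  moreover have "attach\<^sup>*\<^sup>* U (concat_diagram U (Diagram w C (p @ es @ q)))"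
    using is_diagram_attach by (simp add: botw_def)
  ultimately show ?case by simp
qed

lemma concat_is_diagram:
  "is_diagram R U \<Longrightarrow> is_diagram R V \<Longrightarrow> botw U = topw V \<Longrightarrow> is_diagram R (concat_diagram U V)"
  using attach_is_diagram[OF attach_concat] by blast

text \<open>Replaces the unknown remainder \<open>F\<close> by a chain of single attachments. For
  the converse each new cell has to be pulled back to \<open>F\<close>: renaming maps the bottom
  path of \<open>F\<close> edge by edge onto that of \<open>W\<close>, so the segment
  \<open>es\<close> has a preimage with the same labels.\<close>

lemma is_prefix_iff_attach: "is_prefix R V W \<longleftrightarrow> is_diagram R V \<and> attach\<^sup>*\<^sup>* V W"
proof
  assume "is_prefix R V W"
  then obtain F where "is_diagram R V" "is_diagram R F" "botw V = topw F" "W = concat_diagram V F"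
    unfolding is_prefix_def by (elim exE conjE) (rule that)
  then show "is_diagram R V \<and> attach\<^sup>*\<^sup>* V W" using attach_concat[of F V] by simp
next
  assume a: "is_diagram R V \<and> attach\<^sup>*\<^sup>* V W"
  then have dV: "is_diagram R V" by simp
  from a have "attach\<^sup>*\<^sup>* V W" by simp
  then have "\<exists>F. is_diagram R F \<and> botw V = topw F \<and> W = concat_diagram V F"
  proof (induction rule: rtranclp_induct)
    case base
    have "concat_diagram V (degenerate (botw V)) = V"
      by (simp add: concat_diagram_def degenerate_def rename_glue_path_of_word botw_def)
    moreover have "botw V = topw (degenerate (botw V))" by (simp add: degenerate_def)
    ultimately show ?case using is_diagram_degenerate
      by (intro exI[of _ "degenerate (botw V)"] conjI) simp_all
  next
    case (step W W')
    let ?r = "rename_edge (glue (bot_path V))" and ?rc = "rename_cell (glue (bot_path V))"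
    from step obtain F where F: "is_diagram R F" "botw V = topw F" "W = concat_diagram V F" by blast
    obtain es v w C p q where s: "(map label es, v) \<in> R"
      "W = Diagram w C (p @ es @ q)"
      "W' = Diagram w (insert (Cell es v) C) (p @ cell_bot (Cell es v) @ q)"
      using step.hyps(2)[unfolded attach.simps] by (elim exE conjE) (rule that)
    have "map ?r (bot_path F) = p @ es @ q" using F(3) s(2) by (simp add: concat_diagram_def)
    then obtain p' r' where b1: "bot_path F = p' @ r'" "map ?r p' = p" "map ?r r' = es @ q"
      by (metis append_eq_map_conv)
    from b1(3) obtain es' q' where "r' = es' @ q'" "map ?r es' = es" "map ?r q' = q"
      by (metis append_eq_map_conv)
    with b1 have b: "bot_path F = p' @ es' @ q'" "map ?r p' = p" "map ?r es' = es" "map ?r q' = q"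
      by simp_all
    have gF: "good_path (topw F) (bot_path F)" using is_diagram_good[OF F(1)] .
    then have "map label (map ?r es') = map label es'"
      using label_rename[OF is_diagram_good[OF dV]] b(1) F(2) by (simp add: botw_def)
    then have l: "map label es' = map label es" using b(3) by simp
    let ?F = "Diagram (topw F) (insert (Cell es' v) (cells F)) (p' @ cell_bot (Cell es' v) @ q')"
    have "F = Diagram (topw F) (cells F) (p' @ es' @ q')" using b(1) by (cases F) simp
    then have "is_diagram R (Diagram (topw F) (cells F) (p' @ es' @ q'))" using F(1) by simp
    moreover have "(map label es', v) \<in> R" unfolding l by (rule s(1))
    ultimately have "is_diagram R ?F" by (rule is_diagram.is_diagram_attach)
    moreover have "map ?r (cell_bot (Cell es' v)) = cell_bot (Cell es v)"
      using b(3) by (simp add: cell_bot_def)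
    then have "W' = concat_diagram V ?F"
      using F(3) s(2,3) b(2-4) by (simp add: concat_diagram_def)
    ultimately show ?case using F(2) by (intro exI[of _ ?F]) simp
  qed
  then show "is_prefix R V W" using dV unfolding is_prefix_def by blast
qed

text \<open>The action of a diagram with bottom path \<open>B\<close> on normal names.\<close>

definition act :: "'a edge list \<Rightarrow> 'a edge \<Rightarrow> 'a edge" where
  "act B e = nf_edge (rename_edge (glue B) e)"

text \<open>The vertices of the complex, in terms of their bottom paths.\<close>

definition npath :: "'a list \<Rightarrow> 'a edge list \<Rightarrow> bool" where
  "npath w B \<longleftrightarrow> is_diagram R (mk_diagram w B) \<and> normal_path B"

lemma npath_good: "npath w B \<Longrightarrow> good_path w B"
  using is_diagram_good[of "mk_diagram w B"] by (simp add: npath_def)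

lemma npath_normal: "npath w B \<Longrightarrow> normal_path B"
  by (simp add: npath_def)

lemma npath_distinct: "npath w B \<Longrightarrow> distinct B"
  using is_diagram_struct(3)[of "mk_diagram w B"] by (simp add: npath_def)

lemma npath_path_of_word: "npath w (path_of_word w)"
  using is_diagram_degenerate[of R w] by (auto simp: npath_def degenerate_eq path_of_word_def)

section \<open>Vertices as normal paths, and moves between them\<close>

lemma vertices_iff: "U \<in> vertices R w \<longleftrightarrow> U = mk_diagram w (bot_path U) \<and> npath w (bot_path U)"
  using is_diagram_mk[of U] reduced_iff[of U]
  unfolding vertices_def npath_def mem_Collect_eq by (metis mk_diagram_sel(1))

lemma mk_in_vertices [simp]: "mk_diagram w B \<in> vertices R w \<longleftrightarrow> npath w B"
  by (simp add: vertices_iff)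

lemma npath_nf: "is_diagram R U \<Longrightarrow> npath (topw U) (map nf_edge (bot_path U))"
  using is_diagram_reduced_form[of U] is_diagram_good[of U] normal_nf by (auto simp: npath_def)

lemma npath_att:
  assumes "npath w (p @ es @ q)" "(map label es, v) \<in> R"
  shows "npath w (p @ att es v @ q)"
proof -
  have "is_diagram R (mk_diagram w (p @ es @ q))" using assms(1) by (simp add: npath_def)
  then have "is_diagram R (Diagram w (insert (Cell es v) (cells (mk_diagram w (p @ es @ q))))
      (p @ cell_bot (Cell es v) @ q))"
    unfolding mk_diagram_def by (intro is_diagram.is_diagram_attach) (simp_all add: assms)
  from npath_nf[OF this] have "npath w (map nf_edge p @ att (map nf_edge es) v @ map nf_edge q)"
    by (simp add: map_nf_cell_bot)
  moreover have "map nf_edge X = X" if "set X \<subseteq> set (p @ es @ q)" for X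
  proof (rule map_nf_normal)
    show "good_path w X" "normal_path X"
      using npath_good[OF assms(1)] npath_normal[OF assms(1)] that by auto
  qed
  from this[of p] this[of es] this[of q] have "map nf_edge p = p" "map nf_edge es = es" "map nf_edge q = q"
    by auto
  ultimately show ?thesis by simp
qed

text \<open>Every normal path is reached from the top word by moves through normal paths only. So a
  function whose change under each move is known can be followed along any diagram; connectedness,
  additivity of the heights and the eventual presence of a cell are proved in this way.\<close>

lemma npath_induct [consumes 1, case_names word att]:
  assumes "npath w B" "P (path_of_word w)"
    "\<And>p es q v. npath w (p @ es @ q) \<Longrightarrow> (map label es, v) \<in> R \<Longrightarrow> P (p @ es @ q) \<Longrightarrow> P (p @ att es v @ q)"
  shows "P B"
proof -
  have "is_diagram R U \<Longrightarrow> topw U = w \<Longrightarrow> P (map nf_edge (bot_path U))" for U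
  proof (induction rule: is_diagram.induct)
    case (is_diagram_degenerate w')
    have "map nf_edge (path_of_word w) = path_of_word w" by (auto simp: path_of_word_def)
    then show ?case using is_diagram_degenerate assms(2) by (simp add: degenerate_def)
  next
    case (is_diagram_attach w' C p es q v)
    have "good_path w (p @ es @ q)"
      using is_diagram_good[OF is_diagram_attach.hyps(1)] is_diagram_attach.prems by simp
    then have "map label (map nf_edge es) = map label es" by (intro map_label_nf) auto
    then have "(map label (map nf_edge es), v) \<in> R" using is_diagram_attach.hyps(2) by (simp del: map_map)
    moreover have "npath w (map nf_edge p @ map nf_edge es @ map nf_edge q)"
      using npath_nf[OF is_diagram_attach.hyps(1)] is_diagram_attach.prems by simp
    moreover have "P (map nf_edge p @ map nf_edge es @ map nf_edge q)"
      using is_diagram_attach.IH is_diagram_attach.prems by simp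
    ultimately have "P (map nf_edge p @ att (map nf_edge es) v @ map nf_edge q)" by (intro assms(3))
    then show ?case by (simp add: map_nf_cell_bot)
  qed
  from this[of "mk_diagram w B"] show ?thesis
    using assms(1) map_nf_normal[OF npath_good[OF assms(1)] npath_normal[OF assms(1)]] by (simp add: npath_def)
qed

lemma prod_props:
  assumes "is_diagram R U" "is_diagram R V" "botw U = topw V"
  shows diagram_prod_eq: "diagram_prod U V = mk_diagram (topw U) (map (act (bot_path U)) (bot_path V))"
    and npath_act: "npath (topw U) (map (act (bot_path U)) (bot_path V))"
proof -
  note d = concat_is_diagram[OF assms]
  show "diagram_prod U V = mk_diagram (topw U) (map (act (bot_path U)) (bot_path V))"
    using reduced_form_eq[OF d] by (simp add: diagram_prod_def concat_diagram_def act_def[abs_def] comp_def)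
  show "npath (topw U) (map (act (bot_path U)) (bot_path V))"
    using npath_nf[OF d] by (simp add: concat_diagram_def act_def[abs_def] comp_def)
qed

lemma act_props:
  assumes "good_path w B" "good_edge R (map label B) e"
  shows good_act: "good_edge R w (act B e)" and label_act: "label (act B e) = label e"
    and normal_act: "normal_edge (act B e)"
  using assms good_rename label_rename good_nf label_nf normal_nf unfolding act_def by metis+

text \<open>The action commutes with moves even if the move cancels: then \<open>es\<close> is the
  bottom path of some \<open>c1\<close>, its image is a move of the image of the top path of
  \<open>c1\<close>, and \<open>att_att\<close> leads back.\<close>

lemma map_act_att:
  assumes B: "good_path w B" and e: "good_path (map label B) es" "(map label es, v) \<in> R"
  shows "map (act B) (att es v) = att (map (act B) es) v"
    and "map (act B) (cell_bot (Cell es v)) = att (map (act B) es) v"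
proof -
  show c: "map (act B) (cell_bot (Cell es v)) = att (map (act B) es) v"
    by (simp add: cell_bot_def att_def comp_def act_def[abs_def])
  have ne: "es \<noteq> []" using rel_nonempty e(2) by fastforce
  show "map (act B) (att es v) = att (map (act B) es) v"
    using att_cases[OF ne, of v]
  proof (elim disjE exE conjE)
    fix c1 assume c1: "inverse_cells c1 (Cell es v)" "att es v = cell_top c1"
    obtain fs u where f: "c1 = Cell fs u" by (cases c1)
    have es: "es = cell_bot (Cell fs u)" using c1 f by (simp add: inverse_cells_def)
    have g: "good_path (map label B) fs" "(map label fs, u) \<in> R"
      using cell_top_good[OF c1(1) e(1) ne] f by auto
    let ?fs = "map (act B) fs"
    have l: "map label ?fs = v" using g(1) label_act[OF B] c1(1) f by (simp add: inverse_cells_def cell_topword_def)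
    have m: "map (act B) es = att ?fs u" unfolding es
      by (simp add: cell_bot_def att_def) (simp add: act_def comp_def cong: map_cong)
    have "map label ?fs = map label fs" using g(1) label_act[OF B] by simp
    then have r: "(map label ?fs, u) \<in> R" using g(2) by (simp del: map_map)
    have "good_path w ?fs" "normal_path ?fs" using g(1) good_act[OF B] normal_act[OF B] by auto
    from att_att[OF this r] show ?thesis using m l c1(2) f by simp
  next
    assume "att es v = cell_bot (Cell es v)"
    then show ?thesis using c by simp
  qed
qed

lemma act_act:
  assumes B: "good_path w B" and B': "good_path (map label B) B'" and e: "good_edge R (map label B') e"
  shows "act B (act B' e) = act (map (act B) B') e"
proof -
  let ?r = "rename_edge (glue B)"
  have g: "good_edge R (map label B) (rename_edge (glue B') e)" using good_rename[OF B' e] .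
  have gB: "good_path w (map ?r B')" using good_rename[OF B] B' by simp
  have l: "map label (map ?r B') = map label B'" using label_rename[OF B] B' by simp
  have "act B (act B' e) = nf_edge (?r (rename_edge (glue B') e))"
    unfolding act_def by (rule nf_rename_nf(1)[OF B g])
  also have "\<dots> = nf_edge (rename_edge (glue (map ?r B')) e)" using rename_glue_rename(1)[OF e] by simp
  also have "\<dots> = nf_edge (rename_edge (glue (map nf_edge (map ?r B'))) e)"
    by (rule nf_rename_glue_nf(1)[OF gB, symmetric]) (unfold l, rule e)
  finally show ?thesis by (simp add: act_def comp_def cong: map_cong)
qed

lemma act_path_of_word: "good_edge R w e \<Longrightarrow> normal_edge e \<Longrightarrow> act (path_of_word w) e = e"
  using rename_glue_degenerate(1)[of R w e] nf_normal(1)[of w e] unfolding act_def by metis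

end

section \<open>Points of a cube\<close>

text \<open>The mean value of \<open>f\<close> at a random path: the blocks \<open>(t, a, b)\<close> independently
contribute \<open>a\<close> with probability \<open>t\<close> and \<open>b\<close> otherwise.\<close>

primrec expect :: "(real \<times> 'p list \<times> 'p list) list \<Rightarrow> ('p list \<Rightarrow> real) \<Rightarrow> real" where
  "expect [] f = f []"
| "expect (x # xs) f = fst x * expect xs (\<lambda>r. f (fst (snd x) @ r)) +
     (1 - fst x) * expect xs (\<lambda>r. f (snd (snd x) @ r))"

primrec outcomes :: "(real \<times> 'p list \<times> 'p list) list \<Rightarrow> 'p list set" where
  "outcomes [] = {[]}"
| "outcomes (x # xs) = (\<lambda>r. fst (snd x) @ r) ` outcomes xs \<union> (\<lambda>r. snd (snd x) @ r) ` outcomes xs"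

lemma finite_outcomes [simp]: "finite (outcomes xs)"
  by (induction xs) auto

lemma expect_cong: "(\<And>B. B \<in> outcomes xs \<Longrightarrow> f B = g B) \<Longrightarrow> expect xs f = expect xs g"
proof (induction xs arbitrary: f g)
  case (Cons x xs)
  have "expect xs (\<lambda>r. f (fst (snd x) @ r)) = expect xs (\<lambda>r. g (fst (snd x) @ r))"
    "expect xs (\<lambda>r. f (snd (snd x) @ r)) = expect xs (\<lambda>r. g (snd (snd x) @ r))"
    by (rule Cons.IH, rule Cons.prems, simp)+
  then show ?case by simp
qed simp

lemma expect_add: "expect xs (\<lambda>B. f B + g B) = expect xs f + expect xs g"
  by (induction xs arbitrary: f g) (simp_all add: algebra_simps)

lemma expect_cmult: "expect xs (\<lambda>B. c * f B) = c * expect xs f"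
  by (induction xs arbitrary: f) (simp_all add: algebra_simps)

lemma expect_const [simp]: "expect xs (\<lambda>B. c) = c"
  by (induction xs) (simp_all add: algebra_simps)

lemma expect_sum: "finite Z \<Longrightarrow> expect xs (\<lambda>B. \<Sum>z\<in>Z. f z B) = (\<Sum>z\<in>Z. expect xs (f z))"
  by (induction Z rule: finite_induct) (simp_all add: expect_add)

lemma expect_append: "expect (xs @ ys) f = expect xs (\<lambda>a. expect ys (\<lambda>b. f (a @ b)))"
  by (induction xs arbitrary: f) simp_all

lemma expect_map:
  "expect xs (\<lambda>B. f (map h B)) = expect (map (\<lambda>x. (fst x, map h (fst (snd x)), map h (snd (snd x)))) xs) f"
proof (induction xs arbitrary: f)
  case (Cons x xs)
  show ?case using Cons[of "\<lambda>r. f (map h (fst (snd x)) @ r)"] Cons[of "\<lambda>r. f (map h (snd (snd x)) @ r)"]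
    by simp
qed simp

text \<open>Different outcomes may have the same image under \<open>m\<close>, so their weights are
  collected by value. Outside the finite set of values all weights vanish.\<close>

lemma sum_expect:
  fixes m :: "'p list \<Rightarrow> 'w" and F :: "'w \<Rightarrow> real"
  shows "(\<Sum>W | expect xs (\<lambda>B. of_bool (m B = W)) \<noteq> 0. expect xs (\<lambda>B. of_bool (m B = W)) * F W) =
    expect xs (\<lambda>B. F (m B))" (is "sum _ ?A = _")
proof -
  let ?Z = "m ` outcomes xs"
  have z: "expect xs (\<lambda>B. of_bool (m B = W)) = 0" if "W \<notin> ?Z" for W
  proof -
    have "expect xs (\<lambda>B. of_bool (m B = W)) = expect xs (\<lambda>B. 0)"
      by (rule expect_cong) (use that in auto)
    then show ?thesis by simp
  qed
  have "sum (\<lambda>W. expect xs (\<lambda>B. of_bool (m B = W)) * F W) ?A =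
      sum (\<lambda>W. expect xs (\<lambda>B. of_bool (m B = W)) * F W) ?Z"
    by (rule sum.mono_neutral_left) (use z in auto)
  also have "\<dots> = (\<Sum>W\<in>?Z. expect xs (\<lambda>B. F W * of_bool (m B = W)))"
    by (simp add: expect_cmult mult.commute)
  also have "\<dots> = expect xs (\<lambda>B. \<Sum>W\<in>?Z. F W * of_bool (m B = W))"
    by (rule expect_sum[where f = "\<lambda>W B. F W * of_bool (m B = W)", symmetric]) simp
  also have "\<dots> = expect xs (\<lambda>B. F (m B))"
  proof (rule expect_cong)
    fix B assume B: "B \<in> outcomes xs"
    have "(\<Sum>W\<in>?Z. F W * of_bool (m B = W)) = (\<Sum>W\<in>?Z. if W = m B then F W else 0)"
      by (intro sum.cong) auto
    also have "\<dots> = F (m B)" using B by (simp add: sum.delta)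
    finally show "(\<Sum>W\<in>?Z. F W * of_bool (m B = W)) = F (m B)" .
  qed
  finally show ?thesis .
qed

text \<open>A thin diagram is read from left to right as a list of edges lying on no cell and of cells.\<close>

type_synonym 'a block = "'a edge + 'a cell"

fun block_path1 :: "'a cell set \<Rightarrow> 'a block \<Rightarrow> 'a edge list" where
  "block_path1 S (Inl e) = [e]"
| "block_path1 S (Inr c) = (if c \<in> S then cell_bot c else cell_top c)"

definition block_path :: "'a cell set \<Rightarrow> 'a block list \<Rightarrow> 'a edge list" where
  "block_path S bs = concat (map (block_path1 S) bs)"

definition block_cells :: "'a block list \<Rightarrow> 'a cell set" where
  "block_cells bs = {c. Inr c \<in> set bs}"

definition block_diagram :: "'a list \<Rightarrow> 'a block list \<Rightarrow> 'a cell set \<Rightarrow> 'a diagram" where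
  "block_diagram w bs S = Diagram w S (block_path S bs)"

lemma block_path_simps [simp]:
  "block_path S [] = []" "block_path S (b # bs) = block_path1 S b @ block_path S bs"
  "block_path S (bs @ bs') = block_path S bs @ block_path S bs'"
  by (simp_all add: block_path_def)

lemma block_cells_simps [simp]:
  "block_cells [] = {}" "block_cells (Inl e # bs) = block_cells bs"
  "block_cells (Inr c # bs) = insert c (block_cells bs)"
  "block_cells (bs @ bs') = block_cells bs \<union> block_cells bs'"
  by (auto simp: block_cells_def)

lemma block_cells_Inl [simp]: "block_cells (map Inl es) = {}"
  by (auto simp: block_cells_def)

lemma finite_block_cells [simp]: "finite (block_cells bs)"
proof -
  have "block_cells bs \<subseteq> (\<lambda>b. case b of Inl e \<Rightarrow> undefined | Inr c \<Rightarrow> c) ` set bs"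
    by (force simp: block_cells_def)
  then show ?thesis by (rule finite_subset) simp
qed

lemma block_path_cong: "(\<And>c. c \<in> block_cells bs \<Longrightarrow> c \<in> S \<longleftrightarrow> c \<in> S') \<Longrightarrow> block_path S bs = block_path S' bs"
proof (induction bs)
  case (Cons b bs)
  then show ?case by (cases b) auto
qed simp

lemma block_path_Inl [simp]: "block_path S (map Inl es) = es"
  by (induction es) simp_all

definition block_weight :: "('a cell \<Rightarrow> real) \<Rightarrow> 'a block \<Rightarrow> real \<times> 'a edge list \<times> 'a edge list" where
  "block_weight t b = (case b of Inl e \<Rightarrow> (0, [e], [e]) | Inr c \<Rightarrow> (t c, cell_bot c, cell_top c))"

lemma block_weight_simps [simp]:
  "block_weight t (Inl e) = (0, [e], [e])" "block_weight t (Inr c) = (t c, cell_bot c, cell_top c)"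
  by (simp_all add: block_weight_def)

text \<open>Independence of the cells: the sum over subsets splits according to whether the cell of
  the first block belongs to the subset. Distinctness of the blocks keeps a cell from being decided
  twice.\<close>

lemma sum_subsets_expect:
  "distinct bs \<Longrightarrow> (\<Sum>S\<in>Pow (block_cells bs).
     (\<Prod>c\<in>block_cells bs. if c \<in> S then t c else 1 - t c) * f (block_path S bs)) =
   expect (map (block_weight t) bs) f"
proof (induction bs arbitrary: f)
  case (Cons b bs)
  show ?case
  proof (cases b)
    case (Inl e)
    then show ?thesis using Cons.IH[of "\<lambda>r. f (e # r)"] Cons.prems by simp
  next
    case (Inr c)
    let ?A = "block_cells bs"
    let ?p = "\<lambda>A S. \<Prod>c\<in>A. if c \<in> S then t c else 1 - t c"
    have c: "c \<notin> ?A" using Cons.prems Inr by (auto simp: block_cells_def)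
    have i: "inj_on (insert c) (Pow ?A)" "Pow ?A \<inter> insert c ` Pow ?A = {}"
      using c by (auto simp: inj_on_def)
    have q: "block_path (insert c S) bs = block_path S bs" for S
      by (rule block_path_cong) (use c in auto)
    have p1: "?p (insert c ?A) (insert c S) = t c * ?p ?A S" if "S \<in> Pow ?A" for S
    proof -
      have "?p ?A (insert c S) = ?p ?A S" by (rule prod.cong) (use c in auto)
      then show ?thesis using c by simp
    qed
    have p0: "?p (insert c ?A) S = (1 - t c) * ?p ?A S" if "S \<in> Pow ?A" for S
      using c that by auto
    have "(\<Sum>S\<in>Pow (insert c ?A). ?p (insert c ?A) S * f (block_path S (b # bs))) =
       (\<Sum>S\<in>Pow ?A. ?p (insert c ?A) S * f (block_path S (b # bs))) +
       (\<Sum>S\<in>Pow ?A. ?p (insert c ?A) (insert c S) * f (block_path (insert c S) (b # bs)))"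
      unfolding Pow_insert using i by (simp add: sum.union_disjoint sum.reindex)
    also have "(\<Sum>S\<in>Pow ?A. ?p (insert c ?A) S * f (block_path S (b # bs))) =
       (\<Sum>S\<in>Pow ?A. (1 - t c) * (?p ?A S * f (cell_top c @ block_path S bs)))"
    proof (rule sum.cong)
      fix S assume S: "S \<in> Pow ?A"
      then have "c \<notin> S" using c by auto
      then show "?p (insert c ?A) S * f (block_path S (b # bs)) =
        (1 - t c) * (?p ?A S * f (cell_top c @ block_path S bs))"
        using p0[OF S] Inr by simp
    qed simp
    also have "(\<Sum>S\<in>Pow ?A. ?p (insert c ?A) (insert c S) * f (block_path (insert c S) (b # bs))) =
       (\<Sum>S\<in>Pow ?A. t c * (?p ?A S * f (cell_bot c @ block_path S bs)))"
    proof (rule sum.cong)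
      fix S assume S: "S \<in> Pow ?A"
      show "?p (insert c ?A) (insert c S) * f (block_path (insert c S) (b # bs)) =
        t c * (?p ?A S * f (cell_bot c @ block_path S bs))"
        using p1[OF S] Inr q[of S] by simp
    qed simp
    finally show ?thesis
      using Cons.IH[of "\<lambda>r. f (cell_top c @ r)"] Cons.IH[of "\<lambda>r. f (cell_bot c @ r)"] Cons.prems Inr
      by (simp add: sum_distrib_left[symmetric] del: Pow_insert)
  qed
qed simp

fun is_Top :: "'a edge \<Rightarrow> bool" where
  "is_Top (Top i a) = True"
| "is_Top (Bot c j) = False"

text \<open>In a thin diagram the next cell is attached along edges of the top path of the whole
  diagram. With all cells of \<open>bs\<close> attached, such edges come only from
  \<open>Inl\<close> blocks, so the segment is a run of these, ready to be replaced by one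
  \<open>Inr\<close> block.\<close>

lemma split_blocks:
  assumes "block_path S bs = p @ es @ q" "es \<noteq> []" "\<forall>e\<in>set es. is_Top e"
    "block_cells bs \<subseteq> S" "\<forall>c\<in>block_cells bs. cell_botword c \<noteq> []"
  shows "\<exists>bs1 bs2. bs = bs1 @ map Inl es @ bs2 \<and> block_path S bs1 = p \<and> block_path S bs2 = q"
  using assms
proof (induction bs arbitrary: p es)
  case (Cons b bs)
  have sub: "block_cells bs \<subseteq> S" "\<forall>c\<in>block_cells bs. cell_botword c \<noteq> []"
    using Cons.prems(4,5) by (cases b; auto)+
  have ne: "block_path1 S b \<noteq> []" using Cons.prems(4,5) by (cases b) (auto simp: cell_bot_def)
  have inl: "b = Inl e" if "e \<in> set (block_path1 S b)" "is_Top e" for e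
    using that Cons.prems(4) by (cases b) (auto simp: set_cell_bot)
  show ?case
  proof (cases p)
    case Nil
    obtain e es' where es: "es = e # es'" using Cons.prems(2) by (cases es) auto
    have "e \<in> set (block_path1 S b)" using Cons.prems(1) Nil es ne by (cases "block_path1 S b") auto
    then have b: "b = Inl e" using inl Cons.prems(3) es by simp
    then have r: "block_path S bs = [] @ es' @ q" using Cons.prems(1) Nil es by simp
    show ?thesis
    proof (cases "es' = []")
      case True
      then show ?thesis using b es Nil r by (intro exI[of _ "[]"] exI[of _ bs]) simp
    next
      case False
      obtain bs1 bs2 where h: "bs = bs1 @ map Inl es' @ bs2" "block_path S bs1 = []" "block_path S bs2 = q"
        using Cons.IH[OF r False _ sub] Cons.prems(3) es by auto
      have "bs1 = []"
      proof (cases bs1)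
        case (Cons b' bs')
        then have "block_path1 S b' \<noteq> []" using sub h(1) by (cases b') (auto simp: cell_bot_def)
        then show ?thesis using h(2) Cons by simp
      qed simp
      then show ?thesis using h b es Nil by (intro exI[of _ "[]"] exI[of _ bs2]) simp
    qed
  next
    case p: (Cons x p')
    have "\<exists>p''. p = block_path1 S b @ p''"
    proof -
      have "block_path1 S b @ block_path S bs = p @ (es @ q)" using Cons.prems(1) by simp
      then consider u where "p = block_path1 S b @ u"
        | u where "block_path1 S b = p @ u" "es @ q = u @ block_path S bs"
        by (metis append_eq_append_conv2)
      then show ?thesis
      proof cases
        case 2
        show ?thesis
        proof (cases u)
          case (Cons e u')
          then have "e \<in> set (block_path1 S b)" "is_Top e"
            using 2 \<open>es \<noteq> []\<close> \<open>\<forall>e\<in>set es. is_Top e\<close> by (cases es; simp)+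
          then have "b = Inl e" using inl by blast
          then show ?thesis using 2 p Cons by simp
        qed (use 2 in simp)
      qed blast
    qed
    then obtain p'' where p'': "p = block_path1 S b @ p''" by blast
    then have "block_path S bs = p'' @ es @ q" using Cons.prems(1) by simp
    from Cons.IH[OF this Cons.prems(2,3) sub] obtain bs1 bs2 where
      "bs = bs1 @ map Inl es @ bs2" "block_path S bs1 = p''" "block_path S bs2 = q" by blast
    then show ?thesis using p'' by (intro exI[of _ "b # bs1"] exI[of _ bs2]) simp
  qed
qed simp

text \<open>A cell of a cube together with its coordinate, or, with \<open>None\<close>, an edge
  lying on no cell. The names are those of the vertex above the cube, not those of the thin
  diagram.\<close>

type_synonym 'a item = "real \<times> 'a edge list \<times> 'a list option"

definition item_block :: "'a item \<Rightarrow> real \<times> 'a edge list \<times> 'a edge list" where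
  "item_block x = (fst x, (case snd (snd x) of None \<Rightarrow> fst (snd x) | Some v \<Rightarrow> att (fst (snd x)) v),
     fst (snd x))"

text \<open>The point of the cube whose cells replace the segments \<open>es\<close> by \<open>v\<close>, for the
items \<open>(t, es, Some v)\<close>, with coordinates \<open>t\<close>.\<close>

definition point :: "'a list \<Rightarrow> 'a item list \<Rightarrow> 'a diagram \<Rightarrow> real" where
  "point w xs W = expect (map item_block xs) (\<lambda>B. of_bool (mk_diagram w B = W))"

definition item_dist :: "'a item list \<Rightarrow> 'a item list \<Rightarrow> real" where
  "item_dist xs ys = sqrt (\<Sum>i<length xs. (fst (xs ! i) - fst (ys ! i))\<^sup>2)"

lemma distinct_of_concat_map:
  "distinct (concat (map f bs)) \<Longrightarrow> (\<And>b. b \<in> set bs \<Longrightarrow> f b \<noteq> []) \<Longrightarrow> distinct bs"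
proof (induction bs)
  case (Cons b bs)
  have "b \<notin> set bs"
  proof
    assume "b \<in> set bs"
    then have "set (f b) \<subseteq> set (concat (map f bs))" by auto
    then show False using Cons.prems by (cases "f b") auto
  qed
  then show ?case using Cons by simp
qed simp

section \<open>Thin diagrams, their prefixes, and cubes as item lists\<close>

context presentation
begin

definition blocks :: "'a list \<Rightarrow> 'a block list \<Rightarrow> bool" where
  "blocks w bs \<longleftrightarrow> block_path {} bs = path_of_word w \<and>
     (\<forall>c\<in>block_cells bs. (cell_topword c, cell_botword c) \<in> R)"

lemma block_path1_nonempty:
  assumes "blocks w bs" "b \<in> set bs"
  shows "block_path1 {} b \<noteq> []"
proof (cases b)
  case (Inr c)
  then have "c \<in> block_cells bs" using assms(2) by (simp add: block_cells_def)
  then have "(cell_topword c, cell_botword c) \<in> R" using assms(1) by (simp add: blocks_def)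
  then show ?thesis using rel_nonempty Inr by (fastforce simp: cell_topword_def)
qed simp

lemma blocks_distinct:
  assumes "blocks w bs"
  shows "distinct bs"
proof -
  have "distinct (path_of_word w)" by (auto simp: path_of_word_def distinct_map inj_on_def)
  then show ?thesis
    using assms block_path1_nonempty[OF assms] distinct_of_concat_map[of "block_path1 {}" bs]
    by (simp add: blocks_def block_path_def)
qed

lemma blocks_split:
  assumes "blocks w bs" "c \<in> block_cells bs"
  obtains bs1 bs2 where "bs = bs1 @ Inr c # bs2" "c \<notin> block_cells bs1" "c \<notin> block_cells bs2"
proof -
  from assms(2) obtain bs1 bs2 where "bs = bs1 @ Inr c # bs2"
    by (auto simp: block_cells_def in_set_conv_decomp)
  then show thesis using that blocks_distinct[OF assms(1)] by (auto simp: block_cells_def)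
qed

lemma attach_block_diagram:
  assumes "blocks w bs" "c \<in> block_cells bs" "c \<notin> S"
  shows "attach (block_diagram w bs S) (block_diagram w bs (insert c S))"
proof -
  obtain bs1 bs2 where bs: "bs = bs1 @ Inr c # bs2" "c \<notin> block_cells bs1" "c \<notin> block_cells bs2"
    using blocks_split[OF assms(1,2)] .
  have "block_path (insert c S) bs1 = block_path S bs1" "block_path (insert c S) bs2 = block_path S bs2"
    using bs by (auto intro!: block_path_cong)
  moreover have "(cell_topword c, cell_botword c) \<in> R" using assms by (simp add: blocks_def)
  ultimately show ?thesis
    using attach.intros[of "cell_top c" "cell_botword c" w S "block_path S bs1" "block_path S bs2"]
      assms(3) bs(1) by (simp add: block_diagram_def cell_topword_def)
qed

lemma attach_star_block_diagram:
  assumes "blocks w bs" "finite T" "T \<subseteq> block_cells bs" "S \<inter> T = {}"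
  shows "attach\<^sup>*\<^sup>* (block_diagram w bs S) (block_diagram w bs (S \<union> T))"
  using assms(2-4)
proof (induction T rule: finite_induct)
  case (insert c T)
  then have "attach\<^sup>*\<^sup>* (block_diagram w bs S) (block_diagram w bs (S \<union> T))" by auto
  moreover have "attach (block_diagram w bs (S \<union> T)) (block_diagram w bs (insert c (S \<union> T)))"
    using insert by (intro attach_block_diagram[OF assms(1)]) auto
  ultimately show ?case by simp
qed simp

lemma block_diagram_is_diagram:
  assumes "blocks w bs" "S \<subseteq> block_cells bs"
  shows "is_diagram R (block_diagram w bs S)"
proof -
  have "block_diagram w bs {} = degenerate w"
    using assms(1) by (simp add: block_diagram_def degenerate_def blocks_def)
  moreover have "attach\<^sup>*\<^sup>* (block_diagram w bs {}) (block_diagram w bs S)"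
    using attach_star_block_diagram[OF assms(1) _ assms(2), of "{}"] finite_subset[OF assms(2)] by simp
  ultimately show ?thesis using attach_is_diagram[OF _ is_diagram_degenerate] by simp
qed

lemma thin_blocks:
  assumes "is_diagram R \<Phi>" "thin \<Phi>"
  shows "\<exists>bs. blocks (topw \<Phi>) bs \<and> \<Phi> = block_diagram (topw \<Phi>) bs (block_cells bs)"
  using assms
proof (induction rule: is_diagram.induct)
  case (is_diagram_degenerate w)
  show ?case
    by (rule exI[of _ "map Inl (path_of_word w)"]) (simp add: degenerate_def blocks_def block_diagram_def)
next
  case (is_diagram_attach w C p es q v)
  let ?c = "Cell es v"
  have ne: "es \<noteq> []" using rel_nonempty is_diagram_attach.hyps(2) by fastforce
  have "thin (Diagram w C (p @ es @ q))" using is_diagram_attach.prems by (simp add: thin_def top_path_def)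
  with is_diagram_attach.IH obtain bs where bs: "blocks w bs" "C = block_cells bs"
    "p @ es @ q = block_path C bs" by (auto simp: block_diagram_def)
  have "set es \<subseteq> set (path_of_word w)" using is_diagram_attach.prems by (simp add: thin_def top_path_def)
  then have tops: "\<forall>e\<in>set es. is_Top e" by (auto simp: path_of_word_def)
  have "\<forall>c\<in>block_cells bs. cell_botword c \<noteq> []" using bs(1) rel_nonempty by (fastforce simp: blocks_def)
  then obtain bs1 bs2 where s: "bs = bs1 @ map Inl es @ bs2" "block_path C bs1 = p" "block_path C bs2 = q"
    using split_blocks[OF bs(3)[symmetric] ne tops] bs(2) by blast
  have fresh: "?c \<notin> C" using attach_fresh[OF is_diagram_attach.hyps(1) ne] .
  have "block_path (insert ?c C) bs1 = p" "block_path (insert ?c C) bs2 = q"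
    using s(2,3) fresh bs(2) s(1) block_path_cong[of bs1 "insert ?c C" C]
      block_path_cong[of bs2 "insert ?c C" C] by auto
  moreover have "block_cells (bs1 @ [Inr ?c] @ bs2) = insert ?c C" using s(1) bs(2) by auto
  moreover have "blocks w (bs1 @ [Inr ?c] @ bs2)"
    using bs(1,2) s(1) is_diagram_attach.hyps(2) by (auto simp: blocks_def cell_topword_def)
  ultimately show ?case
    by (intro exI[of _ "bs1 @ [Inr ?c] @ bs2"]) (simp add: block_diagram_def)
qed

lemma thin_block_diagram: "blocks w bs \<Longrightarrow> thin (block_diagram w bs (block_cells bs))"
proof -
  assume b: "blocks w bs"
  have "set (cell_top c) \<subseteq> set (block_path {} bs)" if "c \<in> block_cells bs" for c
    using that by (force simp: block_cells_def block_path_def)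
  then show ?thesis using b by (simp add: thin_def block_diagram_def top_path_def blocks_def)
qed

text \<open>For the converse, cells are peeled off the full diagram: each removed cell has a block
  of its own, whose position is determined since the edges of a bottom path are distinct.\<close>

lemma is_prefix_block_diagram:
  assumes b: "blocks w bs"
  shows "is_prefix R V (block_diagram w bs (block_cells bs)) \<longleftrightarrow>
    (\<exists>S\<subseteq>block_cells bs. V = block_diagram w bs S)"
proof
  assume "\<exists>S\<subseteq>block_cells bs. V = block_diagram w bs S"
  then obtain S where S: "S \<subseteq> block_cells bs" "V = block_diagram w bs S" by blast
  then have "S \<union> (block_cells bs - S) = block_cells bs" by auto
  then show "is_prefix R V (block_diagram w bs (block_cells bs))"
    using attach_star_block_diagram[OF b, of "block_cells bs - S" S] S block_diagram_is_diagram[OF b S(1)]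
    unfolding is_prefix_iff_attach by auto
next
  assume "is_prefix R V (block_diagram w bs (block_cells bs))"
  then have "attach\<^sup>*\<^sup>* V (block_diagram w bs (block_cells bs))" "is_diagram R V"
    by (simp_all add: is_prefix_iff_attach)
  then show "\<exists>S\<subseteq>block_cells bs. V = block_diagram w bs S"
  proof (induction rule: converse_rtranclp_induct)
    case (step V V')
    from step.hyps(1)[unfolded attach.simps] obtain es v w' C p q where
      r: "(map label es, v) \<in> R" and V: "V = Diagram w' C (p @ es @ q)"
      and V': "V' = Diagram w' (insert (Cell es v) C) (p @ cell_bot (Cell es v) @ q)" by blast
    let ?c = "Cell es v"
    have ne: "es \<noteq> []" "v \<noteq> []" using rel_nonempty r by fastforce+
    have dV': "is_diagram R V'" using attach_is_diagram[OF r_into_rtranclp[of attach, OF step.hyps(1)] step.prems] .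
    then obtain S where S: "S \<subseteq> block_cells bs" "V' = block_diagram w bs S" using step.IH by blast
    have C: "insert ?c C = S" "w' = w" using S(2) V' by (simp_all add: block_diagram_def)
    have fresh: "?c \<notin> C" using attach_fresh step.prems V ne by blast
    obtain bs1 bs2 where bs: "bs = bs1 @ Inr ?c # bs2" "?c \<notin> block_cells bs1" "?c \<notin> block_cells bs2"
      using blocks_split[OF b] S(1) C by blast
    have "p @ cell_bot ?c @ q = block_path S bs1 @ cell_bot ?c @ block_path S bs2"
      using S(2) V' bs(1) C by (auto simp: block_diagram_def)
    moreover have "distinct (p @ cell_bot ?c @ q)" using is_diagram_struct(3)[OF dV'] V' by simp
    moreover have "cell_bot ?c \<noteq> []" using ne(2) by (simp add: cell_bot_def)
    ultimately have pq: "p = block_path S bs1" "q = block_path S bs2"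
      using append_eq_append_distinct by blast+
    have "block_path C bs1 = block_path S bs1" "block_path C bs2 = block_path S bs2"
      using bs C by (auto intro!: block_path_cong)
    then have "V = block_diagram w bs C"
      using V C pq bs(1) fresh by (simp add: block_diagram_def)
    then show ?case using C S(1) by blast
  qed blast
qed

lemma cube_point_block_diagram:
  assumes U: "U \<in> vertices R w" and b: "blocks (botw U) bs"
  shows "cube_point R U (block_diagram (botw U) bs (block_cells bs)) t W =
    expect (map (block_weight t) bs) (\<lambda>B. of_bool (mk_diagram w (map (act (bot_path U)) B) = W))"
proof -
  let ?D = "block_diagram (botw U) bs" and ?C = "block_cells bs"
  let ?p = "\<lambda>S. \<Prod>c\<in>?C. if c \<in> S then t c else 1 - t c"
  have dU: "is_diagram R U" "topw U = w" using U by (simp_all add: vertices_def)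
  have cs: "cells (?D S) = S" "topw (?D S) = botw U" "bot_path (?D S) = block_path S bs" for S
    by (simp_all add: block_diagram_def)
  have prod: "diagram_prod U (?D S) = mk_diagram w (map (act (bot_path U)) (block_path S bs))"
    if "S \<subseteq> ?C" for S
    using diagram_prod_eq[OF dU(1) block_diagram_is_diagram[OF b that]] cs dU(2) by simp
  have inj: "inj_on ?D A" for A by (auto simp: inj_on_def block_diagram_def)
  have "{V. is_prefix R V (?D ?C) \<and> diagram_prod U V = W} = ?D ` {S \<in> Pow ?C. diagram_prod U (?D S) = W}"
    unfolding is_prefix_block_diagram[OF b] by auto
  then have "cube_point R U (?D ?C) t W = (\<Sum>V\<in>?D ` {S \<in> Pow ?C. diagram_prod U (?D S) = W}.
      \<Prod>c\<in>?C. if c \<in> cells V then t c else 1 - t c)"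
    unfolding cube_point_def cs by simp
  also have "\<dots> = (\<Sum>S\<in>{S \<in> Pow ?C. diagram_prod U (?D S) = W}. ?p S)"
    by (simp only: sum.reindex[OF inj] comp_def cs)
  also have "\<dots> = (\<Sum>S\<in>Pow ?C. ?p S * of_bool (diagram_prod U (?D S) = W))"
    by (rule sum.mono_neutral_cong_left) auto
  also have "\<dots> = (\<Sum>S\<in>Pow ?C. ?p S *
      of_bool (mk_diagram w (map (act (bot_path U)) (block_path S bs)) = W))"
    using prod by (intro sum.cong) auto
  also have "\<dots> = expect (map (block_weight t) bs) (\<lambda>B. of_bool (mk_diagram w (map (act (bot_path U)) B) = W))"
    by (rule sum_subsets_expect[OF blocks_distinct[OF b]])
  finally show ?thesis .
qed

definition item :: "'a edge list \<Rightarrow> ('a cell \<Rightarrow> real) \<Rightarrow> 'a block \<Rightarrow> 'a item" where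
  "item B t b = (case b of Inl e \<Rightarrow> (0, [act B e], None)
     | Inr c \<Rightarrow> (t c, map (act B) (cell_top c), Some (cell_botword c)))"

text \<open>The weight of a \<open>None\<close> item is fixed to 0 so that such items contribute
  nothing to \<open>item_dist\<close>.\<close>

definition valid_item :: "'a item \<Rightarrow> bool" where
  "valid_item x \<longleftrightarrow> 0 \<le> fst x \<and> fst x \<le> 1 \<and>
     (case snd (snd x) of None \<Rightarrow> fst x = 0 \<and> length (fst (snd x)) = 1
      | Some v \<Rightarrow> (map label (fst (snd x)), v) \<in> R)"

definition cubing :: "'a list \<Rightarrow> 'a item list \<Rightarrow> bool" where
  "cubing w xs \<longleftrightarrow> npath w (concat (map (fst \<circ> snd) xs)) \<and> (\<forall>x\<in>set xs. valid_item x)"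

lemma map_act_path_of_word:
  assumes "npath w B"
  shows "map (act B) (path_of_word (map label B)) = B"
proof (rule nth_equalityI)
  fix i assume "i < length (map (act B) (path_of_word (map label B)))"
  then have i: "i < length B" by simp
  then have "B ! i \<in> set B" by simp
  then have "nf_edge (B ! i) = B ! i" using nf_normal(1) npath_good[OF assms] npath_normal[OF assms] by blast
  then show "map (act B) (path_of_word (map label B)) ! i = B ! i"
    using i by (simp add: act_def)
qed simp

text \<open>The dictionary from cubes to item lists. It transports points, coordinates and Euclidean
  distances, after which thin diagrams need not be mentioned any more.\<close>

lemma cube_items:
  assumes B: "npath w B" and b: "blocks (map label B) bs"
  defines "\<Phi> \<equiv> block_diagram (map label B) bs (block_cells bs)"
  shows "(mk_diagram w B, \<Phi>) \<in> cubes R w"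
    and "cube_point R (mk_diagram w B) \<Phi> t = point w (map (item B t) bs)"
    and "concat (map (fst \<circ> snd) (map (item B t) bs)) = B"
    and "t \<in> cube_coords \<Phi> \<Longrightarrow> cubing w (map (item B t) bs)"
    and "sqrt (\<Sum>c\<in>cells \<Phi>. (s c - t c)\<^sup>2) = item_dist (map (item B s) bs) (map (item B t) bs)"
proof -
  have [simp]: "botw (mk_diagram w B) = map label B" by (simp add: botw_def)
  have U: "mk_diagram w B \<in> vertices R w" using B by simp
  have r: "(cell_topword c, cell_botword c) \<in> R" if "c \<in> block_cells bs" for c
    using b that by (simp add: blocks_def)
  have gt: "good_path (map label B) (cell_top c)" if "c \<in> block_cells bs" for c
  proof
    fix e assume "e \<in> set (cell_top c)"
    then have "e \<in> set (block_path {} bs)" using that by (force simp: block_cells_def block_path_def)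
    then have "e \<in> set (path_of_word (map label B))" using b by (simp add: blocks_def)
    then show "good_edge R (map label B) e" by (auto simp: path_of_word_def)
  qed
  show "(mk_diagram w B, \<Phi>) \<in> cubes R w"
    using U block_diagram_is_diagram[OF b subset_refl] thin_block_diagram[OF b]
    by (simp add: cubes_def \<Phi>_def) (simp add: block_diagram_def)
  show "cube_point R (mk_diagram w B) \<Phi> t = point w (map (item B t) bs)"
  proof
    fix W
    have e: "(fst (block_weight t b), map (act B) (fst (snd (block_weight t b))),
        map (act B) (snd (snd (block_weight t b)))) = item_block (item B t b)" if "b \<in> set bs" for b
    proof (cases b)
      case (Inr c)
      then have c: "c \<in> block_cells bs" using that by (simp add: block_cells_def)
      have "map (act B) (cell_bot c) = att (map (act B) (cell_top c)) (cell_botword c)"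
        using map_act_att(2)[OF npath_good[OF B] gt[OF c], of "cell_botword c"] r[OF c]
        by (simp add: cell_topword_def)
      then show ?thesis using Inr by (simp add: item_def item_block_def)
    qed (simp add: item_def item_block_def)
    have "cube_point R (mk_diagram w B) \<Phi> t W =
      expect (map (block_weight t) bs) (\<lambda>B'. of_bool (mk_diagram w (map (act B) B') = W))"
      using cube_point_block_diagram[OF U, of bs t W] b by (simp add: \<Phi>_def)
    also have "\<dots> = point w (map (item B t) bs) W"
      unfolding point_def expect_map[of _ "\<lambda>B'. of_bool (mk_diagram w B' = W)" "act B"]
      using e by (simp add: comp_def cong: map_cong)
    finally show "cube_point R (mk_diagram w B) \<Phi> t W = point w (map (item B t) bs) W" .
  qed
  have "concat (map (fst \<circ> snd) (map (item B t) bs)) = map (act B) (block_path {} bs)"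
  proof (induction bs)
    case (Cons b bs)
    then show ?case by (cases b) (simp_all add: item_def)
  qed simp
  then show cc: "concat (map (fst \<circ> snd) (map (item B t) bs)) = B"
    using b map_act_path_of_word[OF B] by (simp add: blocks_def)
  show "cubing w (map (item B t) bs)" if "t \<in> cube_coords \<Phi>"
    unfolding cubing_def
  proof (intro conjI ballI)
    show "npath w (concat (map (fst \<circ> snd) (map (item B t) bs)))" using cc B by simp
    fix x assume "x \<in> set (map (item B t) bs)"
    then obtain b' where b': "b' \<in> set bs" "x = item B t b'" by auto
    show "valid_item x"
    proof (cases b')
      case (Inr c)
      then have c: "c \<in> block_cells bs" using b' by (simp add: block_cells_def)
      have "map label (map (act B) (cell_top c)) = cell_topword c"
        using label_act[OF npath_good[OF B]] gt[OF c] by (simp add: cell_topword_def)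
      then have "(map label (map (act B) (cell_top c)), cell_botword c) \<in> R" using r[OF c] by (simp del: map_map)
      moreover have "t c \<in> {0..1}" using that c by (auto simp: cube_coords_def \<Phi>_def block_diagram_def)
      ultimately show ?thesis using b' Inr by (simp add: valid_item_def item_def del: map_map)
    qed (simp add: b' valid_item_def item_def)
  qed
  have s: "distinct bs \<Longrightarrow> (\<Sum>c\<in>block_cells bs. (s c - t c)\<^sup>2) =
    (\<Sum>i<length bs. (fst (item B s (bs ! i)) - fst (item B t (bs ! i)))\<^sup>2)" for bs
  proof (induction bs)
    case (Cons b bs)
    show ?case
    proof (cases b)
      case (Inr c)
      then have "c \<notin> block_cells bs" using Cons.prems by (auto simp: block_cells_def)
      then show ?thesis using Cons Inr by (simp add: sum.lessThan_Suc_shift item_def del: sum.lessThan_Suc)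
    qed (use Cons in \<open>simp add: sum.lessThan_Suc_shift item_def del: sum.lessThan_Suc\<close>)
  qed simp
  show "sqrt (\<Sum>c\<in>cells \<Phi>. (s c - t c)\<^sup>2) = item_dist (map (item B s) bs) (map (item B t) bs)"
    using s[OF blocks_distinct[OF b]] by (simp add: item_dist_def \<Phi>_def block_diagram_def)
qed

lemma cubes_blocks:
  assumes "(U, \<Phi>) \<in> cubes R w"
  obtains B bs where "npath w B" "U = mk_diagram w B" "blocks (map label B) bs"
    "\<Phi> = block_diagram (map label B) bs (block_cells bs)"
proof -
  have U: "U = mk_diagram w (bot_path U)" "npath w (bot_path U)"
    using assms iffD1[OF vertices_iff, of U w] by (simp_all add: cubes_def)
  have "botw U = map label (bot_path U)" by (simp add: botw_def)
  with assms thin_blocks[of \<Phi>] obtain bs where "blocks (map label (bot_path U)) bs"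
    "\<Phi> = block_diagram (map label (bot_path U)) bs (block_cells bs)" by (auto simp: cubes_def)
  then show thesis using that U by blast
qed

end

section \<open>From item lists back to cubes\<close>

definition tops :: "nat \<Rightarrow> 'a edge list \<Rightarrow> 'a edge list" where
  "tops i es = map (\<lambda>j. Top (i + j) (label (es ! j))) [0..<length es]"

definition layout1 :: "nat \<Rightarrow> 'a edge list \<times> 'a list option \<Rightarrow> 'a block" where
  "layout1 i s = (case snd s of None \<Rightarrow> Inl (Top i (label (hd (fst s))))
     | Some v \<Rightarrow> Inr (Cell (tops i (fst s)) v))"

primrec layout :: "nat \<Rightarrow> ('a edge list \<times> 'a list option) list \<Rightarrow> 'a block list" where
  "layout i [] = []"
| "layout i (s # ss) = layout1 i s # layout (i + length (fst s)) ss"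

definition vertex_items :: "'a edge list \<Rightarrow> 'a item list" where
  "vertex_items B = map (\<lambda>e. (0, [e], None)) B"

lemma length_tops [simp]: "length (tops i es) = length es"
  by (simp add: tops_def)

lemma tops_append: "tops i (es @ fs) = tops i es @ tops (i + length es) fs"
  by (rule nth_equalityI) (auto simp: tops_def nth_append)

lemma tops_0: "tops 0 B = path_of_word (map label B)"
  by (rule nth_equalityI) (auto simp: tops_def)

lemma tops_single: "tops i [x] = [Top i (label x)]"
  by (simp add: tops_def)

lemma map_label_tops [simp]: "map label (tops i es) = map label es"
  by (rule nth_equalityI) (auto simp: tops_def)

lemma expect_zero_items:
  "\<forall>x\<in>set xs. fst x = 0 \<Longrightarrow> expect (map item_block xs) f = f (concat (map (fst \<circ> snd) xs))"
  by (induction xs arbitrary: f) (simp_all add: item_block_def)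

lemma concat_vertex_items [simp]: "concat (map (fst \<circ> snd) (vertex_items B)) = B"
  by (induction B) (simp_all add: vertex_items_def)

lemma expect_vertex_items [simp]: "expect (map item_block (vertex_items B)) f = f B"
proof -
  have "\<forall>x\<in>set (vertex_items B). fst x = 0" by (auto simp: vertex_items_def)
  from expect_zero_items[OF this] show ?thesis unfolding concat_vertex_items .
qed

lemma item_dist_commute: "length xs = length ys \<Longrightarrow> item_dist xs ys = item_dist ys xs"
  by (simp add: item_dist_def power2_commute)

lemma item_dist_nonneg: "item_dist xs ys \<ge> 0"
  by (simp add: item_dist_def sum_nonneg)

lemma finite_support_point: "finite {W. point w xs W \<noteq> 0}"
proof (rule finite_subset)
  show "{W. point w xs W \<noteq> 0} \<subseteq> mk_diagram w ` outcomes (map item_block xs)"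
  proof
    fix W assume W: "W \<in> {W. point w xs W \<noteq> 0}"
    show "W \<in> mk_diagram w ` outcomes (map item_block xs)"
    proof (rule ccontr)
      assume a: "W \<notin> mk_diagram w ` outcomes (map item_block xs)"
      have "point w xs W = expect (map item_block xs) (\<lambda>B. 0)"
        unfolding point_def by (rule expect_cong) (use a in auto)
      then show False using W by simp
    qed
  qed
qed simp

lemma sum_point:
  "(\<Sum>W | point w xs W \<noteq> 0. point w xs W * F W) = expect (map item_block xs) (\<lambda>B. F (mk_diagram w B))"
  unfolding point_def by (rule sum_expect)

context presentation
begin

lemma block_path_layout:
  assumes "\<forall>s\<in>set ss. snd s = None \<longrightarrow> length (fst s) = 1"
  shows "block_path {} (layout i ss) = tops i (concat (map fst ss))"
  using assms
proof (induction ss arbitrary: i)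
  case (Cons s ss)
  have "block_path1 {} (layout1 i s) = tops i (fst s)"
  proof (cases "snd s")
    case None
    then obtain x where "fst s = [x]" using Cons.prems by (cases "fst s") auto
    then show ?thesis using None by (simp add: layout1_def tops_single)
  qed (simp add: layout1_def)
  then show ?case using Cons by (simp add: tops_append)
qed (simp add: tops_def)

lemma act_tops:
  assumes "npath w (p @ es @ q)"
  shows "map (act (p @ es @ q)) (tops (length p) es) = es"
proof (rule nth_equalityI)
  fix i assume "i < length (map (act (p @ es @ q)) (tops (length p) es))"
  then have i: "i < length es" by simp
  then have "es ! i \<in> set (p @ es @ q)" by simp
  then have "nf_edge (es ! i) = es ! i"
    using nf_normal(1) npath_good[OF assms] npath_normal[OF assms] by blast
  then show "map (act (p @ es @ q)) (tops (length p) es) ! i = es ! i"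
    using i by (simp add: act_def tops_def nth_append)
qed simp

lemma items_layout:
  assumes "npath w (p @ concat (map fst ss))" "\<forall>s\<in>set ss. snd s = None \<longrightarrow> length (fst s) = 1"
  shows "map (\<lambda>b. snd (item (p @ concat (map fst ss)) t b)) (layout (length p) ss) = ss"
  using assms
proof (induction ss arbitrary: p)
  case (Cons s ss)
  let ?B = "p @ concat (map fst (s # ss))"
  have a: "map (act ?B) (tops (length p) (fst s)) = fst s"
    using act_tops[of w p "fst s" "concat (map fst ss)"] Cons.prems(1) by simp
  have "snd (item ?B t (layout1 (length p) s)) = s"
  proof (cases "snd s")
    case None
    then obtain x where x: "fst s = [x]" using Cons.prems(2) by (cases "fst s") auto
    then have "act ?B (Top (length p) (label x)) = x" using a by (simp add: tops_single)
    then have "snd (item ?B t (layout1 (length p) s)) = ([x], None)"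
      using None x by (simp add: layout1_def item_def)
    then show ?thesis using None x by (cases s) simp
  next
    case (Some v)
    then have "snd (item ?B t (layout1 (length p) s)) = (fst s, Some v)"
      using a by (simp add: layout1_def item_def)
    then show ?thesis using Some by (cases s) simp
  qed
  moreover have "map (\<lambda>b. snd (item ?B t b)) (layout (length p + length (fst s)) ss) = ss"
    using Cons.IH[of "p @ fst s"] Cons.prems by simp
  ultimately show ?case by simp
qed simp

text \<open>The dictionary is surjective: the segments are numbered along the bottom word of the
  vertex, and gluing below \<open>B\<close> gives them their names back. Coordinates do not
  influence the segments, hence the arbitrary \<open>t\<close>.\<close>

lemma cubing_blocks:
  assumes "cubing w xs"
  defines "B \<equiv> concat (map (fst \<circ> snd) xs)"
  obtains bs where "blocks (map label B) bs" "\<And>t. map (\<lambda>b. snd (item B t b)) bs = map snd xs"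
proof -
  let ?ss = "map snd xs"
  have B: "B = concat (map fst ?ss)" by (simp add: B_def)
  have n: "npath w B" using assms by (simp add: cubing_def)
  have one: "\<forall>s\<in>set ?ss. snd s = None \<longrightarrow> length (fst s) = 1"
    using assms(1) by (auto simp: cubing_def valid_item_def)
  have rel: "\<forall>s\<in>set ?ss. \<forall>v. snd s = Some v \<longrightarrow> (map label (fst s), v) \<in> R"
    using assms(1) by (fastforce simp: cubing_def valid_item_def)
  have "\<forall>s\<in>set ss. \<forall>v. snd s = Some v \<longrightarrow> (map label (fst s), v) \<in> R \<Longrightarrow>
    \<forall>c\<in>block_cells (layout i ss). (cell_topword c, cell_botword c) \<in> R" for i ss
  proof (induction ss arbitrary: i)
    case (Cons s ss)
    then show ?case by (cases "snd s") (auto simp: layout1_def cell_topword_def)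
  qed simp
  from this[OF rel] have "blocks (map label B) (layout 0 ?ss)"
    using block_path_layout[OF one] by (simp add: blocks_def B tops_0)
  moreover have "map (\<lambda>b. snd (item B t b)) (layout 0 ?ss) = ?ss" for t
    using items_layout[of w "[]" ?ss t] n one B by simp
  ultimately show thesis using that by blast
qed

lemma items_of_coords:
  assumes bs: "distinct bs" "\<And>t. map (\<lambda>b. snd (item B t b)) bs = map snd xs"
    and v: "\<forall>x\<in>set xs. valid_item x"
  obtains t where "map (item B t) bs = xs" "\<forall>c\<in>block_cells bs. t c \<in> {0..1}"
proof -
  \<comment> \<open>Coordinates belong to cells but items are listed by position; distinctness of
    the blocks makes the lookup unambiguous.\<close>
  let ?t = "\<lambda>c. fst (the (map_of (zip bs xs) (Inr c)))"
  have l: "length bs = length xs" using bs(2) by (metis length_map)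
  have t: "?t c = fst (xs ! i)" if "i < length bs" "bs ! i = Inr c" for i c
  proof -
    have "map_of (zip bs xs) (bs ! i) = Some (xs ! i)"
      by (rule map_of_zip_nth[OF l bs(1)]) (use that(1) l in simp)
    then show ?thesis unfolding that(2) by simp
  qed
  have "map (item B ?t) bs = xs"
  proof (rule nth_equalityI)
    fix i assume "i < length (map (item B ?t) bs)"
    then have i: "i < length bs" by simp
    have s: "snd (item B ?t (bs ! i)) = snd (xs ! i)"
      using arg_cong[OF bs(2), of "\<lambda>x. x ! i" ?t] i l by simp
    have "fst (item B ?t (bs ! i)) = fst (xs ! i)"
    proof (cases "bs ! i")
      case (Inl e)
      then have "snd (snd (item B ?t (bs ! i))) = None" by (simp add: item_def)
      then have "snd (snd (xs ! i)) = None" unfolding s .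
      moreover have "valid_item (xs ! i)" using v i l by simp
      ultimately have "fst (xs ! i) = 0" by (simp add: valid_item_def)
      then show ?thesis using Inl by (simp add: item_def)
    next
      case (Inr c)
      have "fst (item B ?t (bs ! i)) = ?t c" using Inr by (simp add: item_def)
      then show ?thesis using t[OF i Inr] by simp
    qed
    then show "map (item B ?t) bs ! i = xs ! i" using s i by (simp add: prod_eq_iff)
  qed (simp add: l)
  moreover have "?t c \<in> {0..1}" if "c \<in> block_cells bs" for c
  proof -
    obtain i where i: "i < length bs" "bs ! i = Inr c"
      using \<open>c \<in> block_cells bs\<close> by (auto simp: block_cells_def in_set_conv_nth)
    have "valid_item (xs ! i)" using v i l by simp
    then show ?thesis using t[OF i] by (simp add: valid_item_def)
  qed
  ultimately show thesis using that by blast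
qed

lemma cube_complex_eq: "cube_complex R w = {point w xs |xs. cubing w xs}"
proof (intro equalityI subsetI)
  fix y assume "y \<in> cube_complex R w"
  then obtain U \<Phi> t where y: "y = cube_point R U \<Phi> t" "(U, \<Phi>) \<in> cubes R w" "t \<in> cube_coords \<Phi>"
    by (auto simp: cube_complex_def)
  obtain B bs where b: "npath w B" "U = mk_diagram w B" "blocks (map label B) bs"
    "\<Phi> = block_diagram (map label B) bs (block_cells bs)" using cubes_blocks[OF y(2)] .
  show "y \<in> {point w xs |xs. cubing w xs}"
    using cube_items(2,4)[OF b(1,3)] y b by blast
next
  fix y assume "y \<in> {point w xs |xs. cubing w xs}"
  then obtain xs where xs: "y = point w xs" "cubing w xs" by blast
  let ?B = "concat (map (fst \<circ> snd) xs)"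
  have n: "npath w ?B" and v: "\<forall>x\<in>set xs. valid_item x" using xs(2) by (auto simp: cubing_def)
  obtain bs where b: "blocks (map label ?B) bs" "\<And>t. map (\<lambda>b. snd (item ?B t b)) bs = map snd xs"
    using cubing_blocks[OF xs(2)] by blast
  obtain t where t: "map (item ?B t) bs = xs" "\<forall>c\<in>block_cells bs. t c \<in> {0..1}"
    using items_of_coords[OF blocks_distinct[OF b(1)] b(2) v] .
  let ?P = "block_diagram (map label ?B) bs (block_cells bs)"
  have "t \<in> cube_coords ?P" using t(2) by (auto simp: cube_coords_def block_diagram_def)
  moreover have "cube_point R (mk_diagram w ?B) ?P t = y"
    using cube_items(2)[OF n b(1), of t] unfolding t(1) xs(1) .
  ultimately show "y \<in> cube_complex R w"
    using cube_items(1)[OF n b(1)] unfolding cube_complex_def by blast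
qed

section \<open>The length metric in terms of item lists\<close>

inductive item_string :: "'a list \<Rightarrow> ('a diagram \<Rightarrow> real) \<Rightarrow> ('a diagram \<Rightarrow> real) \<Rightarrow> real \<Rightarrow> bool" for w where
  refl: "cubing w xs \<Longrightarrow> item_string w (point w xs) (point w xs) 0"
| step: "item_string w y (point w xs) l \<Longrightarrow> cubing w xs \<Longrightarrow> cubing w ys \<Longrightarrow>
     map snd xs = map snd ys \<Longrightarrow> item_string w y (point w ys) (l + item_dist xs ys)"

lemma cube_string_iff: "cube_string R w y z l \<longleftrightarrow> item_string w y z l"
proof
  show "cube_string R w y z l \<Longrightarrow> item_string w y z l"
  proof (induction rule: cube_string.induct)
    case (cube_string_refl y)
    then show ?case using item_string.refl by (auto simp: cube_complex_eq)
  next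
    case (cube_string_step y U \<Phi> s l t)
    obtain B bs where b: "npath w B" "U = mk_diagram w B" "blocks (map label B) bs"
      "\<Phi> = block_diagram (map label B) bs (block_cells bs)" using cubes_blocks[OF cube_string_step.hyps(2)] .
    note c = cube_items[OF b(1,3), folded b(2,4)]
    have "map snd (map (item B s) bs) = map snd (map (item B t) bs)"
      by (auto simp: item_def split: sum.splits)
    then show ?case
      using item_string.step[of w y "map (item B s) bs" l "map (item B t) bs"] cube_string_step c(2)
        c(4)[OF cube_string_step.hyps(3)] c(4)[OF cube_string_step.hyps(4)] c(5)[of s t] by simp
  qed
  show "item_string w y z l \<Longrightarrow> cube_string R w y z l"
  proof (induction rule: item_string.induct)
    case (refl xs)
    then show ?case by (intro cube_string.cube_string_refl) (auto simp: cube_complex_eq)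
  next
    case (step y xs l ys)
    let ?B = "concat (map (fst \<circ> snd) xs)"
    have n: "npath w ?B" and v: "\<forall>x\<in>set xs. valid_item x" "\<forall>x\<in>set ys. valid_item x"
      using step.hyps by (auto simp: cubing_def)
    obtain bs where b: "blocks (map label ?B) bs" "\<And>t. map (\<lambda>b. snd (item ?B t b)) bs = map snd xs"
      using cubing_blocks[OF step.hyps(2)] by blast
    obtain s where s: "map (item ?B s) bs = xs" "\<forall>c\<in>block_cells bs. s c \<in> {0..1}"
      using items_of_coords[OF blocks_distinct[OF b(1)] b(2) v(1)] .
    obtain t where t: "map (item ?B t) bs = ys" "\<forall>c\<in>block_cells bs. t c \<in> {0..1}"
      using items_of_coords[OF blocks_distinct[OF b(1)] b(2)[unfolded step.hyps(4)] v(2)] .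
    let ?P = "block_diagram (map label ?B) bs (block_cells bs)"
    have st: "s \<in> cube_coords ?P" "t \<in> cube_coords ?P"
      using s(2) t(2) by (auto simp: cube_coords_def block_diagram_def)
    note c = cube_items[OF n b(1)]
    have ps: "cube_point R (mk_diagram w ?B) ?P s = point w xs" using c(2)[of s] s(1) by simp
    have pt: "cube_point R (mk_diagram w ?B) ?P t = point w ys" using c(2)[of t] t(1) by simp
    have "cube_string R w y (cube_point R (mk_diagram w ?B) ?P s) l" using step.IH ps by simp
    from cube_string_step[OF this c(1) st] show ?case
      unfolding pt using c(5)[of s t] s(1) t(1) by simp
  qed
qed

lemma complex_dist_eq: "complex_dist R w y z = Inf {l. item_string w y z l}"
  by (simp add: complex_dist_def cube_string_iff)

lemma item_string_nonneg: "item_string w y z l \<Longrightarrow> l \<ge> 0"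
  by (induction rule: item_string.induct) (use item_dist_nonneg in \<open>auto intro: add_nonneg_nonneg\<close>)

lemma item_string_trans: "item_string w z u m \<Longrightarrow> item_string w y z l \<Longrightarrow> item_string w y u (l + m)"
proof (induction rule: item_string.induct)
  case (step z xs l' ys)
  then show ?case using item_string.step[of w y xs "l + l'" ys] by (simp add: add.assoc)
qed simp

lemma item_string_single:
  "cubing w xs \<Longrightarrow> cubing w ys \<Longrightarrow> map snd xs = map snd ys \<Longrightarrow>
     item_string w (point w xs) (point w ys) (item_dist xs ys)"
  using item_string.step[of w "point w xs" xs 0 ys] item_string.refl[of w xs] by simp

lemma item_string_sym: "item_string w y z l \<Longrightarrow> item_string w z y l"
proof (induction rule: item_string.induct)
  case (step y xs l ys)
  have "item_string w (point w ys) (point w xs) (item_dist ys xs)"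
    using item_string_single step.hyps by simp
  moreover have "length xs = length ys" using step.hyps(4) by (metis length_map)
  ultimately show ?case using item_string_trans[OF step.IH] item_dist_commute by (metis add.commute)
qed (rule item_string.refl)

lemma point_vertex_items: "point w (vertex_items B) W = of_bool (mk_diagram w B = W)"
  by (simp add: point_def)

lemma cubing_vertex_items [simp]: "cubing w (vertex_items B) \<longleftrightarrow> npath w B"
proof -
  have "\<forall>x\<in>set (vertex_items B). valid_item x" by (auto simp: vertex_items_def valid_item_def)
  then show ?thesis by (simp add: cubing_def)
qed

lemma item_string_to_vertex:
  assumes "cubing w xs"
  shows "\<exists>l. item_string w (point w xs) (point w (vertex_items (concat (map (fst \<circ> snd) xs)))) l"
proof -
  let ?ys = "map (\<lambda>x. (0::real, snd x)) xs"
  have c: "concat (map (fst \<circ> snd) ?ys) = concat (map (fst \<circ> snd) xs)" by (simp add: comp_def)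
  have "cubing w ?ys" using assms c by (auto simp: cubing_def valid_item_def split: option.splits)
  then have "item_string w (point w xs) (point w ?ys) (item_dist xs ?ys)"
    by (intro item_string_single[OF assms]) simp_all
  moreover have "point w ?ys = point w (vertex_items (concat (map (fst \<circ> snd) xs)))"
    by (rule ext) (simp add: point_vertex_items point_def expect_zero_items c del: map_map)
  ultimately show ?thesis by auto
qed

lemma item_string_attach:
  assumes "npath w (p @ es @ q)" "(map label es, v) \<in> R"
  shows "item_string w (point w (vertex_items (p @ es @ q))) (point w (vertex_items (p @ att es v @ q)))
    (item_dist (vertex_items p @ [(0, es, Some v)] @ vertex_items q)
       (vertex_items p @ [(1, es, Some v)] @ vertex_items q))"
proof -
  let ?x = "\<lambda>t::real. vertex_items p @ [(t, es, Some v)] @ vertex_items q"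
  have c: "cubing w (?x t)" if "t \<in> {0..1}" for t
    using that assms by (auto simp: cubing_def valid_item_def vertex_items_def comp_def)
  have "point w (?x 0) = point w (vertex_items (p @ es @ q))"
    "point w (?x 1) = point w (vertex_items (p @ att es v @ q))"
    by (auto simp: fun_eq_iff point_vertex_items point_def expect_append item_block_def)
  then show ?thesis using item_string_single[OF c[of 0] c[of 1]] by simp
qed

lemma item_string_from_base:
  "npath w B \<Longrightarrow> \<exists>l. item_string w (point w (vertex_items (path_of_word w))) (point w (vertex_items B)) l"
proof (induction rule: npath_induct)
  case word
  then show ?case using item_string.refl[of w "vertex_items (path_of_word w)"] npath_path_of_word by auto
next
  case (att p es q v)
  then show ?case using item_string_trans[OF item_string_attach[OF att.hyps]] by blast
qed

text \<open>Connectedness through the base vertex. A lower bound for all strings passes to the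
  distance only if there is some string, since otherwise the infimum is over the empty set.\<close>

lemma item_string_exists:
  assumes "cubing w xs" "cubing w ys"
  shows "\<exists>l. item_string w (point w xs) (point w ys) l"
proof -
  let ?b = "point w (vertex_items (path_of_word w))"
  have *: "\<exists>l. item_string w ?b (point w xs) l" if xs: "cubing w xs" for xs
  proof -
    let ?B = "concat (map (fst \<circ> snd) xs)"
    have n: "npath w ?B" using xs by (simp add: cubing_def)
    have "\<exists>l. item_string w ?b (point w (vertex_items ?B)) l" by (rule item_string_from_base[OF n])
    then show ?thesis using item_string_to_vertex[OF xs] item_string_trans item_string_sym by blast
  qed
  from *[OF assms(1)] *[OF assms(2)] show ?thesis using item_string_trans item_string_sym by blast
qed

end

section \<open>The action\<close>

definition act_items :: "('a edge \<Rightarrow> 'a edge) \<Rightarrow> 'a item list \<Rightarrow> 'a item list" where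
  "act_items h xs = map (\<lambda>x. (fst x, map h (fst (snd x)), snd (snd x))) xs"

lemma act_items_simps [simp]:
  "length (act_items h xs) = length xs"
  "act_items h (xs @ ys) = act_items h xs @ act_items h ys"
  "act_items h [] = []"
  "act_items h (x # xs) = (fst x, map h (fst (snd x)), snd (snd x)) # act_items h xs"
  by (simp_all add: act_items_def)

lemma concat_act_items: "concat (map (fst \<circ> snd) (act_items h xs)) = map h (concat (map (fst \<circ> snd) xs))"
  by (induction xs) simp_all

lemma item_dist_act_items: "length xs = length ys \<Longrightarrow> item_dist (act_items h xs) (act_items h ys) = item_dist xs ys"
  by (simp add: item_dist_def act_items_def)

lemma map_snd_act_items: "map snd xs = map snd ys \<Longrightarrow> map snd (act_items h xs) = map snd (act_items h ys)"
proof -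
  have "map snd (act_items h zs) = map (\<lambda>s. (map h (fst s), snd s)) (map snd zs)" for zs :: "'a item list"
    by (simp add: act_items_def)
  then show "map snd xs = map snd ys \<Longrightarrow> map snd (act_items h xs) = map snd (act_items h ys)" by (simp del: map_map)
qed

context presentation
begin

text \<open>The prefix \<open>p\<close> collects the segments already decided while the later ones
  are still untouched, so each decision is a move on a normal path.\<close>

lemma npath_outcomes:
  assumes "npath w (p @ concat (map (fst \<circ> snd) xs))" "\<forall>x\<in>set xs. valid_item x"
    "B \<in> outcomes (map item_block xs)"
  shows "npath w (p @ B)"
  using assms
proof (induction xs arbitrary: p B)
  case (Cons x xs)
  obtain t es vo where x: "x = (t, es, vo)" by (cases x)
  let ?T = "concat (map (fst \<circ> snd) xs)"
  have n: "npath w (p @ es @ ?T)" using Cons.prems(1) x by (simp add: comp_def)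
  let ?a = "case vo of None \<Rightarrow> es | Some v \<Rightarrow> att es v"
  have n': "npath w (p @ ?a @ ?T)"
  proof (cases vo)
    case (Some v)
    then have "(map label es, v) \<in> R" using Cons.prems(2) x by (simp add: valid_item_def)
    then show ?thesis using npath_att[OF n] Some by simp
  qed (use n in simp)
  have ib: "item_block x = (t, ?a, es)" by (simp add: x item_block_def split: option.split)
  from Cons.prems(3) obtain r where r: "r \<in> outcomes (map item_block xs)" "B = ?a @ r \<or> B = es @ r"
    by (auto simp: ib)
  show ?case using r(2)
  proof
    assume "B = ?a @ r"
    then show ?thesis using Cons.IH[of "p @ ?a" r] n' Cons.prems(2) r(1) by (simp add: comp_def)
  next
    assume "B = es @ r"
    then show ?thesis using Cons.IH[of "p @ es" r] n Cons.prems(2) r(1) by (simp add: comp_def)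
  qed
qed simp

lemma cubing_outcomes: "cubing w xs \<Longrightarrow> B \<in> outcomes (map item_block xs) \<Longrightarrow> npath w B"
  using npath_outcomes[of w "[]" xs B] by (simp add: cubing_def)

lemma npath_map_act:
  assumes "npath w G" "npath (map label G) B"
  shows "npath w (map (act G) B)"
  using npath_act[of "mk_diagram w G" "mk_diagram (map label G) B"] assms
  by (simp add: npath_def botw_def)

context
  fixes w G
  assumes G: "npath w G" and label_G: "map label G = w"
begin

lemma act_cubing:
  assumes "cubing w xs"
  shows "cubing w (act_items (act G) xs)"
proof -
  let ?B = "concat (map (fst \<circ> snd) xs)"
  have n: "npath w ?B" and v: "\<forall>x\<in>set xs. valid_item x" using assms by (auto simp: cubing_def)
  have "valid_item (fst x, map (act G) (fst (snd x)), snd (snd x))" if x: "x \<in> set xs" for x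
  proof -
    have "\<forall>e\<in>set (fst (snd x)). good_edge R w e" using npath_good[OF n] x by fastforce
    then have l: "map label (map (act G) (fst (snd x))) = map label (fst (snd x))"
      using label_act[OF npath_good[OF G]] label_G by simp
    show ?thesis using bspec[OF v x] l by (simp add: valid_item_def del: map_map split: option.splits)
  qed
  then have "\<forall>x\<in>set (act_items (act G) xs). valid_item x" by (auto simp: act_items_def)
  then show ?thesis using npath_map_act[OF G] n label_G by (simp add: cubing_def concat_act_items)
qed

lemma item_block_act:
  assumes "cubing w xs" "x \<in> set xs"
  shows "item_block (fst x, map (act G) (fst (snd x)), snd (snd x)) =
    (fst (item_block x), map (act G) (fst (snd (item_block x))), map (act G) (snd (snd (item_block x))))"
proof -
  have n: "npath w (concat (map (fst \<circ> snd) xs))" and v: "valid_item x"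
    using assms by (auto simp: cubing_def)
  have g: "\<forall>e\<in>set (fst (snd x)). good_edge R w e" using npath_good[OF n] assms(2) by fastforce
  show ?thesis
  proof (cases "snd (snd x)")
    case (Some v')
    then have "(map label (fst (snd x)), v') \<in> R" using v by (simp add: valid_item_def)
    then show ?thesis
      using Some map_act_att(1)[OF npath_good[OF G], of "fst (snd x)" v'] g label_G
      by (simp add: item_block_def)
  qed (simp add: item_block_def)
qed

lemma expect_act_items:
  assumes "cubing w xs"
  shows "expect (map item_block (act_items (act G) xs)) f = expect (map item_block xs) (\<lambda>B. f (map (act G) B))"
proof -
  have "map item_block (act_items (act G) xs) =
    map (\<lambda>x. (fst x, map (act G) (fst (snd x)), map (act G) (snd (snd x)))) (map item_block xs)"
    using item_block_act[OF assms] by (simp add: act_items_def)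
  then show ?thesis unfolding expect_map by simp
qed

lemma prod_vertex: "npath w B \<Longrightarrow> diagram_prod (mk_diagram w G) (mk_diagram w B) = mk_diagram w (map (act G) B)"
  using diagram_prod_eq[of "mk_diagram w G" "mk_diagram w B"] G label_G by (simp add: npath_def botw_def)

lemma diagram_act_point:
  assumes "cubing w xs"
  shows "diagram_act (mk_diagram w G) (point w xs) = point w (act_items (act G) xs)"
proof
  fix W
  let ?y = "point w xs"
  let ?F = "\<lambda>U. of_bool (diagram_prod (mk_diagram w G) U = W)"
  have "diagram_act (mk_diagram w G) ?y W = (\<Sum>U | ?y U \<noteq> 0. ?y U * ?F U)"
    unfolding diagram_act_def
    by (rule sum.mono_neutral_cong_left) (use finite_support_point in auto)
  also have "\<dots> = expect (map item_block xs) (\<lambda>B. ?F (mk_diagram w B))" by (rule sum_point)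
  also have "\<dots> = expect (map item_block xs) (\<lambda>B. of_bool (mk_diagram w (map (act G) B) = W))"
    by (rule expect_cong) (use prod_vertex cubing_outcomes[OF assms] in simp)
  also have "\<dots> = point w (act_items (act G) xs) W"
    by (simp only: point_def expect_act_items[OF assms])
  finally show "diagram_act (mk_diagram w G) ?y W = point w (act_items (act G) xs) W" .
qed

lemma item_string_act:
  "item_string w y z l \<Longrightarrow> item_string w (diagram_act (mk_diagram w G) y) (diagram_act (mk_diagram w G) z) l"
proof (induction rule: item_string.induct)
  case (refl xs)
  show ?case unfolding diagram_act_point[OF refl] by (rule item_string.refl[OF act_cubing[OF refl]])
next
  case (step y xs l ys)
  have "length xs = length ys" using step.hyps(4) by (metis length_map)
  then have "item_dist (act_items (act G) xs) (act_items (act G) ys) = item_dist xs ys"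
    by (rule item_dist_act_items)
  then show ?case
    using item_string.step[OF step.IH[unfolded diagram_act_point[OF step.hyps(2)]]
        act_cubing[OF step.hyps(2)] act_cubing[OF step.hyps(3)] map_snd_act_items[OF step.hyps(4)]]
      diagram_act_point[OF step.hyps(3)] by simp
qed

end

lemma act_items_inverse:
  assumes "npath w H" "map label H = w" "npath w G" "map label G = w"
    and i: "map (act H) G = path_of_word w" and xs: "cubing w xs"
  shows "act_items (act H) (act_items (act G) xs) = xs"
proof -
  have n: "npath w (concat (map (fst \<circ> snd) xs))" using xs by (simp add: cubing_def)
  have *: "act H (act G e) = e" if "x \<in> set xs" "e \<in> set (fst (snd x))" for x e
  proof -
    have "e \<in> set (concat (map (fst \<circ> snd) xs))" using that by force
    then have e: "good_edge R w e" "normal_edge e" using npath_good[OF n] npath_normal[OF n] by blast+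
    have "act H (act G e) = act (map (act H) G) e"
      using act_act[OF npath_good[OF assms(1)], of G e] npath_good[OF assms(3)] e(1) assms(2,4) by simp
    then show ?thesis using act_path_of_word[OF e] i by simp
  qed
  have "map (act H) (map (act G) (fst (snd x))) = fst (snd x)" if "x \<in> set xs" for x
    unfolding map_map by (rule map_idI) (simp add: *[OF that])
  then have "map (\<lambda>x. (fst x, map (act H) (map (act G) (fst (snd x))), snd (snd x))) xs = xs"
    by (intro map_idI) (simp del: map_map)
  then show ?thesis by (simp add: act_items_def comp_def)
qed

text \<open>The inverse \<open>H\<close> carries strings back with the same length, so even the sets
  of lengths of strings agree, not only their infima.\<close>

lemma diagram_act_isometry:
  assumes G: "npath w G" "map label G = w" and H: "npath w H" "map label H = w"
    and i: "map (act H) G = path_of_word w" "map (act G) H = path_of_word w"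
  shows "isometry_of (cube_complex R w) (complex_dist R w) (diagram_act (mk_diagram w G))"
  unfolding isometry_of_def
proof (intro conjI ballI)
  let ?g = "diagram_act (mk_diagram w G)" and ?h = "diagram_act (mk_diagram w H)"
  let ?K = "cube_complex R w"
  have g: "?g y \<in> ?K" "?h (?g y) = y" if "y \<in> ?K" for y
  proof -
    obtain xs where xs: "y = point w xs" "cubing w xs" using \<open>y \<in> ?K\<close> cube_complex_eq by blast
    show "?g y \<in> ?K" using diagram_act_point[OF G xs(2)] act_cubing[OF G xs(2)] xs(1) cube_complex_eq by blast
    show "?h (?g y) = y"
      using diagram_act_point[OF G xs(2)] diagram_act_point[OF H act_cubing[OF G xs(2)]]
        act_items_inverse[OF H G i(1) xs(2)] xs(1) by simp
  qed
  have h: "?h y \<in> ?K" "?g (?h y) = y" if "y \<in> ?K" for y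
  proof -
    obtain xs where xs: "y = point w xs" "cubing w xs" using \<open>y \<in> ?K\<close> cube_complex_eq by blast
    show "?h y \<in> ?K" using diagram_act_point[OF H xs(2)] act_cubing[OF H xs(2)] xs(1) cube_complex_eq by blast
    show "?g (?h y) = y"
      using diagram_act_point[OF H xs(2)] diagram_act_point[OF G act_cubing[OF H xs(2)]]
        act_items_inverse[OF G H i(2) xs(2)] xs(1) by simp
  qed
  show "bij_betw ?g ?K ?K"
    by (rule bij_betw_byWitness[of _ ?h]) (use g h in auto)
  fix y z assume y: "y \<in> ?K" and z: "z \<in> ?K"
  have "item_string w (?g y) (?g z) l \<longleftrightarrow> item_string w y z l" for l
  proof
    assume "item_string w (?g y) (?g z) l"
    from item_string_act[OF H this] show "item_string w y z l" using g y z by simp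
  qed (rule item_string_act[OF G])
  then show "complex_dist R w (?g y) (?g z) = complex_dist R w y z" by (simp add: complex_dist_eq)
qed

end

section \<open>Lipschitz functions on the complex\<close>

text \<open>The total change of the number of edges made by cells at the right end, recorded in the
  name of the last edge. Only the value at the last edge of a path has this meaning; for
  \<open>left_height\<close> it is the first edge.\<close>

primrec right_height :: "'a edge \<Rightarrow> real" and right_height_cell :: "'a cell \<Rightarrow> real" where
  "right_height (Top i a) = 0"
| "right_height (Bot c j) = right_height_cell c"
| "right_height_cell (Cell es v) = last (map right_height es) + real (length v) - real (length es)"

primrec left_height :: "'a edge \<Rightarrow> real" and left_height_cell :: "'a cell \<Rightarrow> real" where
  "left_height (Top i a) = 0"
| "left_height (Bot c j) = left_height_cell c"
| "left_height_cell (Cell es v) = hd (map left_height es) + real (length v) - real (length es)"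

text \<open>A necessary condition for being the first edge of a path, used to show that certain
  edges never come first; hence all \<open>Top\<close> edges may pass. \<open>rightmost\<close> is
  the mirror image.\<close>

primrec leftmost :: "'a edge \<Rightarrow> bool" and leftmost_cell :: "'a cell \<Rightarrow> bool" where
  "leftmost (Top i a) = True"
| "leftmost (Bot c j) = (j = 0 \<and> leftmost_cell c)"
| "leftmost_cell (Cell es v) = hd (map leftmost es)"

primrec rightmost :: "'a edge \<Rightarrow> bool" and rightmost_cell :: "'a cell \<Rightarrow> bool" where
  "rightmost (Top i a) = True"
| "rightmost (Bot c j) = (Suc j = length (cell_botword c) \<and> rightmost_cell c)"
| "rightmost_cell (Cell es v) = last (map rightmost es)"

definition has_cell :: "'a cell \<Rightarrow> 'a edge list \<Rightarrow> real" where
  "has_cell c B = of_bool (c \<in> \<Union>(edge_cells ` set B))"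

definition cell_change :: "'a cell \<Rightarrow> 'a edge list \<Rightarrow> 'a list \<Rightarrow> real" where
  "cell_change c es v = (if Cell es v = c then 1 else if inverse_cells c (Cell es v) then - 1 else 0)"

text \<open>The partial derivatives of a mean value on a cube. The two flags passed to \<alpha> say
  whether the segment is first or last in the path, the only places where the heights
  change.\<close>

primrec coefs :: "(bool \<Rightarrow> bool \<Rightarrow> 'a edge list \<Rightarrow> 'a list \<Rightarrow> real) \<Rightarrow> bool \<Rightarrow> 'a item list \<Rightarrow> real list" where
  "coefs \<alpha> b [] = []"
| "coefs \<alpha> b (x # xs) =
     (case snd (snd x) of None \<Rightarrow> 0 | Some v \<Rightarrow> \<alpha> b (xs = []) (fst (snd x)) v) # coefs \<alpha> False xs"

lemma length_coefs [simp]: "length (coefs \<alpha> b xs) = length xs"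
  by (induction xs arbitrary: b) auto

lemma coefs_cong: "map snd xs = map snd ys \<Longrightarrow> coefs \<alpha> b xs = coefs \<alpha> b ys"
proof (induction xs arbitrary: ys b)
  case (Cons x xs)
  then obtain y ys' where ys: "ys = y # ys'" by (cases ys) auto
  then have "coefs \<alpha> False xs = coefs \<alpha> False ys'" using Cons.prems by (intro Cons.IH) simp
  moreover have "snd x = snd y" "xs = [] \<longleftrightarrow> ys' = []" using Cons.prems ys by auto
  ultimately show ?case by (simp add: ys split: option.split)
qed simp

text \<open>Extends a function on vertices to the complex, affinely in each single coordinate of a
  cube.\<close>

definition mean :: "('a edge list \<Rightarrow> real) \<Rightarrow> ('a diagram \<Rightarrow> real) \<Rightarrow> real" where
  "mean f y = (\<Sum>W | y W \<noteq> 0. y W * f (bot_path W))"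

lemma mean_point: "mean f (point w xs) = expect (map item_block xs) f"
  unfolding mean_def by (simp add: sum_point)

context presentation
begin

lemma npath_att_cases:
  assumes "npath w (p @ es @ q)" "(map label es, v) \<in> R"
  obtains (undo) c1 where "inverse_cells c1 (Cell es v)" "es = cell_bot c1" "v = cell_topword c1"
      "att es v = cell_top c1" "cell_top c1 \<noteq> []" "cell_botword c1 \<noteq> []"
    | (new) "\<nexists>c1. inverse_cells c1 (Cell es v)" "att es v = cell_bot (Cell es v)"
proof -
  have ne: "es \<noteq> []" "v \<noteq> []" using rel_nonempty assms(2) by fastforce+
  show thesis using att_cases[OF ne(1), of v]
  proof (elim disjE exE conjE)
    fix c1 assume c1: "inverse_cells c1 (Cell es v)" "cell_botword c1 \<noteq> []" "att es v = cell_top c1"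
    then have "v = cell_topword c1" "es = cell_bot c1" by (simp_all add: inverse_cells_def)
    moreover from this have "cell_top c1 \<noteq> []" using ne(2) by (auto simp: cell_topword_def)
    ultimately show thesis using undo c1 by blast
  qed (rule new)
qed

text \<open>If the cell undoes \<open>c1\<close>, the height of the last edge of \<open>es\<close>
  already contains the contribution of \<open>c1\<close>, which is opposite to that of the attached
  cell.\<close>

lemma right_height_att:
  assumes "npath w (p @ es @ q)" "(map label es, v) \<in> R"
  shows "right_height (last (p @ att es v @ q)) =
    right_height (last (p @ es @ q)) + (if q = [] then real (length v) - real (length es) else 0)"
proof (cases "q = []")
  case True
  have ne: "es \<noteq> []" "v \<noteq> []" using rel_nonempty assms(2) by fastforce+
  then have "att es v \<noteq> []" by (metis length_att length_0_conv)
  then have l: "last (p @ att es v @ q) = last (att es v)" "last (p @ es @ q) = last es"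
    using True ne by simp_all
  have "right_height (last (att es v)) = right_height (last es) + real (length v) - real (length es)"
    using assms
  proof (cases rule: npath_att_cases)
    case (undo c1)
    then have "right_height (last es) = right_height_cell c1" by (simp add: cell_bot_def last_map)
    moreover have "right_height_cell c1 = right_height (last (cell_top c1)) + real (length es) - real (length v)"
      using undo by (cases c1) (simp add: last_map cell_topword_def)
    ultimately show ?thesis using undo(4) by simp
  next
    case new
    then show ?thesis using ne by (simp add: cell_bot_def last_map)
  qed
  then show ?thesis using True unfolding l by simp
qed simp

lemma left_height_att:
  assumes "npath w (p @ es @ q)" "(map label es, v) \<in> R"
  shows "left_height (hd (p @ att es v @ q)) =
    left_height (hd (p @ es @ q)) + (if p = [] then real (length v) - real (length es) else 0)"
proof (cases "p = []")
  case True
  have ne: "es \<noteq> []" "v \<noteq> []" using rel_nonempty assms(2) by fastforce+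
  then have "att es v \<noteq> []" by (metis length_att length_0_conv)
  then have l: "hd (p @ att es v @ q) = hd (att es v)" "hd (p @ es @ q) = hd es"
    using True ne by simp_all
  have "left_height (hd (att es v)) = left_height (hd es) + real (length v) - real (length es)"
    using assms
  proof (cases rule: npath_att_cases)
    case (undo c1)
    then have "left_height (hd es) = left_height_cell c1" by (simp add: cell_bot_def hd_map)
    moreover have "left_height_cell c1 = left_height (hd (cell_top c1)) + real (length es) - real (length v)"
      using undo by (cases c1) (simp add: hd_map cell_topword_def)
    ultimately show ?thesis using undo(4) by simp
  next
    case new
    then show ?thesis using ne by (simp add: cell_bot_def hd_map)
  qed
  then show ?thesis using True unfolding l by simp
qed simp

lemma leftmost_hd: "npath w B \<Longrightarrow> w \<noteq> [] \<Longrightarrow> B \<noteq> [] \<and> leftmost (hd B)"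
proof (induction rule: npath_induct)
  case word
  then show ?case by (simp add: path_of_word_def hd_map)
next
  case (att p es q v)
  have ne: "es \<noteq> []" "v \<noteq> []" using rel_nonempty att.hyps(2) by fastforce+
  then have a: "att es v \<noteq> []" by (metis length_att length_0_conv)
  show ?case
  proof (cases "p = []")
    case True
    then have h: "leftmost (hd es)" using att ne by simp
    from att.hyps have "leftmost (hd (att es v))"
    proof (cases rule: npath_att_cases)
      case (undo c1)
      then have "leftmost_cell c1" using h by (simp add: cell_bot_def hd_map)
      then show ?thesis using undo by (cases c1) (simp add: hd_map)
    next
      case new
      then show ?thesis using ne h by (simp add: cell_bot_def hd_map)
    qed
    then show ?thesis using True a by simp
  qed (use att a in simp)
qed

lemma rightmost_last: "npath w B \<Longrightarrow> w \<noteq> [] \<Longrightarrow> B \<noteq> [] \<and> rightmost (last B)"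
proof (induction rule: npath_induct)
  case word
  then show ?case by (simp add: path_of_word_def last_map)
next
  case (att p es q v)
  have ne: "es \<noteq> []" "v \<noteq> []" using rel_nonempty att.hyps(2) by fastforce+
  then have a: "att es v \<noteq> []" by (metis length_att length_0_conv)
  show ?case
  proof (cases "q = []")
    case True
    then have h: "rightmost (last es)" using att ne by simp
    from att.hyps have "rightmost (last (att es v))"
    proof (cases rule: npath_att_cases)
      case (undo c1)
      then have "rightmost_cell c1" using h by (simp add: cell_bot_def last_map)
      then show ?thesis using undo by (cases c1) (simp add: last_map)
    next
      case new
      then show ?thesis using ne h by (simp add: cell_bot_def last_map)
    qed
    then show ?thesis using True a by simp
  qed (use att a in simp)
qed

text \<open>The hypothesis on \<open>c\<close> ensures that attaching \<open>c\<close> never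
  cancels: the cell enters only as a new one and leaves only when it is undone. By
  \<open>unattach\<close>, undoing \<open>c1\<close> removes no other cell.\<close>

lemma has_cell_att:
  assumes "npath w (p @ es @ q)" "(map label es, v) \<in> R" and c: "\<nexists>c1. inverse_cells c1 c"
  shows "has_cell c (p @ att es v @ q) = has_cell c (p @ es @ q) + cell_change c es v"
proof -
  let ?C = "\<lambda>B. \<Union>(edge_cells ` set B)"
  have d: "is_diagram R (Diagram w (?C (p @ es @ q)) (p @ es @ q))"
    using assms(1) by (simp add: npath_def mk_diagram_def)
  have ne: "es \<noteq> []" using rel_nonempty assms(2) by fastforce
  from assms(1,2) show ?thesis
  proof (cases rule: npath_att_cases)
    case (undo c1)
    have "is_diagram R (Diagram w (?C (p @ es @ q) - {c1}) (p @ cell_top c1 @ q))"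
      using unattach[of w _ p c1 q] d undo by simp
    from cells_eq[OF this] have e: "?C (p @ att es v @ q) = ?C (p @ es @ q) - {c1}"
      using undo(4) by (simp del: set_append)
    have c1: "c1 \<in> ?C (p @ es @ q)"
    proof -
      have "Bot c1 0 \<in> set es" using undo by (simp add: set_cell_bot)
      moreover have "c1 \<in> edge_cells (Bot c1 0)" by (simp add: cell_cells_iff[of c1])
      ultimately show ?thesis by fastforce
    qed
    have "Cell es v \<noteq> c" using undo(1) c by blast
    moreover have "inverse_cells c (Cell es v) \<longleftrightarrow> c = c1"
      using undo cell_bot_eq_iff[of c1 c] by (auto simp: inverse_cells_def)
    ultimately show ?thesis using e c1 by (simp add: has_cell_def cell_change_def del: set_append)
  next
    case new
    have "is_diagram R (Diagram w (insert (Cell es v) (?C (p @ es @ q))) (p @ cell_bot (Cell es v) @ q))"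
      using is_diagram.is_diagram_attach[OF d assms(2)] .
    from cells_eq[OF this] have e: "?C (p @ att es v @ q) = insert (Cell es v) (?C (p @ es @ q))"
      using new(2) by (simp del: set_append)
    have "Cell es v \<notin> ?C (p @ es @ q)" using attach_fresh[OF d ne] .
    then show ?thesis using e new(1) by (auto simp add: has_cell_def cell_change_def simp del: set_append)
  qed
qed

section \<open>Mean values on cubes and their gradients\<close>

lemma item_nonempty: "valid_item x \<Longrightarrow> fst (snd x) \<noteq> []"
  using rel_nonempty by (fastforce simp: valid_item_def split: option.splits)

text \<open>A mean is a priori only affine in each coordinate separately. Here there are no mixed
  terms, because the increment of a move does not depend on how the other segments were decided:
  replacing nonempty segments by nonempty ones does not change which segment is first or
  last.\<close>

lemma expect_affine:
  assumes f: "\<And>p es q v. npath w (p @ es @ q) \<Longrightarrow> (map label es, v) \<in> R \<Longrightarrow>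
      f (p @ att es v @ q) = f (p @ es @ q) + \<alpha> (p = []) (q = []) es v"
    and "npath w (p @ concat (map (fst \<circ> snd) xs))" "\<forall>x\<in>set xs. valid_item x"
  shows "expect (map item_block xs) (\<lambda>B. f (p @ B)) =
    f (p @ concat (map (fst \<circ> snd) xs)) + (\<Sum>i<length xs. fst (xs ! i) * coefs \<alpha> (p = []) xs ! i)"
  using assms(2,3)
proof (induction xs arbitrary: p)
  case (Cons x xs)
  obtain t es vo where x: "x = (t, es, vo)" by (cases x)
  let ?T = "concat (map (fst \<circ> snd) xs)"
  let ?S = "\<Sum>i<length xs. fst (xs ! i) * coefs \<alpha> False xs ! i"
  have n: "npath w (p @ es @ ?T)" using Cons.prems(1) x by (simp add: comp_def)
  have vx: "valid_item x" and v: "\<forall>x\<in>set xs. valid_item x" using Cons.prems(2) by simp_all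
  have es: "es \<noteq> []" using item_nonempty[OF vx] x by simp
  \<comment> \<open>Segments are nonempty, so the last item is the one at the end of the path; this
    matches the flags of \<open>coefs\<close> with those of \<alpha>.\<close>
  have T: "?T = [] \<longleftrightarrow> xs = []" using v item_nonempty by (cases xs) auto
  have i0: "expect (map item_block xs) (\<lambda>B. f ((p @ es) @ B)) = f ((p @ es) @ ?T) + ?S"
    using Cons.IH[of "p @ es"] n v es by (simp add: comp_def)
  have ib: "item_block x = (t, case vo of None \<Rightarrow> es | Some v \<Rightarrow> att es v, es)"
    by (simp add: x item_block_def split: option.split)
  have x': "fst x = t" "fst (snd x) = es" "snd (snd x) = vo" by (simp_all add: x)
  show ?case
  proof (cases vo)
    case None
    then have "t = 0" using vx x by (simp add: valid_item_def)
    then show ?thesis using i0 x' None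
      by (simp add: ib sum.lessThan_Suc_shift comp_def del: sum.lessThan_Suc)
  next
    case (Some u)
    have r: "(map label es, u) \<in> R" using vx x Some by (simp add: valid_item_def)
    have "u \<noteq> []" using rel_nonempty[OF r] by simp
    then have ne: "att es u \<noteq> []" by (metis length_att length_0_conv)
    have i1: "expect (map item_block xs) (\<lambda>B. f ((p @ att es u) @ B)) = f ((p @ att es u) @ ?T) + ?S"
      using Cons.IH[of "p @ att es u"] npath_att[OF n r] v ne by (simp add: comp_def)
    have "f (p @ att es u @ ?T) = f (p @ es @ ?T) + \<alpha> (p = []) (xs = []) es u" using f[OF n r] T by simp
    then have "t * (f (p @ att es u @ ?T) + ?S) + (1 - t) * (f (p @ es @ ?T) + ?S) =
        f (p @ es @ ?T) + t * \<alpha> (p = []) (xs = []) es u + ?S" by (simp add: algebra_simps)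
    then show ?thesis using i0 i1 x' Some
      by (simp add: ib sum.lessThan_Suc_shift comp_def del: sum.lessThan_Suc)
  qed
qed simp

lemma mean_lipschitz:
  assumes f: "\<And>p es q v. npath w (p @ es @ q) \<Longrightarrow> (map label es, v) \<in> R \<Longrightarrow>
      f (p @ att es v @ q) = f (p @ es @ q) + \<alpha> (p = []) (q = []) es v"
    and c: "\<And>xs. cubing w xs \<Longrightarrow> (\<Sum>i<length xs. (coefs \<alpha> True xs ! i)\<^sup>2) \<le> L\<^sup>2" and L: "L \<ge> 0"
  shows "item_string w y z l \<Longrightarrow> mean f z - mean f y \<le> L * l"
proof (induction rule: item_string.induct)
  case (step y xs l ys)
  have len: "length xs = length ys" using step.hyps(4) by (metis length_map)
  have t: "concat (map (fst \<circ> snd) xs) = concat (map (fst \<circ> snd) ys)"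
    by (simp only: map_map[symmetric] step.hyps(4))
  have m: "mean f (point w zs) = f (concat (map (fst \<circ> snd) zs)) + (\<Sum>i<length zs. fst (zs ! i) * coefs \<alpha> True zs ! i)"
    if "cubing w zs" for zs
    using expect_affine[of w f \<alpha> "[]" zs, OF f] that by (simp add: mean_point cubing_def)
  have "mean f (point w ys) - mean f (point w xs) =
      (\<Sum>i<length xs. (fst (ys ! i) - fst (xs ! i)) * coefs \<alpha> True xs ! i)"
    using m[OF step.hyps(2)] m[OF step.hyps(3)] t len coefs_cong[OF step.hyps(4), of \<alpha> True]
    by (simp add: sum_subtractf algebra_simps)
  \<comment> \<open>Absolute values bring the sum into the form of the Cauchy-Schwarz inequality for
    \<open>L2_set\<close>.\<close>
  also have "\<dots> \<le> (\<Sum>i<length xs. \<bar>coefs \<alpha> True xs ! i\<bar> * \<bar>fst (xs ! i) - fst (ys ! i)\<bar>)"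
  proof (rule sum_mono)
    have "(a - b) * c \<le> \<bar>c\<bar> * \<bar>b - a\<bar>" for a b c :: real
      using abs_ge_self[of "(a - b) * c"] by (simp add: abs_mult abs_minus_commute mult.commute)
    then show "(fst (ys ! i) - fst (xs ! i)) * coefs \<alpha> True xs ! i \<le>
      \<bar>coefs \<alpha> True xs ! i\<bar> * \<bar>fst (xs ! i) - fst (ys ! i)\<bar>" for i .
  qed
  also have "\<dots> \<le> L2_set (\<lambda>i. coefs \<alpha> True xs ! i) {..<length xs} *
      L2_set (\<lambda>i. fst (xs ! i) - fst (ys ! i)) {..<length xs}" by (rule L2_set_mult_ineq)
  also have "\<dots> = L2_set (\<lambda>i. coefs \<alpha> True xs ! i) {..<length xs} * item_dist xs ys"
    by (simp add: item_dist_def L2_set_def)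
  also have "\<dots> \<le> L * item_dist xs ys"
    unfolding L2_set_def
    by (rule mult_right_mono[OF real_le_lsqrt[OF L c[OF step.hyps(2)]] item_dist_nonneg])
  finally show ?case using step.IH by (simp add: algebra_simps)
qed simp

end

section \<open>An element of the group of the presentation x = xx\<close>

interpretation presentation thompson_rels
  by unfold_locales (auto simp: thompson_rels_def)

abbreviation (input) X :: letter where "X \<equiv> letter_x"

section \<open>Splitting and merging edges\<close>

definition lhalf :: "letter edge \<Rightarrow> letter edge" where "lhalf a = Bot (Cell [a] [X, X]) 0"
definition rhalf :: "letter edge \<Rightarrow> letter edge" where "rhalf a = Bot (Cell [a] [X, X]) 1"
definition merge :: "letter edge \<Rightarrow> letter edge \<Rightarrow> letter edge" where "merge a b = Bot (Cell [a, b] [X]) 0"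

lemma letter_eq [simp]: "(a :: letter) = b"
  by (cases a, cases b) simp

lemma edge_inject [simp]:
  "lhalf a = lhalf b \<longleftrightarrow> a = b" "rhalf a = rhalf b \<longleftrightarrow> a = b" "merge a b = merge c d \<longleftrightarrow> a = c \<and> b = d"
  by (simp_all add: lhalf_def rhalf_def merge_def)

lemma edge_distinct [simp]:
  "lhalf a \<noteq> rhalf b" "rhalf b \<noteq> lhalf a" "lhalf a \<noteq> merge b c"
  "merge b c \<noteq> lhalf a" "rhalf a \<noteq> merge b c" "merge b c \<noteq> rhalf a"
  "lhalf a \<noteq> Top i x" "Top i x \<noteq> lhalf a" "rhalf a \<noteq> Top i x" "Top i x \<noteq> rhalf a" "merge a b \<noteq> Top i x" "Top i x \<noteq> merge a b"
  by (simp_all add: lhalf_def rhalf_def merge_def)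

lemma word_eq_iff: "(u :: letter list) = v \<longleftrightarrow> length u = length v"
  by (auto simp: list_eq_iff_nth_eq)

lemma rel_iff: "(u, v) \<in> thompson_rels \<longleftrightarrow> length u = 1 \<and> length v = 2 \<or> length u = 2 \<and> length v = 1"
  by (auto simp: thompson_rels_def word_eq_iff)

text \<open>A single edge is a whole bottom path only if its cell has one bottom edge, that is, if
  the edge came from a merge. Otherwise the split is new.\<close>

lemma att_single:
  assumes a: "\<And>b c. a \<noteq> merge b c"
  shows "att [a] [X, X] = [lhalf a, rhalf a]"
  using att_cases[of "[a]" "[X, X]", OF list.distinct(2)]
proof (elim disjE exE conjE)
  fix c1 assume c1: "inverse_cells c1 (Cell [a] [X, X])"
  obtain fs u where c: "c1 = Cell fs u" by (cases c1)
  have "length u = 1" "length fs = 2"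
    using c1 c by (simp_all add: inverse_cells_def cell_topword_def word_eq_iff,
        metis length_cell_bot cell.sel(2) length_Cons list.size(3) One_nat_def)
  then have "u = [X]" "fs = [fs ! 0, fs ! 1]"
    by (simp add: word_eq_iff) (rule nth_equalityI, auto simp: less_Suc_eq numeral_2_eq_2 \<open>length fs = 2\<close>)
  then have "a = merge (fs ! 0) (fs ! 1)"
    using c1 c by (simp add: inverse_cells_def cell_bot_def merge_def)
  then show ?thesis using a by blast
qed (simp_all add: cell_bot_def lhalf_def rhalf_def)

lemma att_merge [simp]: "att [merge b c] [X, X] = [b, c]"
proof -
  have i: "inverse_cells (Cell [b, c] [X]) (Cell [merge b c] [X, X])"
    by (simp add: inverse_cells_def cell_bot_def merge_def cell_topword_def)
  then have "mate (Cell [merge b c] [X, X]) = Cell [b, c] [X]" by (simp add: mate_eq)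
  then show ?thesis using i by (simp add: att_def fold_edge_def)
qed

lemma att_pair:
  assumes a: "\<And>c. a = lhalf c \<Longrightarrow> b \<noteq> rhalf c"
  shows "att [a, b] [X] = [merge a b]"
  using att_cases[of "[a, b]" "[X]", OF list.distinct(2)]
proof (elim disjE exE conjE)
  fix c1 assume c1: "inverse_cells c1 (Cell [a, b] [X])"
  obtain fs u where c: "c1 = Cell fs u" by (cases c1)
  have "length fs = 1" "length u = 2"
    using c1 c by (simp_all add: inverse_cells_def cell_topword_def word_eq_iff,
        metis length_cell_bot cell.sel(2) length_Cons list.size(3) numeral_2_eq_2)
  then have "u = [X, X]" "fs = [fs ! 0]"
    by (simp add: word_eq_iff) (rule nth_equalityI, auto simp: \<open>length fs = 1\<close>)
  then have "a = lhalf (fs ! 0)" "b = rhalf (fs ! 0)"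
    using c1 c by (simp_all add: inverse_cells_def cell_bot_def lhalf_def rhalf_def upt_rec)
  then show ?thesis using a by blast
qed (simp_all add: cell_bot_def merge_def)

lemma att_siblings [simp]: "att [lhalf c, rhalf c] [X] = [c]"
proof -
  have i: "inverse_cells (Cell [c] [X, X]) (Cell [lhalf c, rhalf c] [X])"
    by (simp add: inverse_cells_def cell_bot_def lhalf_def rhalf_def cell_topword_def upt_rec)
  then have "mate (Cell [lhalf c, rhalf c] [X]) = Cell [c] [X, X]" by (simp add: mate_eq)
  then show ?thesis using i by (simp add: att_def fold_edge_def)
qed

lemma att_lhalf_rhalf [simp]:
  "att [lhalf a] [X, X] = [lhalf (lhalf a), rhalf (lhalf a)]"
  "att [rhalf a] [X, X] = [lhalf (rhalf a), rhalf (rhalf a)]"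
  "att [Top i x] [X, X] = [lhalf (Top i x), rhalf (Top i x)]"
  by (rule att_single, simp)+

lemma att_pair_simps [simp]:
  "att [merge a b, c] [X] = [merge (merge a b) c]" "att [rhalf a, c] [X] = [merge (rhalf a) c]"
  "att [c, lhalf a] [X] = [merge c (lhalf a)]" "att [c, merge a b] [X] = [merge c (merge a b)]"
  by (rule att_pair, simp)+

lemma npath_split: "npath w (p @ [a] @ q) \<Longrightarrow> npath w (p @ att [a] [X, X] @ q)"
  by (rule npath_att) (simp_all add: rel_iff)

lemma npath_merge: "npath w (p @ [a, b] @ q) \<Longrightarrow> npath w (p @ att [a, b] [X] @ q)"
  by (rule npath_att) (simp_all add: rel_iff)

section \<open>The element and its inverse\<close>

primrec spine :: "nat \<Rightarrow> letter edge" where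
  "spine 0 = Top 0 X"
| "spine (Suc k) = rhalf (spine k)"

text \<open>\<open>spine k\<close> is the last edge after \<open>k\<close> splits at the right end,
  \<open>leaf k\<close> the edge emitted by the next one, and \<open>leaf_cell k\<close> the further
  cell that splits this leaf on its way to the left.\<close>

definition leaf :: "nat \<Rightarrow> letter edge" where "leaf k = lhalf (spine k)"
definition leaf_left :: "nat \<Rightarrow> letter edge" where "leaf_left k = lhalf (leaf k)"
definition leaf_right :: "nat \<Rightarrow> letter edge" where "leaf_right k = rhalf (leaf k)"
definition leaf_cell :: "nat \<Rightarrow> letter cell" where "leaf_cell k = Cell [leaf k] [X, X]"

text \<open>The edge at the left end after \<open>k\<close> periods: the halves of leaves 1 to
  \<open>k\<close> have been merged into \<open>leaf 0\<close> one by one, two merges per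
  period.\<close>

primrec comb :: "nat \<Rightarrow> letter edge" where
  "comb 0 = leaf 0"
| "comb (Suc k) = merge (merge (comb k) (leaf_left (Suc k))) (leaf_right (Suc k))"

text \<open>The diagram with bottom path \<open>[par_bot]\<close> maps the path \<open>[comb k, spine (k + 1)]\<close> to
\<open>[comb (k + 1), spine (k + 2)]\<close>; the one with bottom path \<open>[par_inv_bot]\<close> is its inverse.\<close>

definition par_bot :: "letter edge" where "par_bot = merge (comb 1) (spine 2)"

definition par_inv_bot :: "letter edge" where
  "par_inv_bot = merge (lhalf (lhalf (leaf 0)))
     (merge (merge (rhalf (lhalf (leaf 0))) (rhalf (leaf 0))) (spine 1))"

lemma spine_neq_merge [simp]: "spine k \<noteq> merge b c"
  by (cases k) simp_all

lemma spine_neq_lhalf [simp]: "spine k \<noteq> lhalf b"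
  by (cases k) simp_all

lemma spine_inject [simp]: "spine i = spine j \<longleftrightarrow> i = j"
proof (induction i arbitrary: j)
  case 0
  then show ?case by (cases j) auto
next
  case (Suc i)
  then show ?case by (cases j) auto
qed

lemma leaf_inject [simp]: "leaf i = leaf j \<longleftrightarrow> i = j"
  by (simp add: leaf_def)

lemma leaf_neq_leaf_left [simp]: "leaf i \<noteq> leaf_left j" "leaf_left j \<noteq> leaf i"
  by (simp_all add: leaf_def leaf_left_def spine_neq_lhalf[symmetric])

lemma leaf_left_inject [simp]: "leaf_left i = leaf_left j \<longleftrightarrow> i = j"
  by (simp add: leaf_left_def)

lemma leaf_cell_inject [simp]: "leaf_cell i = leaf_cell j \<longleftrightarrow> i = j"
  by (simp add: leaf_cell_def)

lemma att_spine [simp]: "att [spine k] [X, X] = [leaf k, spine (Suc k)]"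
  by (simp add: att_single leaf_def)

lemma att_leaf [simp]: "att [leaf k] [X, X] = [leaf_left k, leaf_right k]"
  by (simp add: leaf_def leaf_left_def leaf_right_def)

lemma npath_vine: "npath [X] (map leaf [0..<n] @ [spine n])"
proof (induction n)
  case 0
  show ?case using npath_path_of_word[of "[X]"] by (simp add: path_of_word_def)
next
  case (Suc n)
  then show ?case using npath_split[of "[X]" "map leaf [0..<n]" "spine n" "[]"] by simp
qed

lemma npath_par_bot: "npath [X] [par_bot]"
proof -
  have "npath [X] ([leaf 0] @ [leaf 1] @ [spine 2])" using npath_vine[of 2] by (simp add: upt_rec)
  from npath_split[OF this] have "npath [X] ([] @ [leaf 0, leaf_left 1] @ [leaf_right 1, spine 2])" by simp
  from npath_merge[OF this] have "npath [X] ([] @ [merge (leaf 0) (leaf_left 1), leaf_right 1] @ [spine 2])"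
    by (simp add: leaf_left_def)
  from npath_merge[OF this] have "npath [X] ([] @ [comb 1, spine 2] @ [])" by simp
  from npath_merge[OF this] show ?thesis by (simp add: par_bot_def)
qed

lemma npath_par_inv_bot: "npath [X] [par_inv_bot]"
proof -
  have "npath [X] ([] @ [leaf 0] @ [spine 1])" using npath_vine[of 1] by simp
  from npath_split[OF this] have "npath [X] ([] @ [lhalf (leaf 0)] @ [rhalf (leaf 0), spine 1])"
    by (simp add: leaf_left_def leaf_right_def)
  from npath_split[OF this] have "npath [X] ([lhalf (lhalf (leaf 0))] @ [rhalf (lhalf (leaf 0)), rhalf (leaf 0)] @ [spine 1])"
    by simp
  from npath_merge[OF this]
  have "npath [X] ([lhalf (lhalf (leaf 0))] @ [merge (rhalf (lhalf (leaf 0))) (rhalf (leaf 0)), spine 1] @ [])" by simp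
  from npath_merge[OF this]
  have "npath [X] ([] @ [lhalf (lhalf (leaf 0)), merge (merge (rhalf (lhalf (leaf 0))) (rhalf (leaf 0))) (spine 1)] @ [])" by simp
  from npath_merge[OF this] show ?thesis by (simp add: par_inv_bot_def)
qed

text \<open>Acting on a name means performing its splits and merges on the image, so images can be
  computed with \<open>att\<close> alone.\<close>

lemma act_simps:
  "act [b] (Top 0 x) = nf_edge b" "act B (lhalf a) = att [act B a] [X, X] ! 0"
  "act B (rhalf a) = att [act B a] [X, X] ! 1" "act B (merge a c) = att [act B a, act B c] [X] ! 0"
  by (simp_all add: act_def lhalf_def rhalf_def merge_def fold_edge_nth)

abbreviation par_act :: "letter edge \<Rightarrow> letter edge" where "par_act \<equiv> act [par_bot]"
abbreviation par_inv_act :: "letter edge \<Rightarrow> letter edge" where "par_inv_act \<equiv> act [par_inv_bot]"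

lemma par_act_zz0: "par_act (spine 0) = par_bot"
  using nf_normal(1) npath_good[OF npath_par_bot] npath_normal[OF npath_par_bot] by (simp add: act_simps)

lemma par_inv_act_zz0: "par_inv_act (spine 0) = par_inv_bot"
  using nf_normal(1) npath_good[OF npath_par_inv_bot] npath_normal[OF npath_par_inv_bot] by (simp add: act_simps)

text \<open>The shift starts at index 1: \<open>spine 0\<close> is the whole top path and goes to
  \<open>par_bot\<close>. For the same reason \<open>leaf 0\<close> goes to \<open>comb 1\<close>
  and only later leaves are shifted.\<close>

lemma par_act_spine: "par_act (spine (Suc k)) = spine (Suc (Suc k))"
proof (induction k)
  case 0
  have "par_act (spine 1) = att [par_bot] [X, X] ! 1" using par_act_zz0 by (simp add: act_simps)
  then show ?case by (simp add: par_bot_def numeral_2_eq_2)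
next
  case (Suc k)
  have "par_act (spine (Suc (Suc k))) = att [par_act (spine (Suc k))] [X, X] ! 1" by (simp only: spine.simps act_simps)
  then show ?case unfolding Suc by simp
qed

lemma par_act_ee0: "par_act (leaf 0) = comb 1"
  using par_act_zz0 by (simp add: leaf_def act_simps par_bot_def)

lemma par_act_leaf: "par_act (leaf (Suc k)) = leaf (Suc (Suc k))"
proof -
  have "par_act (leaf (Suc k)) = att [par_act (spine (Suc k))] [X, X] ! 0" by (simp only: leaf_def act_simps)
  then show ?thesis unfolding par_act_spine att_spine by simp
qed

lemma par_act_leaf_left: "par_act (leaf_left (Suc k)) = leaf_left (Suc (Suc k))" and par_act_leaf_right: "par_act (leaf_right (Suc k)) = leaf_right (Suc (Suc k))"
  using par_act_leaf[of k] by (simp_all add: leaf_left_def[of "Suc k"] leaf_right_def[of "Suc k"] act_simps)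

lemma par_act_comb: "par_act (comb k) = comb (Suc k)"
proof (induction k)
  case 0
  then show ?case using par_act_ee0 by simp
next
  case (Suc k)
  have "par_act (comb (Suc k)) = att [att [par_act (comb k), par_act (leaf_left (Suc k))] [X] ! 0, par_act (leaf_right (Suc k))] [X] ! 0"
    by (simp only: comb.simps act_simps)
  also have "\<dots> = comb (Suc (Suc k))"
    unfolding Suc par_act_leaf_left par_act_leaf_right unfolding comb.simps(2) by simp
  finally show ?case .
qed

lemma par_act_par_inv_bot: "par_act par_inv_bot = spine 0"
proof -
  have l: "par_act (lhalf (leaf 0)) = merge (leaf 0) (leaf_left 1)" "par_act (rhalf (leaf 0)) = leaf_right 1"
    using par_act_ee0 by (simp_all add: act_simps)
  then have l2: "par_act (lhalf (lhalf (leaf 0))) = leaf 0" "par_act (rhalf (lhalf (leaf 0))) = leaf_left 1"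
    by (simp_all add: act_simps(2,3)[of _ "lhalf (leaf 0)"])
  have "par_act (merge (rhalf (lhalf (leaf 0))) (rhalf (leaf 0))) = att [leaf_left 1, leaf_right 1] [X] ! 0"
    using l l2 by (simp add: act_simps(4))
  then have "par_act (merge (rhalf (lhalf (leaf 0))) (rhalf (leaf 0))) = leaf 1" by (simp add: leaf_left_def leaf_right_def)
  then have "par_act (merge (merge (rhalf (lhalf (leaf 0))) (rhalf (leaf 0))) (spine 1)) = att [leaf 1, spine 2] [X] ! 0"
    using par_act_spine[of 0] by (simp add: act_simps(4) numeral_2_eq_2)
  then have "par_act (merge (merge (rhalf (lhalf (leaf 0))) (rhalf (leaf 0))) (spine 1)) = spine 1"
    by (simp add: leaf_def numeral_2_eq_2)
  then have "par_act par_inv_bot = att [leaf 0, spine 1] [X] ! 0" using l2 by (simp add: par_inv_bot_def act_simps(4))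
  then show ?thesis by (simp add: leaf_def)
qed

lemma par_inv_act_par_bot: "par_inv_act par_bot = spine 0"
proof -
  have z1: "par_inv_act (spine 1) = merge (merge (rhalf (lhalf (leaf 0))) (rhalf (leaf 0))) (spine 1)"
    using par_inv_act_zz0 by (simp add: act_simps(3) par_inv_bot_def)
  have e0: "par_inv_act (leaf 0) = lhalf (lhalf (leaf 0))" using par_inv_act_zz0 by (simp add: leaf_def act_simps(2) par_inv_bot_def)
  have z2: "par_inv_act (spine 2) = spine 1" using z1 by (simp add: act_simps(3) numeral_2_eq_2)
  have e1: "par_inv_act (leaf 1) = merge (rhalf (lhalf (leaf 0))) (rhalf (leaf 0))"
    unfolding leaf_def[of 1] act_simps(2) z1 by simp
  have p: "par_inv_act (leaf_left 1) = rhalf (lhalf (leaf 0))" "par_inv_act (leaf_right 1) = rhalf (leaf 0)"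
    unfolding leaf_left_def[of 1] leaf_right_def[of 1] act_simps(2,3) e1 by simp_all
  have "par_inv_act (merge (leaf 0) (leaf_left 1)) = lhalf (leaf 0)" using e0 p by (simp add: act_simps(4))
  then have "par_inv_act (comb 1) = leaf 0" using p by (simp add: act_simps(4))
  then have "par_inv_act par_bot = att [leaf 0, spine 1] [X] ! 0" using z2 by (simp add: par_bot_def act_simps(4))
  then show ?thesis by (simp add: leaf_def)
qed

abbreviation (input) par :: "letter diagram" where "par \<equiv> mk_diagram [X] [par_bot]"

lemma label_par_bot: "map label [par_bot] = [X]" and label_par_inv_bot: "map label [par_inv_bot] = [X]"
  by simp_all

lemma path_of_word_X: "path_of_word [X] = [spine 0]"
  by (simp add: path_of_word_def)

lemma isometry_par: "isometry_of (cube_complex thompson_rels [X]) (complex_dist thompson_rels [X]) (diagram_act par)"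
  by (rule diagram_act_isometry[OF npath_par_bot label_par_bot npath_par_inv_bot label_par_inv_bot])
    (simp_all only: list.map path_of_word_X par_act_par_inv_bot par_inv_act_par_bot)

lemma par_carrier: "par \<in> carrier (diagram_group thompson_rels [X])"
proof -
  have "is_diagram thompson_rels par" using npath_par_bot by (simp add: npath_def)
  moreover have "reduced par" using reduced_iff[OF calculation] npath_par_bot by (simp add: npath_def)
  ultimately show ?thesis by (simp add: diagram_group_def botw_def)
qed

lemma npath_par_act: "npath [X] B \<Longrightarrow> npath [X] (map par_act B)"
  by (rule npath_map_act[OF npath_par_bot, unfolded label_par_bot])

lemma map_par_act_att:
  assumes "npath [X] (p @ es @ q)" "(map label es, v) \<in> thompson_rels"
  shows "map par_act (att es v) = att (map par_act es) v"
proof (rule map_act_att(1)[OF npath_good[OF npath_par_bot]])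
  show "good_path (map label [par_bot]) es" using npath_good[OF assms(1)] unfolding label_par_bot by simp
qed (rule assms(2))

lemma rel_map: "(map label es, v) \<in> thompson_rels \<Longrightarrow> (map label (map h es), v) \<in> thompson_rels"
  by (simp add: rel_iff)

text \<open>The height is additive because its increments see only the relation used and whether the
  move is at the end, and the action preserves both.\<close>

lemma right_height_par_act:
  "npath [X] B \<Longrightarrow> right_height (last (map par_act B)) = right_height (last B) + right_height par_bot"
proof (induction rule: npath_induct)
  case word
  then show ?case by (simp add: path_of_word_X par_act_zz0[simplified])
next
  case (att p es q v)
  have n: "npath [X] (map par_act p @ map par_act es @ map par_act q)" using npath_par_act[OF att.hyps(1)] by simp
  show ?case
    using right_height_att[OF att.hyps] right_height_att[OF n rel_map[OF att.hyps(2)]] att.IH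
    by (simp add: map_par_act_att[OF att.hyps])
qed

lemma left_height_par_act:
  "npath [X] B \<Longrightarrow> left_height (hd (map par_act B)) = left_height (hd B) + left_height par_bot"
proof (induction rule: npath_induct)
  case word
  then show ?case by (simp add: path_of_word_X par_act_zz0[simplified])
next
  case (att p es q v)
  have n: "npath [X] (map par_act p @ map par_act es @ map par_act q)" using npath_par_act[OF att.hyps(1)] by simp
  show ?case
    using left_height_att[OF att.hyps] left_height_att[OF n rel_map[OF att.hyps(2)]] att.IH
    by (simp add: map_par_act_att[OF att.hyps])
qed

text \<open>The right end is split twice and finally merged. The left end, in the next lemma, is
  split once and merged three times: twice in \<open>comb 1\<close> and once at the bottom.\<close>

lemma right_height_par_bot: "right_height par_bot = 1"
  by (simp add: par_bot_def merge_def rhalf_def lhalf_def leaf_def leaf_left_def leaf_right_def numeral_2_eq_2)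

lemma left_height_par_bot: "left_height par_bot = - 2"
  by (simp add: par_bot_def merge_def rhalf_def lhalf_def leaf_def leaf_left_def leaf_right_def numeral_2_eq_2)

section \<open>The displacement\<close>

lemma inverse_leaf_cell: "inverse_cells (leaf_cell k) (Cell es v) \<longleftrightarrow> es = [leaf_left k, leaf_right k] \<and> v = [X]"
  by (auto simp: inverse_cells_def cell_bot_def leaf_cell_def leaf_left_def leaf_right_def lhalf_def rhalf_def cell_topword_def upt_rec)

text \<open>A leaf is a left half, one of the two bottom edges of its cell, so by itself it is not a
  whole bottom path.\<close>

lemma leaf_cell_not_inverse: "\<nexists>c1. inverse_cells c1 (leaf_cell k)"
proof
  assume "\<exists>c1. inverse_cells c1 (leaf_cell k)"
  then obtain c1 where i: "inverse_cells c1 (leaf_cell k)" by blast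
  then have c: "[leaf k] = cell_bot c1" by (simp add: inverse_cells_def leaf_cell_def)
  then have l: "length (cell_botword c1) = 1" by (metis length_cell_bot length_Cons list.size(3) One_nat_def)
  then have "leaf k = Bot c1 0" using c by (simp add: cell_bot_def)
  then show False using l by (auto simp: leaf_def lhalf_def)
qed

lemma cell_change_leaf_cell_nonzero:
  assumes "cell_change (leaf_cell k) es v \<noteq> 0"
  shows "es = [leaf k] \<and> v = [X, X] \<or> es = [leaf_left k, leaf_right k] \<and> v = [X]"
  using assms inverse_leaf_cell by (auto simp: cell_change_def leaf_cell_def split: if_splits)

lemma abs_cell_change: "\<bar>cell_change c es v\<bar> \<le> 1"
  by (simp add: cell_change_def)

text \<open>\<open>leaf 0\<close> does occur at the left end, hence the successor indices here and
  in all hyperplanes used below.\<close>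

lemma not_extreme: "\<not> leftmost (leaf (Suc k))" "\<not> rightmost (leaf k)"
    "\<not> leftmost (leaf_left (Suc k))" "\<not> rightmost (leaf_right k)"
  by (simp_all add: leaf_def leaf_left_def leaf_right_def lhalf_def rhalf_def)

text \<open>The coefficients 1 and -2 are the amounts by which the element changes the two
  heights.\<close>

definition weight :: "nat \<Rightarrow> real \<Rightarrow> letter edge list \<Rightarrow> real" where
  "weight k \<epsilon> B = right_height (last B) - 2 * left_height (hd B) + \<epsilon> * has_cell (leaf_cell k) B"

definition weight_change :: "nat \<Rightarrow> real \<Rightarrow> bool \<Rightarrow> bool \<Rightarrow> letter edge list \<Rightarrow> letter list \<Rightarrow> real" where
  "weight_change k \<epsilon> a b es v = (real (length v) - real (length es)) * (of_bool b - 2 * of_bool a) +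
     \<epsilon> * cell_change (leaf_cell k) es v"

lemma weight_att:
  assumes "npath [X] (p @ es @ q)" "(map label es, v) \<in> thompson_rels"
  shows "weight k \<epsilon> (p @ att es v @ q) = weight k \<epsilon> (p @ es @ q) + weight_change k \<epsilon> (p = []) (q = []) es v"
  unfolding weight_def weight_change_def right_height_att[OF assms] left_height_att[OF assms]
    has_cell_att[OF assms leaf_cell_not_inverse]
  by (simp add: algebra_simps)

text \<open>The first segment contributes at most 4 and the last one at most 1; a segment that is
  both contributes (1 - 2)^2. A cell that changes \<open>has_cell\<close> touches neither end, so
  its square \<epsilon>^2 is not mixed with these, and its top path contains one of the two named
  edges, which occur at most once in a path. The prefix \<open>p\<close> lets the induction run from
  left to right: the 4 is present only while the left end lies ahead.\<close>

lemma sum_coefs: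
  assumes "npath [X] (p @ concat (map (fst \<circ> snd) xs))" "\<forall>x\<in>set xs. valid_item x"
  defines "T \<equiv> set (concat (map (fst \<circ> snd) xs))"
  shows "(\<Sum>i<length xs. (coefs (weight_change (Suc k) \<epsilon>) (p = []) xs ! i)\<^sup>2) \<le>
    (if p = [] then 5 else 1) + \<epsilon>\<^sup>2 * (of_bool (leaf (Suc k) \<in> T) + of_bool (leaf_left (Suc k) \<in> T))"
  using assms(1,2) unfolding T_def
proof (induction xs arbitrary: p)
  case (Cons x xs)
  obtain t es vo where x: "fst (snd x) = es" "snd (snd x) = vo" by blast
  let ?T = "concat (map (fst \<circ> snd) xs)" and ?\<alpha> = "weight_change (Suc k) \<epsilon>"
  let ?e = "leaf (Suc k)" and ?p = "leaf_left (Suc k)"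
  let ?S = "\<Sum>i<length xs. (coefs ?\<alpha> False xs ! i)\<^sup>2"
  have n: "npath [X] (p @ es @ ?T)" using Cons.prems(1) x by (simp add: comp_def)
  have vx: "valid_item x" and v: "\<forall>x\<in>set xs. valid_item x" using Cons.prems(2) by simp_all
  have es: "es \<noteq> []" using item_nonempty[OF vx] x by simp
  have T: "?T = [] \<longleftrightarrow> xs = []" using v item_nonempty by (cases xs) auto
  have dist: "distinct (p @ es @ ?T)" using npath_distinct[OF n] .
  define E0 where "E0 = \<epsilon>\<^sup>2 * (of_bool (?e \<in> set ?T) + of_bool (?p \<in> set ?T))"
  define E1 where "E1 = \<epsilon>\<^sup>2 * (of_bool (?e \<in> set es \<union> set ?T) + of_bool (?p \<in> set es \<union> set ?T))"
  have ih: "?S \<le> (if xs = [] then 0 else 1) + E0"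
  proof (cases "xs = []")
    case False
    then show ?thesis using Cons.IH[of "p @ es"] n v es by (simp add: E0_def comp_def)
  qed (simp add: E0_def)
  have split: "(\<Sum>i<length (x # xs). (coefs ?\<alpha> (p = []) (x # xs) ! i)\<^sup>2) =
      (case vo of None \<Rightarrow> 0 | Some u \<Rightarrow> ?\<alpha> (p = []) (xs = []) es u)\<^sup>2 + ?S"
    by (simp add: sum.lessThan_Suc_shift x del: sum.lessThan_Suc split: option.split)
  have set_T: "set (concat (map (fst \<circ> snd) (x # xs))) = set es \<union> set ?T" using x by simp
  have mono: "E0 \<le> E1" unfolding E0_def E1_def by (intro mult_left_mono add_mono) auto
  have "(case vo of None \<Rightarrow> 0 | Some u \<Rightarrow> ?\<alpha> (p = []) (xs = []) es u)\<^sup>2 + ?S \<le>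
    (if p = [] then 5 else 1) + E1"
  proof (cases vo)
    case None
    have "?S \<le> 1 + E1" using ih mono by (cases "xs = []") simp_all
    then show ?thesis using None by simp
  next
    case (Some u)
    have r: "(map label es, u) \<in> thompson_rels" using vx x Some by (simp add: valid_item_def)
    show ?thesis
    proof (cases "cell_change (leaf_cell (Suc k)) es u = 0")
      case True
      have d: "(real (length u) - real (length es))\<^sup>2 = 1" using r by (auto simp: rel_iff)
      have "(?\<alpha> (p = []) (xs = []) es u)\<^sup>2 = (of_bool (xs = []) - 2 * of_bool (p = []))\<^sup>2"
        using True d by (simp add: weight_change_def power_mult_distrib)
      then show ?thesis using ih mono Some by (cases "p = []"; cases "xs = []") simp_all
    next
      case False
      from cell_change_leaf_cell_nonzero[OF False] have c: "es = [?e] \<or> es = [?p, leaf_right (Suc k)]" by auto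
      have "p \<noteq> []"
      proof
        assume "p = []"
        then have "leftmost (hd es)" using leftmost_hd[OF n] es by simp
        then show False using c not_extreme by auto
      qed
      moreover have "xs \<noteq> []"
      proof
        assume "xs = []"
        then have "rightmost (last es)" using rightmost_last[OF n] es by simp
        then show False using c not_extreme by auto
      qed
      ultimately have "(?\<alpha> (p = []) (xs = []) es u)\<^sup>2 = \<epsilon>\<^sup>2 * (cell_change (leaf_cell (Suc k)) es u)\<^sup>2"
        by (simp add: weight_change_def power_mult_distrib)
      also have "\<dots> \<le> \<epsilon>\<^sup>2 * 1"
        using abs_cell_change by (intro mult_left_mono) (simp_all add: abs_square_le_1)
      finally have a: "(?\<alpha> (p = []) (xs = []) es u)\<^sup>2 \<le> \<epsilon>\<^sup>2" by simp
      have "of_bool (?e \<in> set ?T) + of_bool (?p \<in> set ?T) + 1 \<le>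
          (of_bool (?e \<in> set es \<union> set ?T) + of_bool (?p \<in> set es \<union> set ?T) :: real)"
        using c dist by auto
      from mult_left_mono[OF this, of "\<epsilon>\<^sup>2"] have "E0 + \<epsilon>\<^sup>2 \<le> E1"
        unfolding E0_def E1_def by (simp only: distrib_left mult_1_right zero_le_power2)
      then show ?thesis using a ih \<open>p \<noteq> []\<close> \<open>xs \<noteq> []\<close> Some by simp
    qed
  qed
  then show ?case unfolding split set_T E1_def .
qed simp

lemma mean_weight_lipschitz:
  "item_string [X] y z l \<Longrightarrow> mean (weight (Suc k) \<epsilon>) z - mean (weight (Suc k) \<epsilon>) y \<le> sqrt (5 + 2 * \<epsilon>\<^sup>2) * l"
proof (rule mean_lipschitz[OF weight_att])
  fix xs :: "letter item list" assume xs: "cubing [X] xs"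
  let ?T = "set (concat (map (fst \<circ> snd) xs))"
  have "(\<Sum>i<length xs. (coefs (weight_change (Suc k) \<epsilon>) True xs ! i)\<^sup>2) \<le>
      5 + \<epsilon>\<^sup>2 * (of_bool (leaf (Suc k) \<in> ?T) + of_bool (leaf_left (Suc k) \<in> ?T))"
    using sum_coefs[of "[]" xs k \<epsilon>] xs by (simp add: cubing_def)
  also have "\<dots> \<le> 5 + \<epsilon>\<^sup>2 * 2" by (intro add_left_mono mult_left_mono) auto
  finally show "(\<Sum>i<length xs. (coefs (weight_change (Suc k) \<epsilon>) True xs ! i)\<^sup>2) \<le> (sqrt (5 + 2 * \<epsilon>\<^sup>2))\<^sup>2"
    by (simp add: add_nonneg_nonneg)
qed simp_all

text \<open>The constant 5 is 1 for the right height plus (-2) times the change -2 of the left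
  height.\<close>

lemma mean_weight_act:
  assumes "cubing [X] xs"
  shows "mean (weight k \<epsilon>) (diagram_act par (point [X] xs)) - mean (weight k \<epsilon>) (point [X] xs) =
    5 + \<epsilon> * (mean (has_cell (leaf_cell k)) (diagram_act par (point [X] xs)) - mean (has_cell (leaf_cell k)) (point [X] xs))"
proof -
  let ?E = "expect (map item_block xs)" and ?h = "has_cell (leaf_cell k)"
  have "?E (\<lambda>B. weight k \<epsilon> (map par_act B)) =
      ?E (\<lambda>B. (weight k \<epsilon> B + - \<epsilon> * ?h B) + (5 + \<epsilon> * ?h (map par_act B)))"
  proof (rule expect_cong)
    fix B assume "B \<in> outcomes (map item_block xs)"
    from cubing_outcomes[OF assms this] show "weight k \<epsilon> (map par_act B) =
        (weight k \<epsilon> B + - \<epsilon> * ?h B) + (5 + \<epsilon> * ?h (map par_act B))"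
      using right_height_par_act[of B] left_height_par_act[of B] right_height_par_bot left_height_par_bot by (simp add: weight_def)
  qed
  also have "\<dots> = (?E (weight k \<epsilon>) + - \<epsilon> * ?E ?h) + (5 + \<epsilon> * ?E (\<lambda>B. ?h (map par_act B)))"
    by (simp only: expect_add expect_cmult expect_const)
  finally show ?thesis
    using expect_act_items[OF npath_par_bot label_par_bot assms]
    by (simp add: diagram_act_point[OF npath_par_bot label_par_bot assms] mean_point algebra_simps)
qed

section \<open>Hyperplanes crossed by an orbit\<close>

lemma npath_par_act_pow: "npath [X] B \<Longrightarrow> npath [X] (map (par_act ^^ k) B)"
proof (induction k)
  case (Suc k)
  then show ?case using npath_par_act[of "map (par_act ^^ k) B"] by (simp add: comp_def)
qed simp

lemma map_par_act_pow_att: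
  assumes "npath [X] (p @ es @ q)" "(map label es, v) \<in> thompson_rels"
  shows "map (par_act ^^ k) (att es v) = att (map (par_act ^^ k) es) v"
proof (induction k)
  case (Suc k)
  have "npath [X] (map (par_act ^^ k) p @ map (par_act ^^ k) es @ map (par_act ^^ k) q)"
    using npath_par_act_pow[OF assms(1), of k] by simp
  from map_par_act_att[OF this rel_map[OF assms(2)]] Suc show ?case
    by (metis funpow.simps(2) map_map)
qed simp

lemma par_act_pow:
  "(par_act ^^ j) (leaf (Suc k)) = leaf (Suc (k + j))" "(par_act ^^ j) (leaf_left (Suc k)) = leaf_left (Suc (k + j))"
  "(par_act ^^ j) (comb 0) = comb j" "(par_act ^^ j) (spine (Suc 0)) = spine (Suc j)"
proof -
  show "(par_act ^^ j) (leaf (Suc k)) = leaf (Suc (k + j))" by (induction j) (simp_all add: par_act_leaf)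
  show "(par_act ^^ j) (leaf_left (Suc k)) = leaf_left (Suc (k + j))" by (induction j) (simp_all add: par_act_leaf_left)
  show "(par_act ^^ j) (comb 0) = comb j" by (induction j) (simp_all add: par_act_comb del: comb.simps)
  show "(par_act ^^ j) (spine (Suc 0)) = spine (Suc j)" by (induction j) (simp_all add: par_act_spine del: spine.simps)
qed

text \<open>An orbit meets these two edges at most once, because from then on its index is
  larger.\<close>

lemma eventually_avoids: "\<exists>k0. \<forall>k\<ge>k0. (par_act ^^ k) e \<noteq> leaf (Suc K) \<and> (par_act ^^ k) e \<noteq> leaf_left (Suc K)"
proof (cases "\<exists>k. (par_act ^^ k) e = leaf (Suc K) \<or> (par_act ^^ k) e = leaf_left (Suc K)")
  case True
  then obtain k where k: "(par_act ^^ k) e = leaf (Suc K) \<or> (par_act ^^ k) e = leaf_left (Suc K)" by blast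
  have "(par_act ^^ m) e \<noteq> leaf (Suc K) \<and> (par_act ^^ m) e \<noteq> leaf_left (Suc K)" if ge: "m \<ge> Suc k" for m
  proof -
    obtain j where "m = Suc k + j" using le_Suc_ex[OF ge] by blast
    then have m: "m = Suc j + k" by simp
    have "(par_act ^^ m) e = (par_act ^^ Suc j) ((par_act ^^ k) e)" unfolding m by (simp add: funpow_add)
    then have "(par_act ^^ m) e = leaf (Suc (K + Suc j)) \<or> (par_act ^^ m) e = leaf_left (Suc (K + Suc j))"
      using k par_act_pow(1,2)[of "Suc j" K] by metis
    then show ?thesis by auto
  qed
  then show ?thesis by blast
qed blast

text \<open>A move changes the indicator only if it starts at \<open>leaf\<close> or at
  \<open>leaf_left\<close> of the given index, so it suffices to watch the orbit of the first edge
  of \<open>es\<close>.\<close>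

lemma has_cell_att_eventually:
  assumes "npath [X] (p @ es @ q)" "(map label es, v) \<in> thompson_rels"
  shows "\<exists>k0. \<forall>k\<ge>k0. has_cell (leaf_cell (Suc K)) (map (par_act ^^ k) (p @ att es v @ q)) =
    has_cell (leaf_cell (Suc K)) (map (par_act ^^ k) (p @ es @ q))"
proof -
  obtain k0 where k0: "\<And>k. k \<ge> k0 \<Longrightarrow> (par_act ^^ k) (hd es) \<noteq> leaf (Suc K) \<and> (par_act ^^ k) (hd es) \<noteq> leaf_left (Suc K)"
    using eventually_avoids by metis
  have es: "es \<noteq> []" using assms(2) by (auto simp: rel_iff)
  have "has_cell (leaf_cell (Suc K)) (map (par_act ^^ k) (p @ att es v @ q)) =
    has_cell (leaf_cell (Suc K)) (map (par_act ^^ k) (p @ es @ q))" if "k \<ge> k0" for k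
  proof -
    let ?es = "map (par_act ^^ k) es"
    have n: "npath [X] (map (par_act ^^ k) p @ ?es @ map (par_act ^^ k) q)"
      using npath_par_act_pow[OF assms(1), of k] by simp
    have "hd ?es \<noteq> leaf (Suc K)" "hd ?es \<noteq> leaf_left (Suc K)" using k0[OF that] es by (simp_all add: hd_map)
    then have "cell_change (leaf_cell (Suc K)) ?es v = 0" using cell_change_leaf_cell_nonzero by fastforce
    then show ?thesis
      using has_cell_att[OF n rel_map[OF assms(2)] leaf_cell_not_inverse, of "Suc K"]
      by (simp add: map_par_act_pow_att[OF assms])
  qed
  then show ?thesis by blast
qed

lemma leaf_cell_in_comb: "Suc K \<le> k \<Longrightarrow> leaf_cell (Suc K) \<in> edge_cells (comb k)"
proof (induction k)
  case (Suc k)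
  have j: "edge_cells a \<subseteq> edge_cells (merge a b)" "edge_cells b \<subseteq> edge_cells (merge a b)" for a b
    by (auto simp: merge_def)
  have "leaf_cell (Suc k) \<in> edge_cells (leaf_left (Suc k))" by (simp add: leaf_cell_def leaf_left_def lhalf_def)
  then have "leaf_cell (Suc k) \<in> edge_cells (comb (Suc k))" using j by fastforce
  moreover have "edge_cells (comb k) \<subseteq> edge_cells (comb (Suc k))"
    unfolding comb.simps by (rule subset_trans[OF j(1) j(1)])
  ultimately show ?case using Suc by (cases "Suc K = Suc k") auto
qed simp

text \<open>The base vertex is one move away from \<open>[leaf 0, spine 1]\<close>, whose
  \<open>k\<close>-th image starts with \<open>comb k\<close> and so contains the leaf cells 1 to
  \<open>k\<close>. Any vertex is finitely many moves away, and each of these eventually has no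
  effect on the indicator.\<close>

lemma eventually_has_cell:
  "npath [X] B \<Longrightarrow> \<exists>k0. \<forall>k\<ge>k0. has_cell (leaf_cell (Suc K)) (map (par_act ^^ k) B) = 1"
proof (induction rule: npath_induct)
  case word
  have n: "npath [X] ([] @ [spine 0] @ [])" using npath_vine[of 0] by simp
  have "(map label [spine 0], [X, X]) \<in> thompson_rels" by (simp add: rel_iff)
  from has_cell_att_eventually[OF n this, of K] obtain k0 where k0: "\<And>k. k \<ge> k0 \<Longrightarrow>
    has_cell (leaf_cell (Suc K)) (map (par_act ^^ k) [leaf 0, spine (Suc 0)]) = has_cell (leaf_cell (Suc K)) (map (par_act ^^ k) [spine 0])"
    unfolding att_spine append_Nil append_Nil2 by blast
  have "has_cell (leaf_cell (Suc K)) (map (par_act ^^ k) [leaf 0, spine (Suc 0)]) = 1" if "k \<ge> Suc K" for k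
    using leaf_cell_in_comb[OF that] par_act_pow(3)[of k] by (simp add: has_cell_def del: spine.simps)
  then have "has_cell (leaf_cell (Suc K)) (map (par_act ^^ k) [spine 0]) = 1" if "k \<ge> max k0 (Suc K)" for k
    using k0 that by (metis max.bounded_iff)
  then show ?case unfolding path_of_word_X by blast
next
  case (att p es q v)
  obtain k0 where k0: "\<And>k. k \<ge> k0 \<Longrightarrow> has_cell (leaf_cell (Suc K)) (map (par_act ^^ k) (p @ att es v @ q)) =
    has_cell (leaf_cell (Suc K)) (map (par_act ^^ k) (p @ es @ q))" using has_cell_att_eventually[OF att.hyps] by metis
  obtain k1 where "\<And>k. k \<ge> k1 \<Longrightarrow> has_cell (leaf_cell (Suc K)) (map (par_act ^^ k) (p @ es @ q)) = 1"
    using att.IH by blast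
  with k0 have "has_cell (leaf_cell (Suc K)) (map (par_act ^^ k) (p @ att es v @ q)) = 1" if "k \<ge> max k0 k1" for k
    using that by (metis max.bounded_iff)
  then show ?case by blast
qed

lemma act_pow_point:
  assumes "cubing [X] xs"
  shows "cubing [X] ((act_items par_act ^^ k) xs)"
    and "(diagram_act par ^^ k) (point [X] xs) = point [X] ((act_items par_act ^^ k) xs)"
proof -
  have "cubing [X] ((act_items par_act ^^ k) xs) \<and>
    (diagram_act par ^^ k) (point [X] xs) = point [X] ((act_items par_act ^^ k) xs)"
    by (induction k) (simp_all add: assms act_cubing[OF npath_par_bot label_par_bot]
        diagram_act_point[OF npath_par_bot label_par_bot])
  then show "cubing [X] ((act_items par_act ^^ k) xs)"
    "(diagram_act par ^^ k) (point [X] xs) = point [X] ((act_items par_act ^^ k) xs)" by simp_all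
qed

lemma mean_act_pow:
  assumes "cubing [X] xs"
  shows "mean f ((diagram_act par ^^ k) (point [X] xs)) = expect (map item_block xs) (\<lambda>B. f (map (par_act ^^ k) B))"
proof -
  have "expect (map item_block ((act_items par_act ^^ k) xs)) f = expect (map item_block xs) (\<lambda>B. f (map (par_act ^^ k) B))"
  proof (induction k arbitrary: f)
    case (Suc k)
    show ?case
      using Suc[of "\<lambda>B. f (map par_act B)"] expect_act_items[OF npath_par_bot label_par_bot act_pow_point(1)[OF assms, of k], of f]
      by (simp add: comp_def)
  qed simp
  then show ?thesis by (simp add: act_pow_point(2)[OF assms] mean_point)
qed

text \<open>The finitely many vertices carrying the point contain only finitely many cells, so for
  some index the mean is 0 at the start. It is eventually 1 along the orbit and has to change at
  some step.\<close>

lemma ex_moved_hyperplane: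
  assumes xs: "cubing [X] xs"
  obtains K k where "mean (has_cell (leaf_cell (Suc K))) ((diagram_act par ^^ Suc k) (point [X] xs)) \<noteq>
    mean (has_cell (leaf_cell (Suc K))) ((diagram_act par ^^ k) (point [X] xs))"
proof -
  let ?O = "outcomes (map item_block xs)"
  let ?A = "\<Union>B\<in>?O. \<Union>(edge_cells ` set B)"
  have "finite ?A" by (intro finite_UN_I) (simp_all add: finite_edge_cells)
  moreover have "inj (\<lambda>K. leaf_cell (Suc K))" by (auto simp: inj_on_def)
  ultimately have "finite ((\<lambda>K. leaf_cell (Suc K)) -` ?A)" by (rule finite_vimageI)
  from ex_new_if_finite[OF infinite_UNIV_nat this] obtain K where K: "leaf_cell (Suc K) \<notin> ?A"
    unfolding vimage_eq by (rule exE)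
  let ?m = "\<lambda>k. mean (has_cell (leaf_cell (Suc K))) ((diagram_act par ^^ k) (point [X] xs))"
  have "?m 0 = expect (map item_block xs) (\<lambda>B. 0)"
    unfolding mean_act_pow[OF xs] by (rule expect_cong) (use K in \<open>auto simp: has_cell_def\<close>)
  then have m0: "?m 0 = 0" by simp
  have "\<forall>B\<in>?O. \<exists>k0. \<forall>k\<ge>k0. has_cell (leaf_cell (Suc K)) (map (par_act ^^ k) B) = 1"
    using eventually_has_cell cubing_outcomes[OF xs] by blast
  then obtain k0 where k0: "\<And>B k. B \<in> ?O \<Longrightarrow> k \<ge> k0 B \<Longrightarrow> has_cell (leaf_cell (Suc K)) (map (par_act ^^ k) B) = 1"
    by metis
  let ?k = "Max (insert 0 (k0 ` ?O))"
  have "?m ?k = expect (map item_block xs) (\<lambda>B. 1)"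
    unfolding mean_act_pow[OF xs] by (rule expect_cong, rule k0) auto
  then have m1: "?m ?k = 1" by simp
  have "\<exists>k. ?m (Suc k) \<noteq> ?m k"
  proof (rule ccontr)
    assume "\<not> ?thesis"
    then have "?m n = ?m 0" for n by (induction n) metis+
    from this[of ?k] show False using m0 m1 by linarith
  qed
  then show thesis using that by blast
qed

section \<open>The strict lower bound\<close>

abbreviation (input) "par_complex \<equiv> cube_complex thompson_rels [X]"
abbreviation (input) "par_dist \<equiv> complex_dist thompson_rels [X]"

lemma dist_act_pow:
  assumes "y \<in> par_complex"
  shows "(diagram_act par ^^ k) y \<in> par_complex"
    "par_dist ((diagram_act par ^^ k) y) ((diagram_act par ^^ Suc k) y) = par_dist y (diagram_act par y)"
proof -
  have c: "diagram_act par z \<in> par_complex" if "z \<in> par_complex" for z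
    using isometry_par that by (auto simp: isometry_of_def bij_betw_def)
  have i: "par_dist (diagram_act par y) (diagram_act par z) = par_dist y z" if "y \<in> par_complex" "z \<in> par_complex" for y z
    using isometry_par that by (simp add: isometry_of_def)
  show k: "(diagram_act par ^^ k) y \<in> par_complex" for k by (induction k) (simp_all add: assms c)
  show "par_dist ((diagram_act par ^^ k) y) ((diagram_act par ^^ Suc k) y) = par_dist y (diagram_act par y)"
  proof (induction k)
    case (Suc k)
    then show ?case using i[OF k[of k] k[of "Suc k"]] by simp
  qed simp
qed

text \<open>The hyperplane may move only at a later point of the orbit of \<open>y\<close>, but all
  points of the orbit have the same displacement.\<close>

lemma dist_act_gt:
  assumes "y \<in> par_complex"
  shows "par_dist y (diagram_act par y) > sqrt 5"
proof -
  obtain xs where xs: "y = point [X] xs" "cubing [X] xs" using assms cube_complex_eq by blast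
  obtain K k where K: "mean (has_cell (leaf_cell (Suc K))) ((diagram_act par ^^ Suc k) (point [X] xs)) \<noteq>
    mean (has_cell (leaf_cell (Suc K))) ((diagram_act par ^^ k) (point [X] xs))"
    using ex_moved_hyperplane[OF xs(2)] .
  define ys where "ys = (act_items par_act ^^ k) xs"
  have ys: "cubing [X] ys" "(diagram_act par ^^ k) y = point [X] ys"
    unfolding ys_def xs(1) by (rule act_pow_point[OF xs(2)])+
  let ?z = "point [X] ys"
  define \<delta> where "\<delta> = mean (has_cell (leaf_cell (Suc K))) (diagram_act par ?z) - mean (has_cell (leaf_cell (Suc K))) ?z"
  have \<delta>: "\<delta> \<noteq> 0" using K ys(2) unfolding \<delta>_def by (simp add: xs(1))
  have pos: "0 < 5 + 2 * \<delta>\<^sup>2" by (simp add: add_pos_nonneg)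
  have low: "(5 + \<delta>\<^sup>2) / sqrt (5 + 2 * \<delta>\<^sup>2) \<le> l" if "item_string [X] ?z (diagram_act par ?z) l" for l
  proof -
    \<comment> \<open>Taking \<epsilon> = \<delta> makes the increment 5 + \<delta>^2, whatever the
      sign of \<delta>.\<close>
    have "5 + \<delta>\<^sup>2 \<le> sqrt (5 + 2 * \<delta>\<^sup>2) * l"
      using mean_weight_lipschitz[OF that, of K \<delta>] mean_weight_act[OF ys(1), of "Suc K" \<delta>]
      by (simp add: \<delta>_def[symmetric] power2_eq_square)
    then show ?thesis using pos by (simp add: divide_le_eq mult.commute)
  qed
  have "cubing [X] (act_items par_act ys)" by (rule act_cubing[OF npath_par_bot label_par_bot ys(1)])
  then have "{l. item_string [X] ?z (diagram_act par ?z) l} \<noteq> {}"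
    using item_string_exists[OF ys(1)] diagram_act_point[OF npath_par_bot label_par_bot ys(1)] by auto
  \<comment> \<open>The infimum preserves only a weak inequality; this suffices since the bound
    itself exceeds sqrt 5.\<close>
  then have "(5 + \<delta>\<^sup>2) / sqrt (5 + 2 * \<delta>\<^sup>2) \<le> par_dist ?z (diagram_act par ?z)"
    unfolding complex_dist_eq by (rule cInf_greatest) (use low in blast)
  moreover have "sqrt 5 < (5 + \<delta>\<^sup>2) / sqrt (5 + 2 * \<delta>\<^sup>2)"
  proof -
    \<comment> \<open>The two sides differ by \<delta>^4.\<close>
    have "5 * (5 + 2 * \<delta>\<^sup>2) < (5 + \<delta>\<^sup>2)\<^sup>2"
      using \<delta> by (simp add: power2_sum power2_eq_square[of "\<delta>\<^sup>2"])
    then have "sqrt (5 * (5 + 2 * \<delta>\<^sup>2)) < 5 + \<delta>\<^sup>2"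
      by (intro real_less_lsqrt) (simp_all add: add_nonneg_nonneg)
    then have "sqrt 5 * sqrt (5 + 2 * \<delta>\<^sup>2) < 5 + \<delta>\<^sup>2" by (simp only: real_sqrt_mult)
    then show ?thesis using pos by (simp add: less_divide_eq)
  qed
  moreover have "par_dist ?z (diagram_act par ?z) = par_dist y (diagram_act par y)"
    using dist_act_pow(2)[OF assms, of k] ys(2) by simp
  ultimately show ?thesis by simp
qed

section \<open>Points of small displacement\<close>

definition sq_dist :: "'a item list \<Rightarrow> 'a item list \<Rightarrow> real" where
  "sq_dist xs ys = (\<Sum>i<length xs. (fst (xs ! i) - fst (ys ! i))\<^sup>2)"

lemma sq_dist_Cons: "sq_dist (x # xs) (y # ys) = (fst x - fst y)\<^sup>2 + sq_dist xs ys"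
  by (simp add: sq_dist_def sum.lessThan_Suc_shift del: sum.lessThan_Suc)

lemma sq_dist_append:
  "length xs = length ys \<Longrightarrow> sq_dist (xs @ xs') (ys @ ys') = sq_dist xs ys + sq_dist xs' ys'"
  by (induction xs ys rule: list_induct2) (simp_all add: sq_dist_Cons, simp add: sq_dist_def)

lemma item_dist_sq: "item_dist xs ys = sqrt (sq_dist xs ys)"
  by (simp add: item_dist_def sq_dist_def)

text \<open>The queue of emitted leaves on their way to the left end, each with the progress of its
  own split.\<close>

definition splits :: "nat \<Rightarrow> (nat \<Rightarrow> real) \<Rightarrow> nat \<Rightarrow> letter item list" where
  "splits n \<sigma> m = map (\<lambda>i. (\<sigma> i, [leaf (m + i)], Some [X, X])) [0..<n]"

definition last_split :: "nat \<Rightarrow> real \<Rightarrow> letter item list" where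
  "last_split m t = [(t, [spine m], Some [X, X])]"

text \<open>Both merges of a period use the edge at the left end, so they lie in different cubes. In
  this one \<open>comb 0\<close> absorbs the left half of \<open>leaf 1\<close>, in
  \<open>second_half\<close> the right half.\<close>

definition first_half :: "nat \<Rightarrow> real \<Rightarrow> (nat \<Rightarrow> real) \<Rightarrow> real \<Rightarrow> letter item list" where
  "first_half n s \<sigma> t = (s, [comb 0, leaf_left 1], Some [X]) # (0, [leaf_right 1], None) # splits n \<sigma> 2 @ last_split (n + 2) t"

definition second_half :: "nat \<Rightarrow> real \<Rightarrow> (nat \<Rightarrow> real) \<Rightarrow> real \<Rightarrow> letter item list" where
  "second_half n s \<sigma> t = (s, [merge (comb 0) (leaf_left 1), leaf_right 1], Some [X]) # splits n \<sigma> 2 @ last_split (n + 2) t"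

lemma length_splits [simp]: "length (splits n \<sigma> m) = n" "length (last_split m t) = 1"
  by (simp_all add: splits_def last_split_def)

lemma concat_splits: "concat (map (fst \<circ> snd) (splits n \<sigma> m)) = map leaf [m..<m + n]"
  by (induction n) (simp_all add: splits_def)

lemma sq_dist_splits: "sq_dist (splits n \<sigma> m) (splits n \<sigma>' m) = (\<Sum>i<n. (\<sigma> i - \<sigma>' i)\<^sup>2)"
  by (simp add: sq_dist_def splits_def)

lemma valid_splits: "(\<And>i. i < n \<Longrightarrow> \<sigma> i \<in> {0..1}) \<Longrightarrow> \<forall>x\<in>set (splits n \<sigma> m). valid_item x"
  by (auto simp: splits_def valid_item_def rel_iff)

lemma npath_first_half: "npath [X] ([comb 0, leaf_left 1, leaf_right 1] @ map leaf [2..<n + 2] @ [spine (n + 2)])"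
proof -
  have "map leaf [0..<n + 2] = [leaf 0, leaf 1] @ map leaf [2..<n + 2]"
    by (simp add: upt_conv_Cons numeral_2_eq_2)
  then have "npath [X] ([leaf 0] @ [leaf 1] @ (map leaf [2..<n + 2] @ [spine (n + 2)]))"
    using npath_vine[of "n + 2"] by simp
  from npath_split[OF this] show ?thesis by simp
qed

lemma npath_second_half: "npath [X] ([merge (comb 0) (leaf_left 1), leaf_right 1] @ map leaf [2..<n + 2] @ [spine (n + 2)])"
  using npath_merge[of "[X]" "[]" "comb 0" "leaf_left 1" "leaf_right 1 # map leaf [2..<n + 2] @ [spine (n + 2)]"] npath_first_half[of n]
  by (simp add: leaf_left_def)

lemma cubing_halves:
  assumes "s \<in> {0..1}" "\<And>i. i < n \<Longrightarrow> \<sigma> i \<in> {0..1}" "t \<in> {0..1}"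
  shows "cubing [X] (first_half n s \<sigma> t)" "cubing [X] (second_half n s \<sigma> t)"
proof -
  have v: "\<forall>x\<in>set (splits n \<sigma> 2). valid_item x" using valid_splits[of n \<sigma> 2] assms(2) by blast
  show "cubing [X] (first_half n s \<sigma> t)"
    using v assms npath_first_half[of n] concat_splits[of n \<sigma> 2]
    by (auto simp: cubing_def first_half_def last_split_def valid_item_def rel_iff add.commute)
  show "cubing [X] (second_half n s \<sigma> t)"
    using v assms npath_second_half[of n] concat_splits[of n \<sigma> 2]
    by (auto simp: cubing_def second_half_def last_split_def valid_item_def rel_iff add.commute)
qed

lemma dist_halves:
  "item_dist (first_half n s \<sigma> t) (first_half n s' \<sigma>' t') = sqrt ((s - s')\<^sup>2 + (\<Sum>i<n. (\<sigma> i - \<sigma>' i)\<^sup>2) + (t - t')\<^sup>2)"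
  "item_dist (second_half n s \<sigma> t) (second_half n s' \<sigma>' t') = sqrt ((s - s')\<^sup>2 + (\<Sum>i<n. (\<sigma> i - \<sigma>' i)\<^sup>2) + (t - t')\<^sup>2)"
  by (simp_all add: item_dist_sq first_half_def second_half_def sq_dist_Cons sq_dist_append sq_dist_splits)
    (simp_all add: last_split_def sq_dist_def)

lemma map_snd_halves:
  "map snd (first_half n s \<sigma> t) = map snd (first_half n s' \<sigma>' t')"
  "map snd (second_half n s \<sigma> t) = map snd (second_half n s' \<sigma>' t')"
  by (simp_all add: first_half_def second_half_def splits_def last_split_def)

text \<open>The two cubes meet in the face where the first merge is complete and the second has not
  begun.\<close>

lemma point_first_second: "point [X] (first_half n 1 \<sigma> t) = point [X] (second_half n 0 \<sigma> t)"
  by (rule ext) (simp add: point_def first_half_def second_half_def item_block_def leaf_left_def)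

lemma act_first_half:
  "act_items par_act (first_half n s \<sigma> t) =
    (s, [comb 1, leaf_left 2], Some [X]) # (0, [leaf_right 2], None) # splits n \<sigma> 3 @ last_split (n + 3) t"
proof -
  have "act_items par_act (splits n \<sigma> 2) = splits n \<sigma> 3"
  proof -
    have "par_act (leaf (2 + i)) = leaf (3 + i)" for i using par_act_leaf[of "Suc i"] by (simp add: numeral_2_eq_2 numeral_3_eq_3)
    then show ?thesis by (simp add: act_items_def splits_def)
  qed
  moreover have "act_items par_act (last_split (n + 2) t) = last_split (n + 3) t"
    using par_act_spine[of "Suc n"] by (simp add: last_split_def numeral_2_eq_2 numeral_3_eq_3 del: spine.simps)
  moreover have "par_act (comb 0) = comb 1" "par_act (leaf_left 1) = leaf_left 2" "par_act (leaf_right 1) = leaf_right 2"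
    using par_act_comb[of 0] par_act_leaf_left[of 0] par_act_leaf_right[of 0] by (simp_all add: numeral_2_eq_2)
  ultimately show ?thesis by (simp add: first_half_def del: comb.simps)
qed

text \<open>After one period the queue has moved up by one place: its oldest leaf is completely
  split, every other leaf has the former progress of its predecessor, and the leaf just emitted has
  progress 0.\<close>

lemma point_second_act:
  assumes "\<sigma> 0 = 1" "\<And>i. i < n \<Longrightarrow> \<sigma> (Suc i) = \<tau> i" "\<tau> n = 0"
  shows "point [X] (second_half (Suc n) 1 \<sigma> 1) = point [X] (act_items par_act (first_half (Suc n) 0 \<tau> 0))"
proof -
  let ?E = "expect (map item_block (splits n \<tau> 3))"
  have s1: "splits (Suc n) \<sigma> 2 = (1, [leaf 2], Some [X, X]) # splits n \<tau> 3"
  proof -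
    have "splits (Suc n) \<sigma> 2 = (\<sigma> 0, [leaf (2 + 0)], Some [X, X]) #
        map (\<lambda>i. (\<sigma> (Suc i), [leaf (2 + Suc i)], Some [X, X])) [0..<n]"
      unfolding splits_def by (simp add: upt_conv_Cons map_Suc_upt[symmetric] comp_def del: upt_Suc)
    then show ?thesis using assms by (simp add: splits_def)
  qed
  have s2: "splits (Suc n) \<tau> 3 = splits n \<tau> 3 @ [(0, [leaf (Suc (Suc (Suc n)))], Some [X, X])]"
    using assms(3) by (simp add: splits_def numeral_3_eq_3)
  have z: "att [spine (Suc (Suc (Suc n)))] [X, X] = [leaf (Suc (Suc (Suc n))), spine (Suc (Suc (Suc (Suc n))))]"
    unfolding att_spine by simp
  have n: "Suc n + 2 = Suc (Suc (Suc n))" "Suc n + 3 = Suc (Suc (Suc (Suc n)))" by simp_all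
  show ?thesis
  proof
    fix W
    let ?m = "\<lambda>B. of_bool (mk_diagram [X] B = W)"
    have "point [X] (second_half (Suc n) 1 \<sigma> 1) W = ?E (\<lambda>r. ?m ([comb 1, leaf_left 2, leaf_right 2] @ r @ [leaf (Suc (Suc (Suc n))), spine (Suc (Suc (Suc (Suc n))))]))"
      unfolding point_def second_half_def s1 n last_split_def
      by (simp add: item_block_def[of "(_, _, _)"] expect_append z comb.simps(2)[of 0, symmetric]
          del: spine.simps comb.simps)
    moreover have "point [X] (act_items par_act (first_half (Suc n) 0 \<tau> 0)) W =
        ?E (\<lambda>r. ?m ([comb 1, leaf_left 2, leaf_right 2] @ r @ [leaf (Suc (Suc (Suc n))), spine (Suc (Suc (Suc (Suc n))))]))"
      unfolding point_def act_first_half s2 n last_split_def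
      by (simp add: item_block_def[of "(_, _, _)"] expect_append del: spine.simps comb.simps)
    ultimately show "point [X] (second_half (Suc n) 1 \<sigma> 1) W =
        point [X] (act_items par_act (first_half (Suc n) 0 \<tau> 0)) W" by simp
  qed
qed

lemma ex_small_displacement: "\<exists>y\<in>par_complex. par_dist y (diagram_act par y) \<le> sqrt (5 + 1 / real (Suc n))"
proof -
  define N where "N = Suc n"
  have N: "real N > 0" by (simp add: N_def)
  \<comment> \<open>Progress falls linearly along the queue, from n / N for the oldest leaf to 0 for
    the youngest, so moving up one place costs each leaf the same amount 1 / N. The function
    \<sigma> is halfway between the initial \<tau> and the final \<rho>.\<close>
  define \<tau> where "\<tau> = (\<lambda>i. (real n - real i) / real N)"
  define \<sigma> where "\<sigma> = (\<lambda>i. \<tau> i + 1 / (2 * real N))"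
  define \<rho> where "\<rho> = (\<lambda>i. \<tau> i + 1 / real N)"
  have r: "\<tau> i \<in> {0..1}" "\<sigma> i \<in> {0..1}" "\<rho> i \<in> {0..1}" if "i < N" for i
  proof -
    have "0 \<le> \<tau> i" using that by (simp add: \<tau>_def N_def)
    moreover have "\<tau> i + 1 / real N = (real N - real i) / real N"
      by (simp add: \<tau>_def N_def add_divide_distrib[symmetric])
    then have "\<tau> i + 1 / real N \<le> 1" using N by (simp add: divide_le_eq)
    moreover have "0 \<le> 1 / (2 * real N)" "1 / (2 * real N) \<le> 1 / real N"
      using N by (simp_all add: field_simps)
    ultimately show "\<tau> i \<in> {0..1}" "\<sigma> i \<in> {0..1}" "\<rho> i \<in> {0..1}"
      by (auto simp: \<sigma>_def \<rho>_def)
  qed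
  have s1: "(\<Sum>i<N. (\<tau> i - \<sigma> i)\<^sup>2) = 1 / (4 * real N)"
    using N by (simp add: \<sigma>_def power_divide power2_eq_square)
  have s2: "(\<Sum>i<N. (\<sigma> i - \<rho> i)\<^sup>2) = 1 / (4 * real N)"
  proof -
    have "\<sigma> i - \<rho> i = - (1 / (2 * real N))" for i using N by (simp add: \<sigma>_def \<rho>_def field_simps)
    then show ?thesis using N by (simp add: power_divide power2_eq_square)
  qed
  let ?y = "point [X] (first_half N 0 \<tau> 0)"
  have c: "cubing [X] (first_half N 0 \<tau> 0)" "cubing [X] (first_half N 1 \<sigma> (1/2))"
    "cubing [X] (second_half N 0 \<sigma> (1/2))" "cubing [X] (second_half N 1 \<rho> 1)"
    using r by (intro cubing_halves; simp)+
  have p: "\<rho> 0 = 1" "\<tau> n = 0" "\<And>i. \<rho> (Suc i) = \<tau> i"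
    using N by (simp_all add: \<rho>_def \<tau>_def N_def field_simps)
  have "point [X] (second_half N 1 \<rho> 1) = diagram_act par ?y"
    using point_second_act[of \<rho> n \<tau>] p diagram_act_point[OF npath_par_bot label_par_bot c(1)] by (simp add: N_def)
  \<comment> \<open>The squared length of a half is 1 for the merge, 1 / 4 for half of the split at
    the right end, and N times 1 / (2 N)^2 for the queue.\<close>
  moreover have "item_string [X] ?y (point [X] (second_half N 0 \<sigma> (1/2))) (sqrt ((5 + 1 / real N) / 4))"
    using item_string_single[OF c(1,2) map_snd_halves(1)] unfolding point_first_second dist_halves s1
    by (simp add: power2_eq_square field_simps)
  moreover have "item_string [X] (point [X] (second_half N 0 \<sigma> (1/2))) (point [X] (second_half N 1 \<rho> 1))
      (sqrt ((5 + 1 / real N) / 4))"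
    using item_string_single[OF c(3,4) map_snd_halves(2)] unfolding dist_halves s2
    by (simp add: power2_eq_square field_simps)
  ultimately have "item_string [X] ?y (diagram_act par ?y) (sqrt ((5 + 1 / real N) / 4) + sqrt ((5 + 1 / real N) / 4))"
    using item_string_trans by metis
  moreover have "sqrt ((5 + 1 / real N) / 4) + sqrt ((5 + 1 / real N) / 4) = sqrt (5 + 1 / real N)"
    by (simp add: real_sqrt_divide)
  ultimately have "item_string [X] ?y (diagram_act par ?y) (sqrt (5 + 1 / real N))" by simp
  then have "par_dist ?y (diagram_act par ?y) \<le> sqrt (5 + 1 / real N)"
    unfolding complex_dist_eq by (intro cInf_lower bdd_belowI[of _ 0]) (auto dest: item_string_nonneg)
  moreover have "?y \<in> par_complex" using c(1) cube_complex_eq by blast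
  ultimately show ?thesis unfolding N_def by blast
qed

text \<open>All displacements exceed sqrt 5 but come arbitrarily close to it, so a minimal one would
  be undercut.\<close>

lemma not_attained: "\<not> attains_translation_length par_complex par_dist (diagram_act par)"
proof
  let ?S = "{par_dist z (diagram_act par z) |z. z \<in> par_complex}"
  assume "attains_translation_length par_complex par_dist (diagram_act par)"
  then obtain y where y: "y \<in> par_complex" "par_dist y (diagram_act par y) = Inf ?S"
    by (auto simp: attains_translation_length_def)
  let ?d = "par_dist y (diagram_act par y)"
  have d: "sqrt 5 < ?d" using dist_act_gt[OF y(1)] .
  have "0 \<le> sqrt (5 :: real)" by simp
  then have "0 < ?d" using d by linarith
  then have "5 < ?d\<^sup>2" using d by (metis abs_of_pos real_sqrt_abs real_sqrt_less_iff)
  then obtain n where n: "inverse (real (Suc n)) < ?d\<^sup>2 - 5"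
    using reals_Archimedean[of "?d\<^sup>2 - 5"] by auto
  obtain z where z: "z \<in> par_complex" "par_dist z (diagram_act par z) \<le> sqrt (5 + 1 / real (Suc n))"
    using ex_small_displacement by blast
  have "5 + 1 / real (Suc n) < ?d\<^sup>2" using n by (simp add: inverse_eq_divide)
  then have "sqrt (5 + 1 / real (Suc n)) < ?d" using \<open>0 < ?d\<close> by (intro real_less_lsqrt) simp_all
  moreover have "Inf ?S \<le> par_dist z (diagram_act par z)"
  proof (rule cInf_lower)
    show "bdd_below ?S" using dist_act_gt by (intro bdd_belowI[of _ "sqrt 5"]) (auto intro: less_imp_le)
  qed (use z in blast)
  ultimately show False using y(2) z(2) by linarith
qed

theorem theorem1:
  fixes D :: "letter diagram monoid"
    and K :: "(letter diagram \<Rightarrow> real) set"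
    and d :: "(letter diagram \<Rightarrow> real) \<Rightarrow> (letter diagram \<Rightarrow> real) \<Rightarrow> real"
  defines "D \<equiv> diagram_group thompson_rels [letter_x]"
    and "K \<equiv> cube_complex thompson_rels [letter_x]"
    and "d \<equiv> complex_dist thompson_rels [letter_x]"
  shows "\<not> (\<forall>g\<in>carrier D. semi_simple K d (diagram_act g)) \<and>
         (\<exists>g\<in>carrier D. parabolic K d (diagram_act g))"
  using par_carrier isometry_par not_attained unfolding D_def K_def d_def semi_simple_def parabolic_def
  by blast

end
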